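(* Let $\mathfrak g$ be a simple Lie algebra and $\alpha\in\Pi$ a simple root. For each $k=1,2,\dots,\dim\mathfrak g_\alpha(1)$, the maximal eigenvalue $\delta_\alpha(k)$ of $\mathcal C_\alpha(0)$ in $\bigwedge^k\mathfrak g_\alpha(1)$ satisfies $\delta_\alpha(k)\le k\gamma_\alpha(1)$. This upper bound is attained for a given $k$ (i.e. $\delta_\alpha(k)=k\gamma_\alpha(1)$) if and only if $\mathfrak g_\alpha(1)$ contains a $k$-dimensional abelian subspace.
   Context: The ground field $\Bbbk$ is algebraically closed of characteristic $0$. $\mathfrak g$ is a simple Lie algebra with Killing form $\Phi$, Cartan subalgebra $\mathfrak t$, root system $\Delta$, positive roots $\Delta^+$, simple roots $\Pi$. For $\gamma=\sum_{\beta\in\Pi}n_\beta\beta$ put $\mathsf{ht}_\alpha(\gamma)=n_\alpha$; $\Delta_\alpha(i)=\{\gamma\in\Delta\mid \mathsf{ht}_\alpha(\gamma)=i\}$. The $(\mathbb Z,\alpha)$-grading is $\mathfrak g=\bigoplus_{i}\mathfrak g_\alpha(i)$ with $\mathfrak g_\alpha(0)=\mathfrak t\oplus\bigoplus_{\gamma\in\Delta_\alpha(0)}\mathfrak g^\gamma$ and $\mathfrak g_\alpha(i)=\bigoplus_{\gamma\in\Delta_\alpha(i)}\mathfrak g^\gamma$ for $i\ne0$, where $\mathfrak g^\gamma$ is the root space. Each nonzero $\mathfrak g_\alpha(i)$, $i\neq 0$, is a simple $\mathfrak g_\alpha(0)$-module. $\mathcal C_\alpha(0)=\sum_j e_j'e_j\in\mathcal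 U(\mathfrak g_\alpha(0))$ is the Casimir element, where $\{e_j\},\{e'_j\}$ are bases of $\mathfrak g_\alpha(0)$ dual with respect to $\Phi|_{\mathfrak g_\alpha(0)}$; $\gamma_\alpha(1)$ is the scalar by which it acts on $\mathfrak g_\alpha(1)$. The eigenvalues of $\mathcal C_\alpha(0)$ in the $\mathfrak g_\alpha(0)$-modules $\bigwedge^k\mathfrak g_\alpha(1)$ are non-negative rational numbers. An abelian subspace of $\mathfrak g_\alpha(1)$ is a linear subspace $\mathfrak a\subset\mathfrak g_\alpha(1)$ with $[\mathfrak a,\mathfrak a]=0$. *)

theory Defs
  imports
    "HOL-Computational_Algebra.Computational_Algebra"
    "HOL-Library.Poly_Mapping"
    "HOL-Library.Function_Algebras"
begin

section \<open>Exterior powers\<close>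

text \<open>
  The free vector space on the lists of vectors is the type \<^typ>\<open>'g list \<Rightarrow>\<^sub>0 'k\<close>.
  The exterior power \<open>\<Lambda>\<^sup>k V\<close> of a subspace \<open>V\<close> is the quotient of
  \<open>ext_free V k\<close> (spanned by the symbols \<open>v\<^sub>1 \<wedge> \<dots> \<wedge> v\<^sub>k\<close> with
  \<open>v\<^sub>i \<in> V\<close>) by \<open>ext_null V k\<close> (spanned by the multilinearity relations and the
  symbols with a repeated entry). The quotient is not formed as a type; statements about it are
  made about representatives modulo \<open>ext_null V k\<close>.
\<close>

definition fscale :: "'k::field \<Rightarrow> ('b \<Rightarrow>\<^sub>0 'k) \<Rightarrow> ('b \<Rightarrow>\<^sub>0 'k)"
  where "fscale c p = Poly_Mapping.map ((*) c) p"

lemma lookup_fscale: "Poly_Mapping.lookup (fscale c p) x = c * Poly_Mapping.lookup p x"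
  unfolding fscale_def by (simp add: Poly_Mapping.map.rep_eq when_def)

global_interpretation free: vector_space "fscale :: 'k::field \<Rightarrow> ('b \<Rightarrow>\<^sub>0 'k) \<Rightarrow> ('b \<Rightarrow>\<^sub>0 'k)"
  by unfold_locales
    (auto intro!: poly_mapping_eqI simp: lookup_fscale Poly_Mapping.lookup_add algebra_simps)

definition free_extend :: "('a \<Rightarrow> ('b \<Rightarrow>\<^sub>0 'k)) \<Rightarrow> ('a \<Rightarrow>\<^sub>0 'k) \<Rightarrow> ('b \<Rightarrow>\<^sub>0 'k::field)"
  where "free_extend f p =
    (\<Sum>x\<in>Poly_Mapping.keys p. fscale (Poly_Mapping.lookup p x) (f x))"

abbreviation gen :: "'a \<Rightarrow> ('a \<Rightarrow>\<^sub>0 'k::field)"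
  where "gen x \<equiv> Poly_Mapping.single x 1"

definition tuples :: "'g set \<Rightarrow> nat \<Rightarrow> 'g list set"
  where "tuples V k = {xs. length xs = k \<and> set xs \<subseteq> V}"

definition ext_free :: "'g set \<Rightarrow> nat \<Rightarrow> ('g list \<Rightarrow>\<^sub>0 'k::field) set"
  where "ext_free V k = free.span (gen ` tuples V k)"

definition ext_null ::
    "('k::field \<Rightarrow> 'g::ab_group_add \<Rightarrow> 'g) \<Rightarrow> 'g set \<Rightarrow> nat \<Rightarrow> ('g list \<Rightarrow>\<^sub>0 'k) set"
  where "ext_null scale V k = free.span
    ({gen (xs[i := a + b]) - gen (xs[i := a]) - gen (xs[i := b]) | xs i a b.
        xs \<in> tuples V k \<and> i < k \<and> a \<in> V \<and> b \<in> V} \<union>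
     {gen (xs[i := scale c a]) - fscale c (gen (xs[i := a])) | xs i c a.
        xs \<in> tuples V k \<and> i < k \<and> a \<in> V} \<union>
     {gen xs | xs. xs \<in> tuples V k \<and> \<not> distinct xs})"

text \<open>The derivation extension
  \<open>x \<cdot> (v\<^sub>1 \<wedge> \<dots> \<wedge> v\<^sub>k) = \<Sum>\<^sub>i v\<^sub>1 \<wedge> \<dots> \<wedge> [x, v\<^sub>i] \<wedge> \<dots> \<wedge> v\<^sub>k\<close>:\<close>

definition ext_act ::
    "('g \<Rightarrow> 'g \<Rightarrow> 'g) \<Rightarrow> 'g \<Rightarrow> ('g list \<Rightarrow>\<^sub>0 'k) \<Rightarrow> ('g list \<Rightarrow>\<^sub>0 'k::field)"
  where "ext_act br x = free_extend (\<lambda>vs. \<Sum>i<length vs. gen (vs[i := br x (vs ! i)]))"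


section \<open>Lie algebras\<close>

text \<open>
  \<open>Basis\<close> is an arbitrary basis of the Lie algebra, inherited from
  \<^locale>\<open>finite_dimensional_vector_space\<close>; it only serves to compute traces.
\<close>

locale lie_algebra = finite_dimensional_vector_space scale Basis
  for scale :: "'k::{alg_closed_field, field_char_0} \<Rightarrow> 'g::ab_group_add \<Rightarrow> 'g" (infixr \<open>*s\<close> 75)
    and Basis :: "'g set" +
  fixes br :: "'g \<Rightarrow> 'g \<Rightarrow> 'g"
  assumes br_add_left: "br (x + y) z = br x z + br y z"
    and br_add_right: "br x (y + z) = br x y + br x z"
    and br_scale_left: "br (c *s x) y = c *s br x y"
    and br_scale_right: "br x (c *s y) = c *s br x y"
    and br_self: "br x x = 0"
    and jacobi: "br x (br y z) + br y (br z x) + br z (br x y) = 0"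
begin

definition ideal :: "'g set \<Rightarrow> bool"
  where "ideal I \<longleftrightarrow> subspace I \<and> (\<forall>x. \<forall>y\<in>I. br x y \<in> I)"

definition is_simple :: bool
  where "is_simple \<longleftrightarrow> (\<exists>x y. br x y \<noteq> 0) \<and> (\<forall>I. ideal I \<longrightarrow> I = {0} \<or> I = UNIV)"

definition trace :: "('g \<Rightarrow> 'g) \<Rightarrow> 'k"
  where "trace f = (\<Sum>b\<in>Basis. representation Basis (f b) b)"

definition killing :: "'g \<Rightarrow> 'g \<Rightarrow> 'k"
  where "killing x y = trace (\<lambda>z. br x (br y z))"

definition subalgebra :: "'g set \<Rightarrow> bool"
  where "subalgebra S \<longleftrightarrow> subspace S \<and> (\<forall>x\<in>S. \<forall>y\<in>S. br x y \<in> S)"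

fun lower_central :: "'g set \<Rightarrow> nat \<Rightarrow> 'g set"
  where "lower_central S 0 = S"
  | "lower_central S (Suc n) = span {br x y | x y. x \<in> S \<and> y \<in> lower_central S n}"

definition normalizer :: "'g set \<Rightarrow> 'g set"
  where "normalizer S = {x. \<forall>y\<in>S. br x y \<in> S}"

definition cartan_subalgebra :: "'g set \<Rightarrow> bool"
  where "cartan_subalgebra t \<longleftrightarrow>
    subalgebra t \<and> (\<exists>n. lower_central t n = {0}) \<and> normalizer t = t"


subsection \<open>Roots\<close>

text \<open>A linear functional on the subspace \<open>t\<close> is represented by the function that
  agrees with it on \<open>t\<close> and vanishes outside \<open>t\<close>, so that equality of
  functionals is equality of functions.\<close>

definition dual_space :: "'g set \<Rightarrow> ('g \<Rightarrow> 'k) set"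
  where "dual_space t = {f.
    (\<forall>x\<in>t. \<forall>y\<in>t. f (x + y) = f x + f y) \<and> (\<forall>c. \<forall>x\<in>t. f (c *s x) = c * f x) \<and>
    (\<forall>x. x \<notin> t \<longrightarrow> f x = 0)}"

definition root_space :: "'g set \<Rightarrow> ('g \<Rightarrow> 'k) \<Rightarrow> 'g set"
  where "root_space t \<gamma> = {x. \<forall>h\<in>t. br h x = \<gamma> h *s x}"

definition roots :: "'g set \<Rightarrow> ('g \<Rightarrow> 'k) set"
  where "roots t = {\<gamma> \<in> dual_space t. \<gamma> \<noteq> 0 \<and> root_space t \<gamma> \<noteq> {0}}"

definition int_comb :: "('g \<Rightarrow> 'k) set \<Rightarrow> (('g \<Rightarrow> 'k) \<Rightarrow> int) \<Rightarrow> 'g \<Rightarrow> 'k"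
  where "int_comb S n = (\<lambda>h. \<Sum>\<beta>\<in>S. of_int (n \<beta>) * \<beta> h)"

definition simple_roots :: "'g set \<Rightarrow> ('g \<Rightarrow> 'k) set \<Rightarrow> bool"
  where "simple_roots t S \<longleftrightarrow>
    S \<subseteq> roots t \<and> finite S \<and> \<not> module.dependent (\<lambda>c f h. c * f h) S \<and>
    (\<forall>\<gamma>\<in>roots t. \<exists>n. \<gamma> = int_comb S n \<and> ((\<forall>\<beta>\<in>S. n \<beta> \<ge> 0) \<or> (\<forall>\<beta>\<in>S. n \<beta> \<le> 0)))"

definition ht :: "('g \<Rightarrow> 'k) set \<Rightarrow> ('g \<Rightarrow> 'k) \<Rightarrow> ('g \<Rightarrow> 'k) \<Rightarrow> int"
  where "ht S \<alpha> \<gamma> = (THE i. \<exists>n. \<gamma> = int_comb S n \<and> n \<alpha> = i)"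

definition grade ::
    "'g set \<Rightarrow> ('g \<Rightarrow> 'k) set \<Rightarrow> ('g \<Rightarrow> 'k) \<Rightarrow> int \<Rightarrow> 'g set"
  where "grade t S \<alpha> i =
    span ((if i = 0 then t else {}) \<union> (\<Union>\<gamma>\<in>{\<gamma> \<in> roots t. ht S \<alpha> \<gamma> = i}. root_space t \<gamma>))"


subsection \<open>Casimir elements\<close>

text \<open>\<open>B\<close> is a basis of \<open>W\<close>, and \<open>d b\<close> is the member of the dual basis
  corresponding to \<open>b \<in> B\<close>.\<close>

definition dual_bases :: "'g set \<Rightarrow> 'g set \<Rightarrow> ('g \<Rightarrow> 'g) \<Rightarrow> bool"
  where "dual_bases W B d \<longleftrightarrow>
    independent B \<and> span B = W \<and> independent (d ` B) \<and> span (d ` B) = W \<and>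
    (\<forall>b\<in>B. \<forall>c\<in>B. killing (d b) c = (if b = c then 1 else 0))"

text \<open>The action of \<open>\<Sum> e\<^sub>j' e\<^sub>j\<close> on a module with action \<open>act\<close>:\<close>

definition casimir :: "'g set \<Rightarrow> ('g \<Rightarrow> 'g) \<Rightarrow> ('g \<Rightarrow> 'm \<Rightarrow> 'm::comm_monoid_add) \<Rightarrow> 'm \<Rightarrow> 'm"
  where "casimir B d act w = (\<Sum>b\<in>B. act (d b) (act b w))"

definition casimir_scalar :: "'g set \<Rightarrow> ('g \<Rightarrow> 'g) \<Rightarrow> 'g set \<Rightarrow> rat"
  where "casimir_scalar B d V = (THE q. \<forall>x\<in>V. casimir B d br x = of_rat q *s x)"

definition ext_eigenvalues :: "'g set \<Rightarrow> ('g \<Rightarrow> 'g) \<Rightarrow> 'g set \<Rightarrow> nat \<Rightarrow> 'k set"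
  where "ext_eigenvalues B d V k = {\<mu>. \<exists>w\<in>ext_free V k. w \<notin> ext_null scale V k \<and>
    casimir B d (ext_act br) w - fscale \<mu> w \<in> ext_null scale V k}"

text \<open>The field is not ordered; the maximum makes sense because all eigenvalues are rational,
  and this is part of the characterization below.\<close>

definition max_ext_eigenvalue :: "'g set \<Rightarrow> ('g \<Rightarrow> 'g) \<Rightarrow> 'g set \<Rightarrow> nat \<Rightarrow> rat"
  where "max_ext_eigenvalue B d V k = (THE q. of_rat q \<in> ext_eigenvalues B d V k \<and>
    (\<forall>\<mu>\<in>ext_eigenvalues B d V k. \<exists>r\<le>q. \<mu> = of_rat r))"

definition abelian_subspace :: "'g set \<Rightarrow> 'g set \<Rightarrow> bool"
  where "abelian_subspace V a \<longleftrightarrow> subspace a \<and> a \<subseteq> V \<and> (\<forall>x\<in>a. \<forall>y\<in>a. br x y = 0)"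

end

end

theory Submission
  imports Defs "HOL-Combinatorics.Permutations"
begin

text \<open>
  Write \<open>V\<close> for the piece of degree 1 of the grading, \<open>\<gamma>\<close> for the scalar by which the Casimir
  element \<open>C\<close> of the piece of degree 0 acts on \<open>V\<close>, and \<open>\<Phi>\<close> for the Killing form.

  On a product \<open>x\<^sub>1 \<and> \<dots> \<and> x\<^sub>k\<close> of elements of \<open>V\<close> the operator \<open>C\<close> is \<open>k \<gamma>\<close> plus mixed terms, one
  for each pair of positions \<open>i \<noteq> j\<close>. By invariance of \<open>\<Phi>\<close> the mixed terms for a pair depend only on
  \<open>[x\<^sub>i, x\<^sub>j]\<close> (\<open>killing_quadratic\<close>, \<open>alternating_casimir_zero\<close>). Hence the product of a basis of a
  \<open>k\<close>-dimensional abelian subspace is an eigenvector with eigenvalue \<open>k \<gamma>\<close>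
  (\<open>abelian_eigenvector\<close>).

  Over the complex numbers the mixed terms form a negative semidefinite operator for the hermitian
  form of a compact real form. The field here carries no such form, and the bound is read off
  from weights instead. Each eigenspace of \<open>C\<close> is stable under the piece of degree 0,
  so it contains a highest weight vector; its weight is the sum \<open>\<lambda>\<close> of a \<open>k\<close>-element set \<open>I\<close> of roots
  of \<open>V\<close>, and the eigenvalue is \<open>(\<lambda>, \<lambda> + 2 \<rho>)\<close>, with \<open>\<rho>\<close> half the sum of the positive
  roots of degree 0 (\<open>eigenvalue_index_set\<close>). Computing \<open>\<gamma>\<close> on each root vector \<open>e\<^sub>\<delta>\<close>,
  \<open>\<delta> \<in> I\<close>, turns \<open>k \<gamma> - (\<lambda>, \<lambda> + 2 \<rho>)\<close> into a sum of scalars by which operators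
  \<open>ad f\<^sub>\<beta> ad e\<^sub>\<beta>\<close> act on root lines. By the representation theory of \<open>sl\<^sub>2\<close> such a scalar is
  a non-negative rational number, and it vanishes only if \<open>ad e\<^sub>\<beta>\<close> kills the line
  (\<open>lowering_raising_scalar\<close>). So the bound holds, and in the case of equality the vectors \<open>e\<^sub>\<delta>\<close>,
  \<open>\<delta> \<in> I\<close>, commute and span an abelian subspace (\<open>hw_value_bound\<close>).

  The structure theory behind this starts from the nondegeneracy of \<open>\<Phi>\<close>, which the dual bases
  force: \<open>\<Phi>\<close> is not zero, and its radical is an ideal of a simple algebra (\<open>killing_nondegenerate\<close>).
  Weight spaces of nilpotent algebras and derivations being inner then
  show that a Cartan subalgebra is abelian and acts diagonalisably (\<open>t_abelian\<close>,
  \<open>ad_semisimple\<close>), and strings of weights give one-dimensional root spaces and the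
  rationality of the form on roots (\<open>rs_one_dim\<close>, \<open>root_norm\<close>). The grading is the
  eigenspace decomposition for one element \<open>cowt\<close> of the Cartan subalgebra (\<open>grade_eigenspace\<close>).
\<close>

section \<open>Linear maps and generalised eigenspaces\<close>

lemma lin_add: "Vector_Spaces.linear s1 s2 f \<Longrightarrow> f (x + y) = f x + f y"
  and lin_scale: "Vector_Spaces.linear s1 s2 f \<Longrightarrow> f (s1 c x) = s2 c (f x)"
  by (simp_all add: Vector_Spaces.linear_iff)

lemma lin_zero: "Vector_Spaces.linear s1 s2 f \<Longrightarrow> f 0 = 0"
  using lin_add[of s1 s2 f 0 0] by simp

lemma lin_diff: "Vector_Spaces.linear s1 s2 f \<Longrightarrow> f (x - y) = f x - f y"
  using lin_add[of s1 s2 f "x - y" y] by (simp add: algebra_simps)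

lemma lin_neg: "Vector_Spaces.linear s1 s2 f \<Longrightarrow> f (- x) = - f x"
  using lin_diff[of s1 s2 f 0 x] lin_zero[of s1 s2 f] by simp

lemma lin_sum: "Vector_Spaces.linear s1 s2 f \<Longrightarrow> f (sum g A) = (\<Sum>a\<in>A. f (g a))"
  by (induction A rule: infinite_finite_induct) (simp_all add: lin_zero lin_add)

lemma lin_funpow:
  assumes "Vector_Spaces.linear s s f"
  shows "Vector_Spaces.linear s s (f ^^ n)"
proof (induction n)
  case 0
  then show ?case using assms by (simp add: Vector_Spaces.linear_iff)
next
  case (Suc n)
  then show ?case using assms by (simp add: Vector_Spaces.linear_iff)
qed

lemma lin_preimage:
  assumes f: "Vector_Spaces.linear s1 s2 f" and W: "module.subspace s2 W"
  shows "module.subspace s1 {x. f x \<in> W}"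
proof -
  from f interpret f: Vector_Spaces.linear s1 s2 f .
  show ?thesis using W by (rule f.subspace_linear_preimage)
qed

lemma lin_eq_on_span:
  assumes f: "Vector_Spaces.linear s1 s2 f" and g: "Vector_Spaces.linear s1 s2 g"
    and x: "x \<in> module.span s1 A" and eq: "\<And>a. a \<in> A \<Longrightarrow> f a = g a"
  shows "f x = g x"
proof -
  from f interpret f: Vector_Spaces.linear s1 s2 f .
  from x show ?thesis
    by (induction rule: f.vs1.span_induct_alt)
      (simp_all add: eq lin_zero[OF f] lin_zero[OF g] lin_add[OF f] lin_add[OF g]
        lin_scale[OF f] lin_scale[OF g])
qed

text \<open>A locale of its own for the constants below, so that they do not come in one copy
  for every interpreted vector space.\<close>

locale operator_space = vector_space scale
  for scale :: "'a::field \<Rightarrow> 'b::ab_group_add \<Rightarrow> 'b" (infixr \<open>*s\<close> 75)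
begin

lemma lin_sub_scale:
  assumes "Vector_Spaces.linear scale scale X"
  shows "Vector_Spaces.linear scale scale (\<lambda>v. X v - c *s v)"
  using assms by (simp add: Vector_Spaces.linear_iff scale_right_distrib scale_right_diff_distrib
      scale_left_commute)

lemma span_Union_subspaces:
  assumes x: "x \<in> span (\<Union>i\<in>I. V i)" and V: "\<And>i. i \<in> I \<Longrightarrow> subspace (V i)"
  obtains F y where "finite F" "F \<subseteq> I" "\<And>i. i \<in> F \<Longrightarrow> y i \<in> V i" "x = (\<Sum>i\<in>F. y i)"
proof -
  from x have "\<exists>F y. finite F \<and> F \<subseteq> I \<and> (\<forall>i\<in>F. y i \<in> V i) \<and> x = (\<Sum>i\<in>F. y i)"
  proof (induction rule: span_induct_alt)
    case base
    show ?case by (intro exI[of _ "{}"]) simp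
  next
    case (step c x z)
    then obtain F y i where F: "finite F" "F \<subseteq> I" "\<forall>i\<in>F. y i \<in> V i" "z = (\<Sum>i\<in>F. y i)"
      and i: "i \<in> I" "x \<in> V i" by blast
    define y' where "y' = (\<lambda>j. (if j = i then c *s x else 0) + (if j \<in> F then y j else 0))"
    have "(\<Sum>j\<in>insert i F. y' j) = c *s x + (\<Sum>j\<in>insert i F. if j \<in> F then y j else 0)"
      unfolding y'_def sum.distrib using F(1) by simp
    also have "(\<Sum>j\<in>insert i F. if j \<in> F then y j else 0) = (\<Sum>j\<in>F. y j)"
      using F(1) by (intro sum.mono_neutral_cong_right) auto
    finally have "c *s x + z = (\<Sum>j\<in>insert i F. y' j)" using F by simp
    moreover have "y' j \<in> V j" if "j \<in> insert i F" for j
    proof -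
      have "subspace (V j)" using that V i F by auto
      then show ?thesis using that i F unfolding y'_def
        by (auto intro!: subspace_add subspace_scale simp: subspace_0)
    qed
    ultimately show ?case using F i by (intro exI[of _ "insert i F"] exI[of _ y']) auto
  qed
  then show ?thesis using that by blast
qed

definition gen_eig :: "('b \<Rightarrow> 'b) \<Rightarrow> 'a \<Rightarrow> 'b set"
  where "gen_eig X c = {x. \<exists>n. ((\<lambda>v. X v - c *s v) ^^ n) x = 0}"

definition gen_weight :: "'i set \<Rightarrow> ('i \<Rightarrow> 'b \<Rightarrow> 'b) \<Rightarrow> ('i \<Rightarrow> 'a) \<Rightarrow> 'b set"
  where "gen_weight T X \<nu> = {x. \<forall>h\<in>T. x \<in> gen_eig (X h) (\<nu> h)}"

lemma funpow_zero_mono: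
  assumes "Vector_Spaces.linear scale scale f" "(f ^^ n) x = 0" "n \<le> m"
  shows "(f ^^ m) x = 0"
proof -
  have "(f ^^ m) x = (f ^^ (m - n)) ((f ^^ n) x)"
    using assms(3) by (simp add: funpow_add[symmetric, THEN fun_cong, simplified o_apply])
  then show ?thesis using assms lin_zero[OF lin_funpow[OF assms(1)]] by simp
qed

lemma subspace_gen_eig:
  assumes X: "Vector_Spaces.linear scale scale X"
  shows "subspace (gen_eig X c)"
proof (rule subspaceI)
  let ?f = "\<lambda>v. X v - c *s v"
  have f: "Vector_Spaces.linear scale scale ?f" by (rule lin_sub_scale[OF X])
  note fn = lin_funpow[OF f]
  show "0 \<in> gen_eig X c" unfolding gen_eig_def by (auto intro!: exI[of _ 0])
  show "x + y \<in> gen_eig X c" if "x \<in> gen_eig X c" "y \<in> gen_eig X c" for x y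
  proof -
    from that obtain n m where nm: "(?f ^^ n) x = 0" "(?f ^^ m) y = 0"
      unfolding gen_eig_def by blast
    have "(?f ^^ max n m) x = 0" "(?f ^^ max n m) y = 0"
      using funpow_zero_mono[OF f] nm by (meson max.cobounded1 max.cobounded2)+
    then have "(?f ^^ max n m) (x + y) = 0" using lin_add[OF fn] by simp
    then show ?thesis unfolding gen_eig_def by blast
  qed
  show "b *s x \<in> gen_eig X c" if "x \<in> gen_eig X c" for b x
    using that lin_scale[OF fn] unfolding gen_eig_def by fastforce
qed

lemma subspace_gen_weight:
  assumes "\<And>h. h \<in> T \<Longrightarrow> Vector_Spaces.linear scale scale (X h)"
  shows "subspace (gen_weight T X \<nu>)"
  using subspace_gen_eig[OF assms] unfolding subspace_def gen_weight_def by auto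

lemma funpow_stable: "(\<And>v. v \<in> U \<Longrightarrow> f v \<in> U) \<Longrightarrow> v \<in> U \<Longrightarrow> (f ^^ n) v \<in> U"
  by (induction n) auto

lemma gen_eig_shift:
  assumes X: "Vector_Spaces.linear scale scale X" and x: "x \<in> gen_eig X a"
  shows "X x \<in> gen_eig X a"
proof -
  let ?f = "\<lambda>v. X v - a *s v"
  have f: "Vector_Spaces.linear scale scale ?f" by (rule lin_sub_scale[OF X])
  from x obtain n where n: "(?f ^^ n) x = 0" unfolding gen_eig_def by blast
  have "(?f ^^ n) (?f x) = ?f ((?f ^^ n) x)" by (rule funpow_swap1[symmetric])
  then have "?f x \<in> gen_eig X a" using n lin_zero[OF f] unfolding gen_eig_def by auto
  then have "?f x + a *s x \<in> gen_eig X a"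
    using x subspace_gen_eig[OF X] by (meson subspace_add subspace_scale)
  then show ?thesis by simp
qed

lemma gen_eig_disjoint1:
  assumes X: "Vector_Spaces.linear scale scale X" and x: "x \<in> gen_eig X a"
    and e: "X x = c *s x" and ne: "a \<noteq> c"
  shows "x = 0"
proof -
  let ?f = "\<lambda>v. X v - a *s v"
  have f: "Vector_Spaces.linear scale scale ?f" by (rule lin_sub_scale[OF X])
  have "(?f ^^ n) x = (c - a) ^ n *s x" for n
    by (induction n) (simp_all add: lin_scale[OF X] e algebra_simps)
  then show ?thesis using x ne unfolding gen_eig_def by auto
qed

lemma gen_eig_disjoint:
  assumes X: "Vector_Spaces.linear scale scale X"
  shows "x \<in> gen_eig X a \<Longrightarrow> ((\<lambda>v. X v - c *s v) ^^ n) x = 0 \<Longrightarrow> a \<noteq> c \<Longrightarrow> x = 0"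
proof (induction n arbitrary: x)
  case (Suc n)
  have "X x - c *s x \<in> gen_eig X a"
    using gen_eig_shift[OF X Suc.prems(1)] Suc.prems(1) subspace_gen_eig[OF X]
    by (meson subspace_diff subspace_scale)
  moreover have "((\<lambda>v. X v - c *s v) ^^ n) (X x - c *s x) = 0"
    using Suc.prems(2) by (simp add: funpow_Suc_right del: funpow.simps(2))
  ultimately have "X x - c *s x = 0" using Suc by blast
  then show ?case using gen_eig_disjoint1[OF X Suc.prems(1)] Suc.prems(3) by auto
qed simp

text \<open>On the generalised eigenspace for \<open>a\<close> the operator \<open>X - c\<close>
  is the sum of the nonzero scalar \<open>a - c\<close> and a nilpotent operator, hence
  invertible. The preimage is taken in a stable subspace \<open>U\<close>, because the
  decompositions below are applied to subspaces.\<close>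

lemma gen_eig_solve:
  assumes X: "Vector_Spaces.linear scale scale X" and U: "subspace U"
    and st: "\<And>v. v \<in> U \<Longrightarrow> X v \<in> U" and ne: "a \<noteq> c"
  shows "v \<in> U \<Longrightarrow> ((\<lambda>v. X v - a *s v) ^^ n) v = 0 \<Longrightarrow>
    \<exists>v'\<in>U. v' \<in> gen_eig X a \<and> X v' - c *s v' = v"
proof (induction n arbitrary: v)
  case 0
  then have "v = 0" by simp
  moreover have "0 \<in> gen_eig X a" using subspace_gen_eig[OF X] by (rule subspace_0)
  ultimately show ?case using lin_zero[OF X] subspace_0[OF U] by (intro bexI[of _ 0]) auto
next
  case (Suc n)
  let ?w = "X v - a *s v"
  have "?w \<in> U" using st U Suc.prems(1) by (meson subspace_diff subspace_scale)
  moreover have "((\<lambda>v. X v - a *s v) ^^ n) ?w = 0"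
    using Suc.prems(2) by (simp add: funpow_Suc_right del: funpow.simps(2))
  ultimately obtain w' where w': "w' \<in> U" "w' \<in> gen_eig X a" "X w' - c *s w' = ?w"
    using Suc.IH by blast
  define v' where "v' = inverse (a - c) *s (v - w')"
  have vg: "v \<in> gen_eig X a" using Suc.prems(2) unfolding gen_eig_def by blast
  have "X (v - w') - c *s (v - w') = (a - c) *s v"
    using w'(3) by (simp add: lin_diff[OF X] algebra_simps)
  then have "inverse (a - c) *s (X (v - w') - c *s (v - w')) = v" using ne by simp
  then have "X v' - c *s v' = v"
    unfolding v'_def lin_scale[OF X]
    by (simp only: scale_right_diff_distrib[of "inverse (a - c)" "X (v - w')"] scale_left_commute[of c])
  moreover have "v' \<in> U" unfolding v'_def using U Suc.prems(1) w'(1)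
    by (meson subspace_diff subspace_scale)
  moreover have "v' \<in> gen_eig X a" unfolding v'_def using subspace_gen_eig[OF X] vg w'(2)
    by (meson subspace_diff subspace_scale)
  ultimately show ?case by blast
qed

text \<open>Applying \<open>(X h - \<kappa>0 h)\<^sup>n\<close> to a relation removes the
  component of weight \<open>\<kappa>0\<close>, and it is injective on every weight space that
  \<open>h\<close> separates from \<open>\<kappa>0\<close>; so the relation can be
  shortened.\<close>

lemma gen_weight_independent:
  assumes "finite \<Lambda>"
    and X: "\<And>h. h \<in> T \<Longrightarrow> Vector_Spaces.linear scale scale (X h)"
    and st: "\<And>h \<nu> v. h \<in> T \<Longrightarrow> v \<in> gen_weight T X \<nu> \<Longrightarrow> X h v \<in> gen_weight T X \<nu>"
  shows "(\<And>\<kappa> \<mu>. \<kappa> \<in> \<Lambda> \<Longrightarrow> \<mu> \<in> \<Lambda> \<Longrightarrow> \<kappa> \<noteq> \<mu> \<Longrightarrow> \<exists>h\<in>T. \<kappa> h \<noteq> \<mu> h) \<Longrightarrow>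
    (\<And>\<kappa>. \<kappa> \<in> \<Lambda> \<Longrightarrow> x \<kappa> \<in> gen_weight T X \<kappa>) \<Longrightarrow> (\<Sum>\<kappa>\<in>\<Lambda>. x \<kappa>) = 0 \<Longrightarrow> \<forall>\<kappa>\<in>\<Lambda>. x \<kappa> = 0"
  using assms(1)
proof (induction \<Lambda> arbitrary: x rule: finite_induct)
  case (insert \<kappa>0 \<Lambda>)
  have z: "x \<mu> = 0" if mu: "\<mu> \<in> \<Lambda>" for \<mu>
  proof -
    have "\<mu> \<noteq> \<kappa>0" using mu insert.hyps by auto
    then obtain h where h: "h \<in> T" "\<mu> h \<noteq> \<kappa>0 h" using insert.prems(1)[of \<mu> \<kappa>0] mu by auto
    let ?f = "\<lambda>v. X h v - \<kappa>0 h *s v"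
    have f: "Vector_Spaces.linear scale scale ?f" by (rule lin_sub_scale[OF X[OF h(1)]])
    note fn = lin_funpow[OF f]
    obtain n where n: "(?f ^^ n) (x \<kappa>0) = 0"
      using insert.prems(2)[of \<kappa>0] h(1) unfolding gen_weight_def gen_eig_def by auto
    have "(\<Sum>\<kappa>\<in>\<Lambda>. (?f ^^ n) (x \<kappa>)) = (?f ^^ n) (\<Sum>\<kappa>\<in>insert \<kappa>0 \<Lambda>. x \<kappa>)"
      using n insert.hyps by (simp add: lin_add[OF fn] lin_sum[OF fn])
    also have "\<dots> = 0" using insert.prems(3) lin_zero[OF fn] by simp
    finally have s0: "(\<Sum>\<kappa>\<in>\<Lambda>. (?f ^^ n) (x \<kappa>)) = 0" .
    have "\<forall>\<kappa>\<in>\<Lambda>. (?f ^^ n) (x \<kappa>) = 0"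
    proof (rule insert.IH[OF _ _ s0])
      show "\<exists>h\<in>T. \<kappa> h \<noteq> \<mu> h" if "\<kappa> \<in> \<Lambda>" "\<mu> \<in> \<Lambda>" "\<kappa> \<noteq> \<mu>" for \<kappa> \<mu>
        using insert.prems(1) that by blast
      show "(?f ^^ n) (x \<kappa>) \<in> gen_weight T X \<kappa>" if "\<kappa> \<in> \<Lambda>" for \<kappa>
      proof (rule funpow_stable)
        show "x \<kappa> \<in> gen_weight T X \<kappa>" using insert.prems(2) that by blast
        show "?f v \<in> gen_weight T X \<kappa>" if "v \<in> gen_weight T X \<kappa>" for v
          using st[OF h(1) that] that subspace_gen_weight[where X = X and T = T, OF X]
          by (meson subspace_diff subspace_scale)
      qed
    qed
    then have "(?f ^^ n) (x \<mu>) = 0" using mu by blast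
    moreover have "x \<mu> \<in> gen_eig (X h) (\<mu> h)"
      using insert.prems(2)[of \<mu>] mu h(1) unfolding gen_weight_def by auto
    ultimately show ?thesis using gen_eig_disjoint[OF X[OF h(1)]] h(2) by blast
  qed
  then show ?case using insert.prems(3) insert.hyps by auto
qed simp

definition poly_act :: "('b \<Rightarrow> 'b) \<Rightarrow> 'a poly \<Rightarrow> 'b \<Rightarrow> 'b"
  where "poly_act X p v = (\<Sum>i\<le>degree p. coeff p i *s (X ^^ i) v)"

lemma poly_act_alt:
  assumes "degree p \<le> N"
  shows "poly_act X p v = (\<Sum>i\<le>N. coeff p i *s (X ^^ i) v)"
  unfolding poly_act_def
  by (rule sum.mono_neutral_left) (use assms in \<open>auto simp: coeff_eq_0\<close>)

lemma poly_act_add: "poly_act X (p + q) v = poly_act X p v + poly_act X q v"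
proof -
  let ?N = "max (degree p) (degree q)"
  have "degree (p + q) \<le> ?N" by (rule degree_add_le_max)
  then show ?thesis
    by (simp add: poly_act_alt[of _ ?N] scale_left_distrib sum.distrib)
qed

lemma poly_act_pCons: "poly_act X (pCons a p) v = a *s v + poly_act X p (X v)"
proof -
  have "poly_act X (pCons a p) v = (\<Sum>i\<le>Suc (degree p). coeff (pCons a p) i *s (X ^^ i) v)"
    by (rule poly_act_alt) (simp add: degree_pCons_le)
  also have "\<dots> = a *s v + (\<Sum>i\<le>degree p. coeff p i *s (X ^^ i) (X v))"
    by (simp add: sum.atMost_Suc_shift funpow_Suc_right del: sum.atMost_Suc funpow.simps(2))
  finally show ?thesis unfolding poly_act_def .
qed

text \<open>The factor \<open>X - c\<close> is applied first, so that peeling off roots of an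
  annihilating polynomial one at a time becomes a recursion on the vector.\<close>

lemma poly_act_linear_factor:
  assumes X: "Vector_Spaces.linear scale scale X"
  shows "poly_act X ([:- c, 1:] * q) v = poly_act X q (X v - c *s v)"
proof -
  have sm: "poly_act X (smult d q) v = d *s poly_act X q v" for d
    by (cases "d = 0") (simp_all add: poly_act_def scale_sum_right)
  have df: "poly_act X q (x - y) = poly_act X q x - poly_act X q y" for x y
    by (simp add: poly_act_def lin_diff[OF lin_funpow[OF X]] scale_right_diff_distrib sum_subtractf)
  have sc: "poly_act X q (d *s x) = d *s poly_act X q x" for d x
    by (simp add: poly_act_def lin_scale[OF lin_funpow[OF X]] scale_sum_right mult.commute)
  have "[:- c, 1:] * q = pCons 0 q + smult (- c) q" by simp
  then show ?thesis by (simp only: poly_act_add poly_act_pCons sm df sc) simp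
qed

end

locale fd_operator_space = finite_dimensional_vector_space scale Basis + operator_space scale
  for scale :: "'a::field \<Rightarrow> 'b::ab_group_add \<Rightarrow> 'b" (infixr \<open>*s\<close> 75)
    and Basis :: "'b set"
begin

text \<open>Otherwise \<open>u, X u, X\<^sup>2 u, \<dots>\<close> would be independent.\<close>

lemma power_in_span_of_lower:
  obtains n where "(X ^^ n) u \<in> span ((\<lambda>i. (X ^^ i) u) ` {..<n})"
proof (rule ccontr)
  assume "\<not> thesis"
  then have ni: "(X ^^ n) u \<notin> span ((\<lambda>i. (X ^^ i) u) ` {..<n})" for n using that by blast
  have ind: "independent ((\<lambda>i. (X ^^ i) u) ` {..<n}) \<and> card ((\<lambda>i. (X ^^ i) u) ` {..<n}) = n" for n
  proof (induction n)
    case 0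
    show ?case by (simp add: independent_empty)
  next
    case (Suc n)
    have "(X ^^ n) u \<notin> (\<lambda>i. (X ^^ i) u) ` {..<n}" using ni[of n] by (meson span_base)
    then show ?case using Suc ni[of n]
      by (simp add: lessThan_Suc independent_insert)
  qed
  have "card ((\<lambda>i. (X ^^ i) u) ` {..<Suc (dim UNIV)}) \<le> dim UNIV"
    using ind[of "Suc (dim UNIV)"] by (intro independent_card_le_dim) blast+
  then show False using ind[of "Suc (dim UNIV)"] by simp
qed

lemma span_image_coeffs:
  assumes "x \<in> span (f ` {..<n::nat})"
  obtains c where "x = (\<Sum>i<n. c i *s f i)"
proof -
  from assms have "\<exists>c. x = (\<Sum>i<n. c i *s f i)"
  proof (induction rule: span_induct_alt)
    case base
    show ?case by (rule exI[of _ "\<lambda>_. 0"]) simp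
  next
    case (step a x y)
    then obtain i c where i: "i < n" "x = f i" and c: "y = (\<Sum>i<n. c i *s f i)" by auto
    have "a *s x + y = (\<Sum>j<n. (c j + (if j = i then a else 0)) *s f j)"
      using i unfolding c by (simp add: scale_left_distrib sum.distrib if_distrib[of "\<lambda>z. z *s _"] cong: if_cong)
    then show ?case by (rule exI[of _ "\<lambda>j. c j + (if j = i then a else 0)"])
  qed
  then show ?thesis using that by blast
qed

lemma annihilating_poly: obtains p where "p \<noteq> 0" "poly_act X p u = 0"
proof -
  obtain n where "(X ^^ n) u \<in> span ((\<lambda>i. (X ^^ i) u) ` {..<n})" by (rule power_in_span_of_lower)
  then obtain c where c: "(X ^^ n) u = (\<Sum>i<n. c i *s (X ^^ i) u)" by (rule span_image_coeffs)
  define p where "p = monom 1 n - (\<Sum>i<n. monom (c i) i)"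
  have cf: "coeff p j = (if j = n then 1 else if j < n then - c j else 0)" for j
    unfolding p_def by (simp add: coeff_sum sum.delta' cong: if_cong)
  have p0: "p \<noteq> 0" using cf[of n] by auto
  have "degree p \<le> n" by (rule degree_le) (simp add: cf)
  then have "poly_act X p u = (\<Sum>i\<le>n. coeff p i *s (X ^^ i) u)" by (rule poly_act_alt)
  also have "\<dots> = (X ^^ n) u + (\<Sum>i<n. - (c i *s (X ^^ i) u))"
    by (simp add: cf flip: lessThan_Suc_atMost)
  also have "\<dots> = 0" using c by (simp add: sum_negf)
  finally show ?thesis using that p0 by blast
qed

end

locale closed_fd_space = fd_operator_space scale Basis
  for scale :: "'k::{alg_closed_field, field_char_0} \<Rightarrow> 'g::ab_group_add \<Rightarrow> 'g" (infixr \<open>*s\<close> 75)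
    and Basis :: "'g set"
begin

text \<open>The only place where the field has to be algebraically closed: an annihilating
  polynomial of \<open>u\<close> splits. In this form, as a list of shifts killing
  \<open>u\<close>, the fact supports inductions that never mention polynomials.\<close>

lemma annihilating_linear_factors:
  assumes X: "Vector_Spaces.linear scale scale X"
  obtains cs where "fold (\<lambda>c v. X v - c *s v) cs u = 0"
proof -
  obtain p where p: "p \<noteq> 0" "poly_act X p u = 0" by (rule annihilating_poly)
  then have "\<exists>cs. fold (\<lambda>c v. X v - c *s v) cs u = 0"
  proof (induction "degree p" arbitrary: p u)
    case 0
    then obtain a where "p = [:a:]" "a \<noteq> 0" by (metis degree_eq_zeroE pCons_0_0)
    then have "u = 0" using 0 by (simp add: poly_act_def)
    then show ?case by (intro exI[of _ "[]"]) simp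
  next
    case (Suc n)
    then obtain c where "poly p c = 0" using alg_closed_imp_poly_has_root[of p] by auto
    then obtain q where q: "p = [:- c, 1:] * q" by (auto simp: poly_eq_0_iff_dvd)
    then have "q \<noteq> 0" using Suc.prems by auto
    moreover have "degree p = Suc (degree q)" unfolding q using \<open>q \<noteq> 0\<close> by (subst degree_mult_eq) auto
    moreover have "poly_act X q (X u - c *s u) = 0"
      using Suc.prems poly_act_linear_factor[OF X] q by simp
    ultimately obtain cs where "fold (\<lambda>c v. X v - c *s v) cs (X u - c *s u) = 0"
      using Suc.hyps by (metis Suc_inject)
    then show ?case by (intro exI[of _ "c # cs"]) simp
  qed
  then show ?thesis using that by blast
qed

text \<open>An eigenvector in the quotient of \<open>U\<close> by \<open>W\<close>: among the
  shifts that bring \<open>u\<close> to zero, one is the first to move the vector into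
  \<open>W\<close>.\<close>

lemma relative_eigenvector:
  assumes X: "Vector_Spaces.linear scale scale X" and U: "subspace U"
    and st: "\<And>v. v \<in> U \<Longrightarrow> X v \<in> U" and W: "0 \<in> W" and "W \<subset> U"
  obtains v c where "v \<in> U" "v \<notin> W" "X v - c *s v \<in> W"
proof -
  obtain u where u: "u \<in> U" "u \<notin> W" using \<open>W \<subset> U\<close> by blast
  obtain cs where "fold (\<lambda>c v. X v - c *s v) cs u = 0" using annihilating_linear_factors[OF X] .
  with u have "\<exists>v c. v \<in> U \<and> v \<notin> W \<and> X v - c *s v \<in> W"
  proof (induction cs arbitrary: u)
    case Nil
    then show ?case using W by simp
  next
    case (Cons c cs)
    have "X u - c *s u \<in> U" using Cons.prems st U by (meson subspace_diff subspace_scale)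
    then show ?case using Cons by (cases "X u - c *s u \<in> W") auto
  qed
  then show ?thesis using that by blast
qed

text \<open>Induction on the shifts that kill \<open>u\<close>. If \<open>(X - c) u\<close> is a
  sum of generalised eigenvectors, then the components for \<open>a \<noteq> c\<close> can be
  divided by \<open>X - c\<close>; what remains of \<open>u\<close> is a generalised eigenvector
  for \<open>c\<close>.\<close>

lemma span_gen_eig:
  assumes X: "Vector_Spaces.linear scale scale X" and U: "subspace U"
    and st: "\<And>v. v \<in> U \<Longrightarrow> X v \<in> U" and u: "u \<in> U"
  shows "u \<in> span (\<Union>c. U \<inter> gen_eig X c)"
proof -
  let ?G = "\<Union>c. U \<inter> gen_eig X c"
  have solve: "\<exists>v\<in>span ?G. v \<in> U \<and> X v - c *s v - w \<in> U \<inter> gen_eig X c" if "w \<in> span ?G" for c w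
    using that
  proof (induction rule: span_induct_alt)
    case base
    have "0 \<in> U \<inter> gen_eig X c" using U subspace_gen_eig[OF X] by (simp add: subspace_0)
    then show ?case using lin_zero[OF X] by (intro bexI[of _ 0]) (auto simp: span_zero subspace_0[OF U])
  next
    case (step b x y)
    then obtain v where v: "v \<in> span ?G" "v \<in> U" "X v - c *s v - y \<in> U \<inter> gen_eig X c" by blast
    from step obtain a where a: "x \<in> U" "x \<in> gen_eig X a" by blast
    have sub: "subspace (U \<inter> gen_eig X c)" using U subspace_gen_eig[OF X] by (rule subspace_inter)
    show ?case
    proof (cases "a = c")
      case True
      have "(X v - c *s v - y) - b *s x \<in> U \<inter> gen_eig X c"
        using v(3) a True sub by (meson IntI subspace_diff subspace_scale)
      moreover have "(X v - c *s v - y) - b *s x = X v - c *s v - (b *s x + y)" by simp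
      ultimately show ?thesis using v(1,2) by (intro bexI[of _ v] conjI) auto
    next
      case False
      obtain n where "((\<lambda>v. X v - a *s v) ^^ n) x = 0" using a unfolding gen_eig_def by blast
      then obtain x' where x': "x' \<in> U" "x' \<in> gen_eig X a" "X x' - c *s x' = x"
        using gen_eig_solve[OF X U st False a(1)] by blast
      have "X (b *s x' + v) - c *s (b *s x' + v) - (b *s x + y) = X v - c *s v - y"
        unfolding x'(3)[symmetric]
        by (simp add: lin_add[OF X] lin_scale[OF X] algebra_simps)
      moreover have "b *s x' + v \<in> span ?G"
        using x' v(1) by (intro span_add span_scale) (auto intro!: span_base)
      moreover have "b *s x' + v \<in> U" using x' v U by (meson subspace_add subspace_scale)
      ultimately show ?thesis using v(3) by metis
    qed
  qed
  obtain cs where "fold (\<lambda>c v. X v - c *s v) cs u = 0" using annihilating_linear_factors[OF X] .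
  with u show ?thesis
  proof (induction cs arbitrary: u)
    case Nil
    then show ?case by (simp add: span_zero)
  next
    case (Cons c cs)
    let ?f = "\<lambda>v. X v - c *s v"
    have "?f u \<in> U" using Cons.prems st U by (meson subspace_diff subspace_scale)
    then have "?f u \<in> span ?G" using Cons by simp
    then obtain v where v: "v \<in> span ?G" "v \<in> U" "?f v - ?f u \<in> U \<inter> gen_eig X c" using solve by blast
    have "?f (v - u) \<in> gen_eig X c" using v(3) lin_diff[OF lin_sub_scale[OF X]] by simp
    then obtain n where "(?f ^^ n) (?f (v - u)) = 0" unfolding gen_eig_def by blast
    then have "(?f ^^ Suc n) (v - u) = 0" by (simp add: funpow_Suc_right del: funpow.simps(2))
    then have "v - u \<in> gen_eig X c" unfolding gen_eig_def by blast
    moreover have "v - u \<in> U" using v(2) Cons.prems(1) U by (simp add: subspace_diff)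
    ultimately have "v - u \<in> span ?G" by (intro span_base) auto
    then have "v - (v - u) \<in> span ?G" using v(1) by (rule span_diff[rotated])
    then show ?case by simp
  qed
qed

text \<open>A commutator on a quotient \<open>U / W\<close> that is a scalar \<open>c\<close>
  vanishes. If \<open>v\<close> is an eigenvector of \<open>Y\<close> with eigenvalue
  \<open>a\<close>, then \<open>Y - a\<close> sends \<open>Z\<^sup>m\<^sup>+\<^sup>1 v\<close>
  to \<open>(m + 1) c Z\<^sup>m v\<close>; for \<open>c \<noteq> 0\<close> this would shorten
  any linear dependence between the powers \<open>Z\<^sup>m v\<close>, but finite dimension
  requires one.\<close>

lemma commutator_scalar_zero:
  assumes Y: "Vector_Spaces.linear scale scale Y" and Z: "Vector_Spaces.linear scale scale Z"
    and U: "subspace U" "\<And>u. u \<in> U \<Longrightarrow> Y u \<in> U" "\<And>u. u \<in> U \<Longrightarrow> Z u \<in> U"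
    and W: "subspace W" "\<And>w. w \<in> W \<Longrightarrow> Y w \<in> W" "\<And>w. w \<in> W \<Longrightarrow> Z w \<in> W" "W \<subset> U"
    and c: "\<And>u. u \<in> U \<Longrightarrow> Y (Z u) - Z (Y u) - c *s u \<in> W"
  shows "c = 0"
proof (rule ccontr)
  assume c0: "c \<noteq> 0"
  obtain v a where v: "v \<in> U" "v \<notin> W" and a: "Y v - a *s v \<in> W"
    using relative_eigenvector[OF Y U(1) U(2) subspace_0[OF W(1)] W(4)] by blast
  define Y' where "Y' = (\<lambda>u. Y u - a *s u)"
  have Y': "Vector_Spaces.linear scale scale Y'" unfolding Y'_def by (rule lin_sub_scale[OF Y])
  have Y'W: "Y' w \<in> W" if "w \<in> W" for w
    unfolding Y'_def using W that by (meson subspace_diff subspace_scale)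
  have ZU: "(Z ^^ m) v \<in> U" for m using U(3) v(1) by (rule funpow_stable)
  have lower: "Y' ((Z ^^ Suc m) v) - (of_nat (Suc m) * c) *s (Z ^^ m) v \<in> W" for m
  proof (induction m)
    case 0
    have "Y' (Z v) - c *s v = (Y (Z v) - Z (Y v) - c *s v) + Z (Y v - a *s v)"
      unfolding Y'_def by (simp add: lin_diff[OF Z] lin_scale[OF Z])
    moreover have "(Y (Z v) - Z (Y v) - c *s v) + Z (Y v - a *s v) \<in> W"
      using c[OF v(1)] W(3)[OF a] by (rule subspace_add[OF W(1)])
    ultimately have "Y' (Z v) - c *s v \<in> W" by (simp only:)
    then show ?case by simp
  next
    case (Suc m)
    let ?u = "(Z ^^ Suc m) v"
    have "Y' (Z ?u) - (of_nat (Suc (Suc m)) * c) *s ?u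
      = (Y (Z ?u) - Z (Y ?u) - c *s ?u)
        + Z (Y' ?u - (of_nat (Suc m) * c) *s (Z ^^ m) v)"
    proof -
      have "(of_nat (Suc (Suc m)) * c) *s ?u = (of_nat (Suc m) * c) *s ?u + c *s ?u"
        unfolding scale_left_distrib[symmetric] by (simp add: distrib_right)
      then show ?thesis unfolding Y'_def
        by (simp add: lin_diff[OF Z] lin_scale[OF Z] del: of_nat_Suc)
    qed
    moreover have "(Y (Z ?u) - Z (Y ?u) - c *s ?u)
        + Z (Y' ?u - (of_nat (Suc m) * c) *s (Z ^^ m) v) \<in> W"
      using c[OF ZU[of "Suc m"]] W(3)[OF Suc] by (rule subspace_add[OF W(1)])
    ultimately have "Y' (Z ?u) - (of_nat (Suc (Suc m)) * c) *s ?u \<in> W" by (simp only:)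
    then show ?case by simp
  qed
  let ?S = "\<lambda>n. span (W \<union> (\<lambda>i. (Z ^^ i) v) ` {..<n})"
  have ex: "\<exists>n. (Z ^^ n) v \<in> ?S n"
  proof -
    obtain n where "(Z ^^ n) v \<in> span ((\<lambda>i. (Z ^^ i) v) ` {..<n})" by (rule power_in_span_of_lower)
    then show ?thesis using span_mono[of "(\<lambda>i. (Z ^^ i) v) ` {..<n}" "W \<union> (\<lambda>i. (Z ^^ i) v) ` {..<n}"]
      by blast
  qed
  define n where "n = (LEAST n. (Z ^^ n) v \<in> ?S n)"
  have n: "(Z ^^ n) v \<in> ?S n" unfolding n_def by (rule LeastI_ex[OF ex])
  show False
  proof (cases n)
    case 0
    then have "v \<in> span W" using n by simp
    then show False using v(2) W(1) by (simp add: span_eq_iff[THEN iffD2])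
  next
    case (Suc m)
    have map: "Y' x \<in> ?S m" if "x \<in> ?S (Suc m)" for x
      using that
    proof (induction rule: span_induct_alt)
      case base
      then show ?case by (simp add: lin_zero[OF Y'] span_zero)
    next
      case (step b x y)
      have "Y' x \<in> ?S m"
      proof (cases "x \<in> W")
        case True
        then show ?thesis using Y'W by (auto intro: span_base)
      next
        case False
        then obtain i where i: "i < Suc m" "x = (Z ^^ i) v" using step by blast
        show ?thesis
        proof (cases i)
          case 0
          then have "Y' x \<in> W" using a i unfolding Y'_def by simp
          then show ?thesis by (auto intro: span_base)
        next
          case (Suc j)
          have "(of_nat (Suc j) * c) *s (Z ^^ j) v \<in> ?S m"
            using i Suc by (intro span_scale span_base) auto
          moreover have "Y' x - (of_nat (Suc j) * c) *s (Z ^^ j) v \<in> ?S m"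
            using lower[of j] i Suc by (intro span_base) auto
          ultimately show ?thesis by (metis diff_add_cancel span_add)
        qed
      qed
      then show ?case using step by (simp only: lin_add[OF Y'] lin_scale[OF Y']) (intro span_add span_scale)
    qed
    have "Y' ((Z ^^ Suc m) v) \<in> ?S m" using map n Suc by simp
    moreover have "Y' ((Z ^^ Suc m) v) - (of_nat (Suc m) * c) *s (Z ^^ m) v \<in> ?S m"
      using lower[of m] by (intro span_base) auto
    ultimately have "Y' ((Z ^^ Suc m) v) - (Y' ((Z ^^ Suc m) v) - (of_nat (Suc m) * c) *s (Z ^^ m) v) \<in> ?S m"
      by (rule span_diff)
    then have "(of_nat (Suc m) * c) *s (Z ^^ m) v \<in> ?S m" by (simp only: diff_diff_eq2 add_diff_cancel_left')
    then have "inverse (of_nat (Suc m) * c) *s ((of_nat (Suc m) * c) *s (Z ^^ m) v) \<in> ?S m"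
      by (rule span_scale)
    moreover have "inverse (of_nat (Suc m) * c) * (of_nat (Suc m) * c) = 1"
      using c0 by (intro left_inverse) (simp del: of_nat_Suc)
    ultimately have "(Z ^^ m) v \<in> ?S m" by (simp only: scale_scale scale_one)
    then have "n \<le> m" unfolding n_def by (rule Least_le)
    then show False using Suc by simp
  qed
qed

end

section \<open>Brackets\<close>

sublocale lie_algebra \<subseteq> closed_fd_space scale Basis ..

context lie_algebra
begin

lemma lin_br: "Vector_Spaces.linear scale scale (br x)"
  by (simp add: Vector_Spaces.linear_iff br_add_right br_scale_right vector_space_axioms)

lemma lin_br_left: "Vector_Spaces.linear scale scale (\<lambda>x. br x y)"
  by (simp add: Vector_Spaces.linear_iff br_add_left br_scale_left vector_space_axioms)

lemmas br_zero [simp] = lin_zero[OF lin_br] lin_zero[OF lin_br_left]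
lemmas br_diff = lin_diff[OF lin_br] lin_diff[OF lin_br_left]
lemmas br_neg = lin_neg[OF lin_br] lin_neg[OF lin_br_left]

lemma br_skew: "br x y = - br y x"
proof -
  have "br x y + br y x = 0"
    using br_self[of "x + y"] unfolding br_add_left br_add_right by (simp add: br_self add.commute)
  then show ?thesis by (simp add: eq_neg_iff_add_eq_0)
qed

lemma br_br: "br (br x y) z = br x (br y z) - br y (br x z)"
  using jacobi[of x y z] br_skew[of "br x y" z] br_skew[of z x]
  by (simp add: br_neg add_eq_0_iff algebra_simps)

lemma br_deriv: "br x (br y z) = br (br x y) z + br y (br x z)"
  by (simp add: br_br)

text \<open>The operator \<open>ad h - (a + b)\<close> acts on \<open>[x, y]\<close> as
  \<open>ad h - a\<close> on \<open>x\<close> plus \<open>ad h - b\<close> on \<open>y\<close>,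
  and each summand lowers one of the two exponents.\<close>

lemma gen_eig_br_aux:
  "((\<lambda>v. br h v - a *s v) ^^ m) x = 0 \<Longrightarrow> ((\<lambda>v. br h v - b *s v) ^^ n) y = 0 \<Longrightarrow>
    ((\<lambda>v. br h v - (a + b) *s v) ^^ (m + n)) (br x y) = 0"
proof (induction "m + n" arbitrary: m n x y)
  case 0
  then show ?case by simp
next
  case (Suc N)
  let ?f = "\<lambda>v. br h v - (a + b) *s v"
  have fN: "Vector_Spaces.linear scale scale (?f ^^ k)" for k
    by (rule lin_funpow[OF lin_sub_scale[OF lin_br]])
  show ?case
  proof (cases "m = 0 \<or> n = 0")
    case True
    then have "br x y = 0" using Suc.prems by auto
    then show ?thesis using lin_zero[OF fN] by simp
  next
    case False
    then obtain m' n' where mn: "m = Suc m'" "n = Suc n'" by (auto simp: gr0_conv_Suc)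
    let ?x = "br h x - a *s x" and ?y = "br h y - b *s y"
    have "((\<lambda>v. br h v - a *s v) ^^ m') ?x = 0" "((\<lambda>v. br h v - b *s v) ^^ n') ?y = 0"
      using Suc.prems mn by (simp_all add: funpow_Suc_right del: funpow.simps(2))
    then have "(?f ^^ (m' + n)) (br ?x y) = 0" "(?f ^^ (m + n')) (br x ?y) = 0"
      using Suc.hyps(1)[of m' n ?x y] Suc.hyps(1)[of m n' x ?y] Suc.hyps(2) Suc.prems mn by auto
    then have "(?f ^^ N) (br ?x y) = 0" "(?f ^^ N) (br x ?y) = 0" using Suc.hyps(2) mn by auto
    moreover have "?f (br x y) = br ?x y + br x ?y"
      by (simp add: br_diff br_scale_left br_scale_right br_deriv[of h x y] scale_left_distrib)
    ultimately have "(?f ^^ N) (?f (br x y)) = 0" using lin_add[OF fN] by simp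
    then show ?thesis using Suc.hyps(2)[symmetric] by (simp add: funpow_Suc_right del: funpow.simps(2))
  qed
qed

lemma gen_eig_br:
  "x \<in> gen_eig (br h) a \<Longrightarrow> y \<in> gen_eig (br h) b \<Longrightarrow> br x y \<in> gen_eig (br h) (a + b)"
  using gen_eig_br_aux unfolding gen_eig_def by blast

section \<open>Nilpotent subalgebras\<close>

lemma subspace_lower_central: "subalgebra T \<Longrightarrow> subspace (lower_central T n)"
  by (cases n) (auto simp: subalgebra_def)

lemma lower_central_br: "x \<in> T \<Longrightarrow> y \<in> lower_central T n \<Longrightarrow> br x y \<in> lower_central T (Suc n)"
  by (simp, rule span_base, blast)

lemma lower_central_subset:
  assumes "subalgebra T"
  shows "lower_central T (Suc n) \<subseteq> lower_central T n"
proof (induction n)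
  case 0
  have "span {br x y |x y. x \<in> T \<and> y \<in> T} \<subseteq> T"
    by (rule span_minimal) (use assms in \<open>auto simp: subalgebra_def\<close>)
  then show ?case by simp
next
  case (Suc n)
  have "{br x y |x y. x \<in> T \<and> y \<in> lower_central T (Suc n)} \<subseteq> lower_central T (Suc n)"
    using Suc lower_central_br by blast
  then have "span {br x y |x y. x \<in> T \<and> y \<in> lower_central T (Suc n)} \<subseteq> lower_central T (Suc n)"
    using subspace_lower_central[OF assms] by (rule span_minimal)
  then show ?case by simp
qed

lemma lower_central_subset': 
  assumes "subalgebra T" shows "lower_central T n \<subseteq> T"
proof (induction n)
  case (Suc n)
  then show ?case using lower_central_subset[OF assms, of n] by (rule order_trans[rotated])
qed simp

lemma nilpotent_gen_eig:
  assumes "lower_central T n = {0}" "h \<in> T" "x \<in> T"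
  shows "x \<in> gen_eig (br h) 0"
proof -
  have "(br h ^^ k) x \<in> lower_central T k" for k
  proof (induction k)
    case (Suc k)
    then show ?case using lower_central_br[OF assms(2)] by (simp only: funpow.simps o_apply)
  qed (simp add: assms(3))
  then have "(br h ^^ n) x = 0" using assms(1) by blast
  then show ?thesis unfolding gen_eig_def by (auto intro!: exI[of _ n])
qed

text \<open>A nilpotent algebra acting on \<open>V / W\<close> has a common eigenvector. Used
  with \<open>W = 0\<close> it shows that weights are linear and vanish on brackets; used with
  \<open>W\<close> the algebra itself it plays the part of Engel's theorem. The proof looks at
  an irreducible submodule \<open>U / W\<close>. Going down the central series from its last
  term, an element of a term commutes on \<open>U / W\<close> with the algebra, hence is a
  scalar there; if it is a bracket, the scalar is zero.\<close>

lemma relative_common_eigenvector: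
  assumes T: "subalgebra T" "lower_central T N = {0}"
    and V: "subspace V" "\<And>h v. h \<in> T \<Longrightarrow> v \<in> V \<Longrightarrow> br h v \<in> V"
    and W: "subspace W" "\<And>h v. h \<in> T \<Longrightarrow> v \<in> W \<Longrightarrow> br h v \<in> W" "W \<subset> V"
  obtains v \<nu> where "v \<in> V" "v \<notin> W" "\<And>h. h \<in> T \<Longrightarrow> br h v - \<nu> h *s v \<in> W"
proof -
  define P where "P U \<longleftrightarrow> subspace U \<and> (\<forall>h\<in>T. \<forall>v\<in>U. br h v \<in> U) \<and> W \<subset> U \<and> U \<subseteq> V" for U
  \<comment> \<open>A stable subspace of least dimension strictly above W: the preimage of an
    irreducible submodule.\<close>
  have "P V" using V W unfolding P_def by auto
  then obtain U where U: "P U" "\<And>U'. P U' \<Longrightarrow> dim U \<le> dim U'"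
    using ex_has_least_nat[of P V dim] by auto
  have Us: "subspace U" "W \<subset> U" "U \<subseteq> V" and Ust: "\<And>h v. h \<in> T \<Longrightarrow> v \<in> U \<Longrightarrow> br h v \<in> U"
    using U(1) unfolding P_def by auto
  have min: "U' = U" if "subspace U'" "\<And>h v. h \<in> T \<Longrightarrow> v \<in> U' \<Longrightarrow> br h v \<in> U'" "W \<subset> U'" "U' \<subseteq> U" for U'
  proof -
    have "P U'" using that Us unfolding P_def by auto
    then show ?thesis using U(2) that(1,4) Us(1) subspace_dim_equal by blast
  qed
  have scal: "\<exists>c. \<forall>u\<in>U. br x u - c *s u \<in> W"
    if x: "x \<in> T" and cm: "\<And>z u. z \<in> T \<Longrightarrow> u \<in> U \<Longrightarrow> br (br z x) u \<in> W" for x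
  proof -
    obtain u c where u: "u \<in> U" "u \<notin> W" "br x u - c *s u \<in> W"
      using relative_eigenvector[OF lin_br Us(1) Ust[OF x] subspace_0[OF W(1)] Us(2)] by blast
    let ?f = "\<lambda>v. br x v - c *s v"
    define U' where "U' = U \<inter> {v. ?f v \<in> W}"
    have "U' = U"
    proof (rule min)
      show "subspace U'" unfolding U'_def
        using Us(1) lin_preimage[OF lin_sub_scale[OF lin_br] W(1)] by (rule subspace_inter)
      show "U' \<subseteq> U" unfolding U'_def by auto
      have "W \<subseteq> U'" unfolding U'_def using Us(2) W(2)[OF x] W(1) by (auto intro: subspace_diff subspace_scale)
      moreover have "u \<in> U'" unfolding U'_def using u by auto
      ultimately show "W \<subset> U'" using u(2) by auto
      show "br h v \<in> U'" if h: "h \<in> T" and v: "v \<in> U'" for h v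
      proof -
        have vU: "v \<in> U" "?f v \<in> W" using v unfolding U'_def by auto
        have "?f (br h v) = br h (?f v) - br (br h x) v"
          by (simp add: br_diff br_scale_right br_br)
        then have "?f (br h v) \<in> W"
          using W(2)[OF h vU(2)] cm[OF h vU(1)] W(1) by (simp add: subspace_diff)
        then show ?thesis using Ust[OF h vU(1)] unfolding U'_def by auto
      qed
    qed
    then show ?thesis unfolding U'_def by (auto intro!: exI[of _ c])
  qed
  have zero: "N - j \<ge> 1 \<Longrightarrow> x \<in> lower_central T (N - j) \<Longrightarrow> u \<in> U \<Longrightarrow> br x u \<in> W" for j x u
  proof (induction j arbitrary: x u)
    case 0
    then show ?case using T(2) subspace_0[OF W(1)] by simp
  next
    case (Suc j)
    define i where "i = N - Suc j"
    have i: "i \<ge> 1" "N - j = Suc i" using Suc.prems(1) unfolding i_def by auto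
    have IH: "br x u \<in> W" if "x \<in> lower_central T (Suc i)" "u \<in> U" for x u
      using Suc.IH[of x u] that i by simp
    obtain i' where i': "i = Suc i'" using i(1) by (cases i) auto
    have "x \<in> span {br y z | y z. y \<in> T \<and> z \<in> lower_central T i'}"
      using Suc.prems(2) unfolding i_def[symmetric] i' by simp
    then show ?case
    proof (induction rule: span_induct_alt)
      case base
      show ?case using subspace_0[OF W(1)] by simp
    next
      case (step b x x')
      then obtain y z where yz: "y \<in> T" "z \<in> lower_central T i'" "x = br y z" by blast
      have zT: "z \<in> T" using yz(2) lower_central_subset'[OF T(1)] by blast
      have xl: "x \<in> lower_central T i" using lower_central_br[OF yz(1,2)] yz(3) i' by simp
      then have xT: "x \<in> T" using lower_central_subset'[OF T(1)] by blast
      obtain c where c: "\<And>u. u \<in> U \<Longrightarrow> br x u - c *s u \<in> W"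
        using scal[OF xT] IH[OF lower_central_br[OF _ xl]] by blast
      have "c = 0"
      proof (rule commutator_scalar_zero[OF lin_br[of y] lin_br[of z] Us(1) Ust[OF yz(1)] Ust[OF zT]
              W(1) W(2)[OF yz(1)] W(2)[OF zT] Us(2)])
        show "br y (br z u) - br z (br y u) - c *s u \<in> W" if "u \<in> U" for u
          using c[OF that] yz(3) by (simp add: br_br)
      qed
      then have "br x u \<in> W" using c[OF Suc.prems(3)] by simp
      then show ?case using step W(1) by (simp add: br_add_left br_scale_left subspace_add subspace_scale)
    qed
  qed
  have "\<exists>c. \<forall>u\<in>U. br x u - c *s u \<in> W" if x: "x \<in> T" for x
  proof (rule scal[OF x])
    show "br (br z x) u \<in> W" if "z \<in> T" "u \<in> U" for z u
    proof (cases "N = 0")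
      case True
      then have "x = 0" using T(2) x by auto
      then show ?thesis using subspace_0[OF W(1)] by simp
    next
      case False
      have "br z x \<in> lower_central T 1" using lower_central_br[of z T x 0] that x by simp
      then show ?thesis using zero[of "N - 1" "br z x" u] False that by simp
    qed
  qed
  then obtain \<nu> where nu: "\<And>x u. x \<in> T \<Longrightarrow> u \<in> U \<Longrightarrow> br x u - \<nu> x *s u \<in> W" by metis
  obtain v where "v \<in> U" "v \<notin> W" using Us(2) by blast
  then show ?thesis using that[of v \<nu>] nu Us(3) by blast
qed

text \<open>If some \<open>h\<close> has two eigenvalues on \<open>V\<close>, then
  \<open>V\<close> is the sum of its proper subspaces of generalised eigenvectors of
  \<open>h\<close>. They are stable, because the elements of \<open>T\<close> are themselves
  generalised eigenvectors of \<open>ad h\<close> for the eigenvalue 0. Weights vanish outside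
  \<open>T\<close>, so that different weights are different functions on
  \<open>T\<close>.\<close>

lemma gen_weight_decomposition:
  assumes T: "lower_central T N = {0}"
  shows "subspace V \<Longrightarrow> (\<And>h v. h \<in> T \<Longrightarrow> v \<in> V \<Longrightarrow> br h v \<in> V) \<Longrightarrow>
    V \<subseteq> span (\<Union>\<nu>\<in>{\<nu>. \<forall>x. x \<notin> T \<longrightarrow> \<nu> x = 0}. V \<inter> gen_weight T br \<nu>)"
proof (induction "dim V" arbitrary: V rule: less_induct)
  case less
  let ?N = "{\<nu> :: 'g \<Rightarrow> 'k. \<forall>x. x \<notin> T \<longrightarrow> \<nu> x = 0}"
  show ?case
  proof (cases "\<forall>h\<in>T. \<exists>c. V \<subseteq> gen_eig (br h) c")
    case True
    then obtain \<nu>0 where nu0: "\<And>h. h \<in> T \<Longrightarrow> V \<subseteq> gen_eig (br h) (\<nu>0 h)" by metis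
    define \<nu> where "\<nu> = (\<lambda>h. if h \<in> T then \<nu>0 h else 0)"
    have "V \<subseteq> V \<inter> gen_weight T br \<nu>" using nu0 unfolding gen_weight_def \<nu>_def by auto
    also have "\<dots> \<subseteq> (\<Union>\<nu>\<in>?N. V \<inter> gen_weight T br \<nu>)" unfolding \<nu>_def by (intro UN_upper) auto
    finally show ?thesis using span_superset by blast
  next
    case False
    then obtain h where h: "h \<in> T" "\<And>c. \<not> V \<subseteq> gen_eig (br h) c" by blast
    have part: "V \<inter> gen_eig (br h) c \<subseteq> span (\<Union>\<nu>\<in>?N. V \<inter> gen_weight T br \<nu>)" for c
    proof -
      let ?V = "V \<inter> gen_eig (br h) c"
      have sV: "subspace ?V" using less.prems(1) subspace_gen_eig[OF lin_br] by (rule subspace_inter)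
      have "?V \<subset> V" using h(2)[of c] by blast
      then have "span ?V \<subset> span V" using sV less.prems(1) by (simp only: span_eq_iff[THEN iffD2])
      then have d: "dim ?V < dim V" by (rule dim_psubset)
      have "?V \<subseteq> span (\<Union>\<nu>\<in>?N. ?V \<inter> gen_weight T br \<nu>)"
      proof (rule less.hyps[OF d sV])
        show "br x v \<in> ?V" if "x \<in> T" "v \<in> ?V" for x v
          using that less.prems(2) gen_eig_br[OF nilpotent_gen_eig[OF T h(1)], of x v c] by auto
      qed
      also have "\<dots> \<subseteq> span (\<Union>\<nu>\<in>?N. V \<inter> gen_weight T br \<nu>)" by (intro span_mono) auto
      finally show ?thesis .
    qed
    have "V \<subseteq> span (\<Union>c. V \<inter> gen_eig (br h) c)"
      using span_gen_eig[OF lin_br less.prems(1) less.prems(2)[OF h(1)]] by auto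
    also have "\<dots> \<subseteq> span (\<Union>\<nu>\<in>?N. V \<inter> gen_weight T br \<nu>)"
      using part by (intro span_minimal) auto
    finally show ?thesis .
  qed
qed

section \<open>Traces and the Killing form\<close>

lemma rep_linear: "Vector_Spaces.linear scale (*) (\<lambda>v. representation Basis v b)"
  by (rule linear_representation[OF independent_Basis span_Basis])

lemma rep_sum: "(\<Sum>b\<in>Basis. representation Basis v b *s b) = v"
  by (rule sum_representation_eq) (auto simp: independent_Basis span_Basis finite_Basis)

text \<open>Root vectors come with an expansion of this kind (\<open>root_expansion\<close>),
  and the Killing form of a Cartan subalgebra is computed from it
  (\<open>killing_t\<close>).\<close>

lemma trace_frame:
  assumes f: "Vector_Spaces.linear scale scale f"
    and I: "finite I" and \<phi>: "\<And>i. i \<in> I \<Longrightarrow> Vector_Spaces.linear scale (*) (\<phi> i)"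
    and ex: "\<And>x. x = (\<Sum>i\<in>I. \<phi> i x *s v i)"
  shows "trace f = (\<Sum>i\<in>I. \<phi> i (f (v i)))"
proof -
  have fb: "representation Basis (f b) b = (\<Sum>i\<in>I. \<phi> i b * representation Basis (f (v i)) b)" for b
  proof -
    have "f b = (\<Sum>i\<in>I. \<phi> i b *s f (v i))"
      by (subst (1) ex[of b]) (simp add: lin_sum[OF f] lin_scale[OF f])
    then show ?thesis by (simp add: lin_sum[OF rep_linear] lin_scale[OF rep_linear])
  qed
  have "trace f = (\<Sum>b\<in>Basis. \<Sum>i\<in>I. \<phi> i b * representation Basis (f (v i)) b)"
    unfolding trace_def fb ..
  also have "\<dots> = (\<Sum>i\<in>I. \<Sum>b\<in>Basis. representation Basis (f (v i)) b * \<phi> i b)"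
    by (subst sum.swap) (simp add: mult.commute)
  also have "\<dots> = (\<Sum>i\<in>I. \<phi> i (\<Sum>b\<in>Basis. representation Basis (f (v i)) b *s b))"
    by (intro sum.cong refl) (simp add: lin_sum[OF \<phi>] lin_scale[OF \<phi>])
  finally show ?thesis unfolding rep_sum .
qed

lemma trace_comm:
  assumes f: "Vector_Spaces.linear scale scale f" and g: "Vector_Spaces.linear scale scale g"
  shows "trace (\<lambda>x. f (g x)) = trace (\<lambda>x. g (f x))"
proof -
  have *: "trace (\<lambda>x. f (g x)) =
      (\<Sum>b\<in>Basis. \<Sum>c\<in>Basis. representation Basis (g b) c * representation Basis (f c) b)"
    if f: "Vector_Spaces.linear scale scale f" for f g
  proof -
    have "f (g b) = (\<Sum>c\<in>Basis. representation Basis (g b) c *s f c)" for b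
      by (subst (1) rep_sum[of "g b", symmetric]) (simp add: lin_sum[OF f] lin_scale[OF f])
    then show ?thesis unfolding trace_def
      by (simp add: lin_sum[OF rep_linear] lin_scale[OF rep_linear])
  qed
  show ?thesis unfolding *[OF f] *[OF g] by (subst sum.swap) (simp add: mult.commute)
qed

lemma trace_add: "trace (\<lambda>x. f x + g x) = trace f + trace g"
  and trace_scale: "trace (\<lambda>x. c *s f x) = c * trace f"
  and trace_diff: "trace (\<lambda>x. f x - g x) = trace f - trace g"
  unfolding trace_def
  by (simp_all add: lin_add[OF rep_linear] lin_diff[OF rep_linear] lin_scale[OF rep_linear]
      sum.distrib sum_distrib_left sum_subtractf)

lemma lin_br_br: "Vector_Spaces.linear scale scale (\<lambda>z. br x (br y z))"
  by (simp add: Vector_Spaces.linear_iff br_add_right br_scale_right vector_space_axioms)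

lemma killing_sym: "killing x y = killing y x"
  unfolding killing_def by (rule trace_comm[OF lin_br lin_br])

lemma lin_killing: "Vector_Spaces.linear scale (*) (killing x)"
proof -
  have "vector_space ((*) :: 'k \<Rightarrow> 'k \<Rightarrow> 'k)" by unfold_locales (simp_all add: algebra_simps)
  then show ?thesis unfolding Vector_Spaces.linear_iff killing_def
    by (simp add: br_add_left br_scale_left br_add_right br_scale_right trace_add trace_scale
        vector_space_axioms)
qed

lemma lin_killing_left: "Vector_Spaces.linear scale (*) (\<lambda>x. killing x y)"
  using lin_killing[of y] by (simp add: killing_sym[of _ y])

lemmas killing_add = lin_add[OF lin_killing] lin_add[OF lin_killing_left]
lemmas killing_zero [simp] = lin_zero[OF lin_killing] lin_zero[OF lin_killing_left]
lemmas killing_diff = lin_diff[OF lin_killing] lin_diff[OF lin_killing_left]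
lemmas killing_neg = lin_neg[OF lin_killing] lin_neg[OF lin_killing_left]
lemmas killing_scale = lin_scale[OF lin_killing] lin_scale[OF lin_killing_left]
lemmas killing_sum = lin_sum[OF lin_killing] lin_sum[OF lin_killing_left]

lemma killing_inv: "killing (br x y) z = killing x (br y z)"
proof -
  have "killing (br x y) z = trace (\<lambda>w. br x (br y (br z w)) - br y (br x (br z w)))"
    unfolding killing_def br_br by simp
  also have "\<dots> = trace (\<lambda>w. br x (br y (br z w))) - trace (\<lambda>w. br x (br z (br y w)))"
    unfolding trace_diff using trace_comm[OF lin_br lin_br_br, of y x z] by simp
  also have "\<dots> = killing x (br y z)"
    unfolding killing_def br_br trace_diff[symmetric] by (simp add: br_diff)
  finally show ?thesis .
qed

lemma killing_inv': "killing (br x y) z = - killing y (br x z)"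
  using killing_inv[of y x z] br_skew[of x y] by (simp add: killing_neg)

text \<open>By invariance, \<open>(a + b) \<Phi>(x, y)\<close> equals \<open>- \<Phi>((ad h - a)
  x, y) - \<Phi>(x, (ad h - b) y)\<close>; induction on the sum of the exponents.\<close>

lemma killing_gen_eig:
  assumes "x \<in> gen_eig (br h) a" "y \<in> gen_eig (br h) b" and ab: "a + b \<noteq> 0"
  shows "killing x y = 0"
proof -
  have "((\<lambda>v. br h v - a *s v) ^^ m) x = 0 \<Longrightarrow> ((\<lambda>v. br h v - b *s v) ^^ n) y = 0 \<Longrightarrow>
    killing x y = 0" for m n x y
  proof (induction "m + n" arbitrary: m n x y)
    case 0
    then show ?case by simp
  next
    case (Suc N)
    show ?case
    proof (cases "m = 0 \<or> n = 0")
      case True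
      then show ?thesis using Suc.prems by auto
    next
      case False
      then obtain m' n' where mn: "m = Suc m'" "n = Suc n'" by (auto simp: gr0_conv_Suc)
      let ?x = "br h x - a *s x" and ?y = "br h y - b *s y"
      have "((\<lambda>v. br h v - a *s v) ^^ m') ?x = 0" "((\<lambda>v. br h v - b *s v) ^^ n') ?y = 0"
        using Suc.prems mn by (simp_all add: funpow_Suc_right del: funpow.simps(2))
      then have "killing ?x y = 0" "killing x ?y = 0"
        using Suc.hyps(1)[of m' n ?x y] Suc.hyps(1)[of m n' x ?y] Suc.hyps(2) Suc.prems mn by auto
      moreover have "killing ?x y + killing x ?y = - ((a + b) * killing x y)"
        by (simp add: killing_diff killing_scale killing_inv' algebra_simps)
      ultimately have "(a + b) * killing x y = 0" by simp
      then show ?thesis using ab by simp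
    qed
  qed
  then show ?thesis using assms unfolding gen_eig_def by blast
qed

text \<open>A basis adapted to the chain of images of the powers of \<open>f\<close>: each basis
  vector is mapped into the span of basis vectors further down the chain, so all diagonal
  entries vanish.\<close>

lemma trace_nilpotent:
  assumes f: "Vector_Spaces.linear scale scale f" and nil: "\<And>x. (f ^^ m) x = 0"
  shows "trace f = 0"
proof -
  have lin: "Vector_Spaces.linear scale scale (f ^^ k)" for k by (rule lin_funpow[OF f])
  have sub: "subspace (range (f ^^ k))" for k
  proof -
    from lin[of k] interpret f: Vector_Spaces.linear scale scale "f ^^ k" .
    show ?thesis by (rule f.subspace_image) simp
  qed
  have "j \<le> m \<Longrightarrow> \<exists>A. independent A \<and> span A = range (f ^^ (m - j)) \<and>
      (\<forall>a\<in>A. representation A (f a) a = 0)" for j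
  proof (induction j)
    case 0
    have "range (f ^^ m) = {0}" using nil by auto
    then show ?case by (intro exI[of _ "{}"]) (simp add: independent_empty)
  next
    case (Suc j)
    define i where "i = m - Suc j"
    have i: "m - j = Suc i" using Suc.prems unfolding i_def by simp
    obtain A where A: "independent A" "span A = range (f ^^ Suc i)"
      "\<And>a. a \<in> A \<Longrightarrow> representation A (f a) a = 0" using Suc unfolding i by auto
    have "A \<subseteq> range (f ^^ i)"
    proof -
      have "range (f ^^ Suc i) \<subseteq> range (f ^^ i)"
        by (auto simp: funpow_Suc_right simp del: funpow.simps(2))
      then show ?thesis using A(2) span_superset by blast
    qed
    then obtain A' where A': "A \<subseteq> A'" "A' \<subseteq> range (f ^^ i)" "independent A'" "range (f ^^ i) \<subseteq> span A'"
      using maximal_independent_subset_extend[OF _ A(1)] by blast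
    have sp: "span A' = range (f ^^ i)" using A' sub[of i] span_minimal by blast
    have "representation A' (f a) a = 0" if a: "a \<in> A'" for a
    proof -
      have "a \<in> range (f ^^ i)" using a A'(2) by blast
      then have fa: "f a \<in> span A" unfolding A(2) by auto
      have "representation A' (f a) = representation A (f a)"
        by (rule representation_extend[OF A'(3) fa A'(1)])
      then show ?thesis using A(3) representation_ne_zero[of A "f a" a] by metis
    qed
    then show ?case using A' sp unfolding i_def by blast
  qed
  from this[of m] obtain A where A: "independent A" "span A = UNIV" "\<And>a. a \<in> A \<Longrightarrow> representation A (f a) a = 0"
    by auto
  have "trace f = (\<Sum>a\<in>A. representation A (f a) a)"
  proof (rule trace_frame[OF f])
    show "finite A" by (rule finiteI_independent[OF A(1)])
    show "x = (\<Sum>i\<in>A. representation A x i *s i)" for x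
      by (rule sum_representation_eq[symmetric]) (use A \<open>finite A\<close> in auto)
  qed (rule linear_representation[OF A(1,2)])
  then show ?thesis using A(3) by simp
qed

lemma trace_locally_nilpotent:
  assumes f: "Vector_Spaces.linear scale scale f" and nil: "\<And>x. \<exists>n. (f ^^ n) x = 0"
  shows "trace f = 0"
proof -
  obtain n where n: "\<And>x. (f ^^ n x) x = 0" using nil by metis
  define m where "m = Max (n ` Basis)"
  have z: "(f ^^ m) b = 0" if "b \<in> Basis" for b
  proof (rule funpow_zero_mono[OF f n])
    show "n b \<le> m" unfolding m_def using that finite_Basis by auto
  qed
  have "(f ^^ m) x = (\<lambda>_. 0) x" for x
  proof (rule lin_eq_on_span[OF lin_funpow[OF f]])
    show "Vector_Spaces.linear scale scale (\<lambda>_. 0)" by (simp add: Vector_Spaces.linear_iff vector_space_axioms)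
    show "x \<in> span Basis" by (simp add: span_Basis)
  qed (use z in auto)
  then show ?thesis using trace_nilpotent[OF f] by blast
qed

end

section \<open>Cartan subalgebras act diagonalisably\<close>

lemma (in operator_space) gen_eig_independent:
  assumes C: "finite C" and X: "Vector_Spaces.linear scale scale X"
    and y: "\<And>c. c \<in> C \<Longrightarrow> y c \<in> gen_eig X c" and s: "(\<Sum>c\<in>C. y c) = 0" and c: "c \<in> C"
  shows "y c = 0"
proof -
  let ?L = "(\<lambda>c (_::unit). c) ` C"
  have inj: "inj_on (\<lambda>c (_::unit). c) C" by (auto simp: inj_on_def fun_eq_iff)
  have "\<forall>\<kappa>\<in>?L. (\<lambda>\<kappa>. y (\<kappa> ())) \<kappa> = 0"
  proof (rule gen_weight_independent[of ?L UNIV "\<lambda>_. X"])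
    show "(\<Sum>\<kappa>\<in>?L. y (\<kappa> ())) = 0" using s by (simp add: sum.reindex[OF inj])
    show "\<exists>h\<in>UNIV. \<kappa> h \<noteq> \<mu> h" if "\<kappa> \<noteq> \<mu>" for \<kappa> \<mu> :: "unit \<Rightarrow> 'a" using that by auto
  qed (use C X y gen_eig_shift[OF X] in \<open>auto simp: gen_weight_def\<close>)
  then show ?thesis using c by auto
qed

lemma vector_space_field: "vector_space ((*) :: 'a::field \<Rightarrow> 'a \<Rightarrow> 'a)"
  by unfold_locales (simp_all add: algebra_simps)

locale killing_cartan = lie_algebra +
  fixes t :: "'b set"
  assumes nondeg: "(\<And>y. killing x y = 0) \<Longrightarrow> x = 0"
    and cartan: "cartan_subalgebra t"
begin

lemma killing_represents:
  assumes \<phi>: "Vector_Spaces.linear scale (*) \<phi>"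
  obtains x where "\<And>y. killing x y = \<phi> y"
proof -
  define T where "T x = (\<Sum>b\<in>Basis. killing x b *s b)" for x
  have T: "Vector_Spaces.linear scale scale T"
    unfolding T_def Vector_Spaces.linear_iff
    by (simp add: killing_add killing_scale scale_left_distrib sum.distrib scale_sum_right vector_space_axioms)
  have on_basis: "killing x y = \<psi> y"
    if "Vector_Spaces.linear scale (*) \<psi>" "\<And>b. b \<in> Basis \<Longrightarrow> killing x b = \<psi> b" for x y \<psi>
    by (rule lin_eq_on_span[OF lin_killing that(1), of y Basis]) (use that(2) in \<open>auto simp: span_Basis\<close>)
  have zero: "Vector_Spaces.linear scale (*) (\<lambda>_. 0 :: 'a)"
    by (simp add: Vector_Spaces.linear_iff vector_space_axioms vector_space_field)
  have "inj T"
  proof (rule injI)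
    fix x y assume "T x = T y"
    then have "(\<Sum>b\<in>Basis. killing (x - y) b *s b) = 0"
      using lin_diff[OF T, of x y] unfolding T_def[symmetric] by simp
    then have "killing (x - y) b = 0" if "b \<in> Basis" for b
      using independentD[OF independent_Basis finite_Basis subset_refl, of "\<lambda>b. killing (x - y) b" b] that
      by simp
    then have "killing (x - y) z = 0" for z using on_basis[OF zero] by blast
    then show "x = y" using nondeg[of "x - y"] by simp
  qed
  then have "surj T" using linear_inj_imp_surj T by blast
  then obtain x where x: "T x = (\<Sum>b\<in>Basis. \<phi> b *s b)" by (metis surjD)
  have "(\<Sum>b\<in>Basis. (killing x b - \<phi> b) *s b) = 0"
    using x unfolding T_def by (simp add: scale_left_diff_distrib sum_subtractf)
  then have "killing x b = \<phi> b" if "b \<in> Basis" for b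
    using independentD[OF independent_Basis finite_Basis subset_refl, of "\<lambda>b. killing x b - \<phi> b" b] that
    by simp
  then show ?thesis using on_basis[OF \<phi>] that by blast
qed

text \<open>Let \<open>x\<close> represent the functional \<open>y \<mapsto> tr (D ad y)\<close>
  and put \<open>E = D - ad x\<close>, so that \<open>tr (E ad y) = 0\<close> for all
  \<open>y\<close>. Then \<open>\<Phi>(E y, z) = tr ([E, ad y] ad z) = tr (E ad [y, z]) =
  0\<close>.\<close>

lemma derivation_inner:
  assumes D: "Vector_Spaces.linear scale scale D"
    and der: "\<And>x y. D (br x y) = br (D x) y + br x (D y)"
  obtains x where "\<And>y. D y = br x y"
proof -
  have linD: "Vector_Spaces.linear scale scale (\<lambda>z. D (br y z))" for y
    by (simp add: Vector_Spaces.linear_iff lin_add[OF D] lin_scale[OF D] br_add_right br_scale_right vector_space_axioms)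
  have L: "Vector_Spaces.linear scale (*) (\<lambda>y. trace (\<lambda>z. D (br y z)))"
    by (simp add: Vector_Spaces.linear_iff lin_add[OF D] lin_scale[OF D] br_add_left br_scale_left
        trace_add trace_scale vector_space_axioms vector_space_field)
  obtain x where x: "\<And>y. killing x y = trace (\<lambda>z. D (br y z))"
    using killing_represents[OF L] by metis
  define E where "E y = D y - br x y" for y
  have E: "Vector_Spaces.linear scale scale E" unfolding E_def
    by (simp add: Vector_Spaces.linear_iff lin_add[OF D] lin_scale[OF D] br_add_right br_scale_right
        scale_right_diff_distrib vector_space_axioms)
  have Eder: "E (br y z) = br (E y) z + br y (E z)" for y z
    unfolding E_def der br_deriv[of x y z] by (simp add: br_diff)
  have tr0: "trace (\<lambda>z. E (br y z)) = 0" for y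
    unfolding E_def trace_diff using x[of y] unfolding killing_def by simp
  have linEbr: "Vector_Spaces.linear scale scale (\<lambda>w. E (br y w))" for y
    by (simp add: Vector_Spaces.linear_iff lin_add[OF E] lin_scale[OF E] br_add_right br_scale_right vector_space_axioms)
  have "E y = 0" for y
  proof (rule nondeg)
    fix z
    have "killing (E y) z = trace (\<lambda>w. E (br y (br z w)) - br y (E (br z w)))"
      unfolding killing_def using Eder[of y] by (simp add: algebra_simps)
    also have "\<dots> = trace (\<lambda>w. E (br y (br z w))) - trace (\<lambda>w. E (br z (br y w)))"
      unfolding trace_diff using trace_comm[OF lin_br linEbr, of y z] by simp
    also have "\<dots> = trace (\<lambda>w. E (br (br y z) w))"
      unfolding trace_diff[symmetric] br_br lin_diff[OF E] ..
    finally show "killing (E y) z = 0" using tr0 by simp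
  qed
  then have "D y = br x y" for y unfolding E_def by simp
  then show ?thesis by (rule that)
qed

lemma t_subalgebra: "subalgebra t" and t_norm: "(\<And>y. y \<in> t \<Longrightarrow> br x y \<in> t) \<Longrightarrow> x \<in> t"
  and t_nilpotent: "\<exists>n. lower_central t n = {0}"
  using cartan unfolding cartan_subalgebra_def normalizer_def by auto

lemma subspace_t: "subspace t" and br_t: "x \<in> t \<Longrightarrow> y \<in> t \<Longrightarrow> br x y \<in> t"
  using t_subalgebra unfolding subalgebra_def by auto

lemma t_gen_eig: "h \<in> t \<Longrightarrow> x \<in> t \<Longrightarrow> x \<in> gen_eig (br h) 0"
  using t_nilpotent nilpotent_gen_eig by blast

abbreviation "gw \<equiv> gen_weight t br"

lemma subspace_gw: "subspace (gw \<nu>)"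
  by (rule subspace_gen_weight) (rule lin_br)

lemma gw_stable: "h \<in> t \<Longrightarrow> v \<in> gw \<nu> \<Longrightarrow> br h v \<in> gw \<nu>"
  using gen_eig_br[of h _ 0 v] t_gen_eig[of _ h] unfolding gen_weight_def by force

text \<open>A common eigenvector in the quotient of the zero weight space by \<open>t\<close>
  has eigenvalue 0, since \<open>t\<close> acts nilpotently; it therefore normalises
  \<open>t\<close>, and lies in \<open>t\<close>.\<close>

lemma gw_zero: "gw (\<lambda>_. 0) = t"
proof (rule ccontr)
  assume ne: "gw (\<lambda>_. 0) \<noteq> t"
  have "t \<subseteq> gw (\<lambda>_. 0)" using t_gen_eig unfolding gen_weight_def by auto
  then have ss: "t \<subset> gw (\<lambda>_. 0)" using ne by auto
  obtain N where N: "lower_central t N = {0}" using t_nilpotent by blast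
  obtain v \<nu> where v: "v \<in> gw (\<lambda>_. 0)" "v \<notin> t" and nu: "\<And>h. h \<in> t \<Longrightarrow> br h v - \<nu> h *s v \<in> t"
    using relative_common_eigenvector[OF t_subalgebra N subspace_gw gw_stable subspace_t br_t ss]
    by metis
  have "br v h \<in> t" if h: "h \<in> t" for h
  proof -
    have it: "(br h ^^ n) v - (\<nu> h) ^ n *s v \<in> t" for n
    proof (induction n)
      case 0
      show ?case using subspace_0[OF subspace_t] by simp
    next
      case (Suc n)
      have "br h ((br h ^^ n) v) - (\<nu> h) ^ Suc n *s v
        = br h ((br h ^^ n) v - (\<nu> h) ^ n *s v) + (\<nu> h) ^ n *s (br h v - \<nu> h *s v)"
        by (simp add: br_diff br_scale_right scale_right_diff_distrib mult.commute)
      moreover have "\<dots> \<in> t"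
        by (intro subspace_add[OF subspace_t] subspace_scale[OF subspace_t] br_t[OF h Suc] nu[OF h])
      ultimately show ?case by (simp only: funpow.simps o_apply)
    qed
    obtain n where n: "(br h ^^ n) v = 0"
      using v(1) h unfolding gen_weight_def gen_eig_def by auto
    have "\<nu> h = 0"
    proof (rule ccontr)
      assume nz: "\<nu> h \<noteq> 0"
      have "(\<nu> h) ^ n *s v \<in> t" using it[of n] n subspace_neg[OF subspace_t] by fastforce
      then have "inverse ((\<nu> h) ^ n) *s ((\<nu> h) ^ n *s v) \<in> t" by (rule subspace_scale[OF subspace_t])
      then show False using nz v(2) by simp
    qed
    then have "br h v \<in> t" using nu[OF h] by simp
    then show ?thesis using br_skew[of v h] subspace_neg[OF subspace_t] by simp
  qed
  then show False using t_norm v(2) by blast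
qed

lemma gw_zero': "(\<And>h. h \<in> t \<Longrightarrow> \<nu> h = 0) \<Longrightarrow> gw \<nu> = t"
  using gw_zero unfolding gen_weight_def by auto

lemma gw_span: "span (\<Union>\<nu>\<in>{\<nu>. \<forall>x. x \<notin> t \<longrightarrow> \<nu> x = 0}. gw \<nu>) = UNIV"
proof -
  obtain N where N: "lower_central t N = {0}" using t_nilpotent by blast
  have "UNIV \<subseteq> span (\<Union>\<nu>\<in>{\<nu>. \<forall>x. x \<notin> t \<longrightarrow> \<nu> x = 0}. UNIV \<inter> gw \<nu>)"
    by (rule gen_weight_decomposition[OF N subspace_UNIV]) simp
  then show ?thesis unfolding Int_UNIV_left by (rule top.extremum_uniqueI)
qed

lemma common_eigenvector:
  assumes "gw \<nu> \<noteq> {0}"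
  obtains v where "v \<in> gw \<nu>" "v \<noteq> 0" "\<And>h. h \<in> t \<Longrightarrow> br h v = \<nu> h *s v"
proof -
  obtain N where N: "lower_central t N = {0}" using t_nilpotent by blast
  have "{0} \<subset> gw \<nu>" using assms subspace_0[OF subspace_gw] by blast
  moreover have "br h v \<in> {0}" if "v \<in> {0}" for h v using that by simp
  ultimately obtain v \<mu> where v: "v \<in> gw \<nu>" "v \<notin> {0}"
    and mu': "\<And>h. h \<in> t \<Longrightarrow> br h v - \<mu> h *s v \<in> {0}"
    using relative_common_eigenvector[OF t_subalgebra N subspace_gw gw_stable subspace_single_0]
    by metis
  have mu: "br h v = \<mu> h *s v" if "h \<in> t" for h using mu'[OF that] by simp
  have "\<mu> h = \<nu> h" if h: "h \<in> t" for h
  proof (rule ccontr)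
    assume "\<mu> h \<noteq> \<nu> h"
    moreover have "v \<in> gen_eig (br h) (\<nu> h)" using v(1) h unfolding gen_weight_def by simp
    ultimately show False using gen_eig_disjoint1[OF lin_br _ mu[OF h], of "\<nu> h"] v(2) by simp
  qed
  then show ?thesis using that[of v] v mu by simp
qed

lemma weight_dual:
  assumes "gw \<nu> \<noteq> {0}" "\<And>x. x \<notin> t \<Longrightarrow> \<nu> x = 0"
  shows "\<nu> \<in> dual_space t"
proof -
  obtain v where v: "v \<noteq> 0" "\<And>h. h \<in> t \<Longrightarrow> br h v = \<nu> h *s v"
    using common_eigenvector[OF assms(1)] by metis
  have add: "\<nu> (x + y) = \<nu> x + \<nu> y" if "x \<in> t" "y \<in> t" for x y
  proof -
    have "\<nu> (x + y) *s v = br (x + y) v" using v(2)[OF subspace_add[OF subspace_t that]] by simp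
    also have "\<dots> = (\<nu> x + \<nu> y) *s v"
      using v(2)[OF that(1)] v(2)[OF that(2)] by (simp only: br_add_left scale_left_distrib)
    finally show ?thesis using v(1) by simp
  qed
  have scl: "\<nu> (c *s x) = c * \<nu> x" if "x \<in> t" for c x
  proof -
    have "\<nu> (c *s x) *s v = br (c *s x) v" using v(2)[OF subspace_scale[OF subspace_t that]] by simp
    also have "\<dots> = (c * \<nu> x) *s v" using v(2)[OF that] by (simp only: br_scale_left scale_scale)
    finally show ?thesis using v(1) by (simp only: scale_cancel_right) simp
  qed
  show ?thesis unfolding dual_space_def mem_Collect_eq using add scl assms(2) by blast
qed

lemma weight_derived:
  assumes "gw \<nu> \<noteq> {0}" "c \<in> lower_central t (Suc m)"
  shows "\<nu> c = 0"
proof -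
  obtain v where v: "v \<noteq> 0" "\<And>h. h \<in> t \<Longrightarrow> br h v = \<nu> h *s v"
    using common_eigenvector[OF assms(1)] by metis
  have ct: "c \<in> t" using assms(2) lower_central_subset'[OF t_subalgebra] by blast
  have "br c v = 0"
    using assms(2)[unfolded lower_central.simps]
  proof (induction rule: span_induct_alt)
    case (step b x y)
    then obtain p q where pq: "x = br p q" "p \<in> t" "q \<in> lower_central t m" by blast
    then have "q \<in> t" using lower_central_subset'[OF t_subalgebra] by (auto dest: subsetD)
    then have "br x v = 0" using v(2) pq(1,2) by (simp add: br_br br_scale_right mult.commute)
    then show ?case using step by (simp add: br_add_left br_scale_left)
  qed simp
  then show ?thesis using v(1) v(2)[OF ct] by simp
qed

lemma killing_gw: "x \<in> gw \<mu> \<Longrightarrow> y \<in> gw \<nu> \<Longrightarrow> h \<in> t \<Longrightarrow> \<mu> h + \<nu> h \<noteq> 0 \<Longrightarrow> killing x y = 0"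
  using killing_gen_eig unfolding gen_weight_def by blast

lemma killing_zero_if_gw:
  assumes "\<And>\<nu> y. y \<in> gw \<nu> \<Longrightarrow> killing x y = 0"
  shows "x = 0"
proof (rule nondeg)
  fix y
  have zero: "Vector_Spaces.linear scale (*) (\<lambda>_. 0 :: 'a)"
    by (simp add: Vector_Spaces.linear_iff vector_space_axioms vector_space_field)
  show "killing x y = 0"
    by (rule lin_eq_on_span[OF lin_killing zero, where A = "\<Union>\<nu>\<in>{\<nu>. \<forall>x. x \<notin> t \<longrightarrow> \<nu> x = 0}. gw \<nu>"])
      (use assms in \<open>auto simp: gw_span\<close>)
qed

lemma t_nondeg:
  assumes "z \<in> t" "\<And>h. h \<in> t \<Longrightarrow> killing z h = 0"
  shows "z = 0"
proof (rule killing_zero_if_gw)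
  fix \<nu> y assume y: "y \<in> gw \<nu>"
  show "killing z y = 0"
  proof (cases "\<forall>h\<in>t. \<nu> h = 0")
    case True
    then have "gw \<nu> = t" by (intro gw_zero') auto
    then show ?thesis using assms(2) y by auto
  next
    case False
    then obtain h where "h \<in> t" "\<nu> h \<noteq> 0" by blast
    then show ?thesis using killing_gw[of z "\<lambda>_. 0" y \<nu> h] assms(1) y gw_zero by auto
  qed
qed

text \<open>For \<open>h\<close> in \<open>t\<close> the operator \<open>ad z ad h\<close> is
  nilpotent, because \<open>ad z\<close> is and the two factors commute. So \<open>z\<close> is
  orthogonal to \<open>t\<close>.\<close>

lemma locally_nilpotent_zero:
  assumes z: "z \<in> t" and c: "\<And>h. h \<in> t \<Longrightarrow> br h z = 0" and nil: "\<And>x. x \<in> gen_eig (br z) 0"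
  shows "z = 0"
proof (rule t_nondeg[OF z])
  fix h assume h: "h \<in> t"
  have cm: "br z (br h x) = br h (br z x)" for x
    using br_deriv[of h z x] c[OF h] by simp
  show "killing z h = 0" unfolding killing_def
  proof (rule trace_locally_nilpotent[OF lin_br_br])
    fix x
    have cm': "(br z ^^ n) (br h y) = br h ((br z ^^ n) y)" for n y
      by (induction n) (simp_all add: cm)
    have "((\<lambda>w. br z (br h w)) ^^ n) x = (br h ^^ n) ((br z ^^ n) x)" for n
    proof (induction n)
      case (Suc n)
      have "((\<lambda>w. br z (br h w)) ^^ Suc n) x = br z (br h ((br h ^^ n) ((br z ^^ n) x)))"
        using Suc by simp
      also have "\<dots> = br z ((br h ^^ Suc n) ((br z ^^ n) x))" by simp
      also have "\<dots> = (br h ^^ Suc n) (br z ((br z ^^ n) x))"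
      proof -
        have "br z ((br h ^^ k) w) = (br h ^^ k) (br z w)" for k w
          by (induction k) (simp_all add: cm)
        then show ?thesis .
      qed
      finally show ?case by simp
    qed simp
    moreover obtain n where "(br z ^^ n) x = 0" using nil[of x] unfolding gen_eig_def by auto
    ultimately show "\<exists>n. ((\<lambda>w. br z (br h w)) ^^ n) x = 0"
      using lin_zero[OF lin_funpow[OF lin_br]] by metis
  qed
qed

text \<open>Otherwise the last nonzero term of the central series is spanned by brackets and is
  central. Weights vanish on brackets, so its elements act nilpotently, and they are zero by
  \<open>locally_nilpotent_zero\<close>.\<close>

lemma t_abelian:
  assumes "x \<in> t" "y \<in> t"
  shows "br x y = 0"
proof -
  define n where "n = (LEAST n. lower_central t n = {0})"
  have n: "lower_central t n = {0}" unfolding n_def by (rule LeastI_ex[OF t_nilpotent])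
  have least: "lower_central t m \<noteq> {0}" if "m < n" for m
    using not_less_Least that unfolding n_def by blast
  have "n \<le> 1"
  proof (rule ccontr)
    assume "\<not> n \<le> 1"
    then obtain m where m: "n = Suc (Suc m)" by (auto simp: not_le less_iff_Suc_add)
    have "0 \<in> lower_central t (Suc m)" using subspace_0[OF subspace_lower_central[OF t_subalgebra]] .
    then obtain c where c: "c \<in> lower_central t (Suc m)" "c \<noteq> 0"
      using least[of "Suc m"] m by blast
    have "c = 0"
    proof (rule locally_nilpotent_zero)
      show ct: "c \<in> t" using c(1) lower_central_subset'[OF t_subalgebra] by blast
      show "br h c = 0" if "h \<in> t" for h
        using lower_central_br[OF that c(1)] n m by simp
      show "x \<in> gen_eig (br c) 0" for x
      proof -
        have "gw \<nu> \<subseteq> gen_eig (br c) 0" for \<nu>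
        proof (cases "gw \<nu> = {0}")
          case True
          then show ?thesis using subspace_0[OF subspace_gen_eig[OF lin_br]] by auto
        next
          case False
          then have "\<nu> c = 0" using weight_derived c(1) by blast
          then show ?thesis using ct unfolding gen_weight_def by auto
        qed
        then have "span (\<Union>\<nu>\<in>{\<nu>. \<forall>x. x \<notin> t \<longrightarrow> \<nu> x = 0}. gw \<nu>) \<subseteq> gen_eig (br c) 0"
          by (intro span_minimal subspace_gen_eig[OF lin_br]) auto
        then show ?thesis using gw_span by auto
      qed
    qed
    then show False using c(2) by simp
  qed
  then consider "n = 0" | "n = Suc 0" by linarith
  then show ?thesis
  proof cases
    case 1
    then show ?thesis using n assms by simp
  next
    case 2
    then show ?thesis using n lower_central_br[of x t y 0] assms by simp
  qed
qed

text \<open>The semisimple part \<open>s\<close> of \<open>ad h\<close>, which acts as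
  \<open>c\<close> on the generalised eigenspace for \<open>c\<close>, is a derivation, hence
  equal to \<open>ad x0\<close> for some \<open>x0\<close>. As \<open>s\<close> kills
  \<open>t\<close>, the element \<open>x0\<close> lies in \<open>t\<close>; and \<open>h -
  x0\<close> acts nilpotently, so it is zero.\<close>

lemma ad_semisimple:
  assumes h: "h \<in> t" and x: "x \<in> gen_eig (br h) c"
  shows "br h x = c *s x"
proof -
  let ?G = "gen_eig (br h)"
  have subG: "subspace (?G c)" for c by (rule subspace_gen_eig[OF lin_br])
  have spG: "span (\<Union>c. ?G c) = UNIV"
    using span_gen_eig[OF lin_br subspace_UNIV, of h] by auto
  obtain A where A: "A \<subseteq> (\<Union>c. ?G c)" "independent A" "(\<Union>c. ?G c) \<subseteq> span A"
    using maximal_independent_subset by blast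
  have spA: "span A = UNIV" using span_minimal[OF A(3)] spG by auto
  have finA: "finite A" by (rule finiteI_independent[OF A(2)])
  obtain w where w: "\<And>a. a \<in> A \<Longrightarrow> a \<in> ?G (w a)" using A(1) by (metis UN_E subsetD)
  define s where "s x = (\<Sum>a\<in>A. (representation A x a * w a) *s a)" for x
  have rep: "Vector_Spaces.linear scale (*) (\<lambda>v. representation A v a)" for a
    by (rule linear_representation[OF A(2) spA])
  have s: "Vector_Spaces.linear scale scale s"
    unfolding s_def Vector_Spaces.linear_iff
    by (simp add: lin_add[OF rep] lin_scale[OF rep] distrib_right scale_left_distrib sum.distrib
        scale_sum_right mult.assoc vector_space_axioms)
  have sG: "s x = c *s x" if x: "x \<in> ?G c" for x c
  proof -
    let ?C = "insert c (w ` A)"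
    \<comment> \<open>The components of x for the eigenvalues of ad h; independence identifies
      them with x and 0.\<close>
    define y where "y d = (\<Sum>a\<in>{a\<in>A. w a = d}. representation A x a *s a)" for d
    have yG: "y d \<in> ?G d" for d unfolding y_def using w subG
      by (intro subspace_sum) (auto intro: subspace_scale)
    have "x = (\<Sum>a\<in>A. representation A x a *s a)"
      by (rule sum_representation_eq[symmetric]) (use A spA finA in auto)
    also have "\<dots> = (\<Sum>d\<in>?C. y d)" unfolding y_def
      by (rule sum.group[symmetric]) (use finA in auto)
    finally have xs: "x = (\<Sum>d\<in>?C. y d)" .
    define y' where "y' d = y d - (if d = c then x else 0)" for d
    have "(\<Sum>d\<in>?C. y' d) = 0" unfolding y'_def sum_subtractf
      using xs finA by (simp add: sum.delta)
    moreover have "y' d \<in> ?G d" for d unfolding y'_def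
      using yG[of d] x subG[of d] by (auto intro: subspace_diff)
    ultimately have y0: "y' d = 0" if "d \<in> ?C" for d
      using gen_eig_independent[of ?C "br h" y' d] finA lin_br that by auto
    have "s x = (\<Sum>d\<in>?C. \<Sum>a\<in>{a\<in>A. w a = d}. (representation A x a * w a) *s a)"
      unfolding s_def by (rule sum.group[symmetric]) (use finA in auto)
    also have "\<dots> = (\<Sum>d\<in>?C. d *s y d)" unfolding y_def
      by (intro sum.cong refl) (simp add: scale_sum_right mult.commute)
    also have "\<dots> = (\<Sum>d\<in>?C. if d = c then c *s x else 0)"
      by (intro sum.cong refl) (use y0 in \<open>force simp: y'_def\<close>)
    also have "\<dots> = c *s x" using finA by (simp add: sum.delta)
    finally show ?thesis .
  qed
  have "s (br x y) = br (s x) y + br x (s y)" for x y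
  proof -
    have l1: "Vector_Spaces.linear scale scale (\<lambda>x. s (br x y))"
      "Vector_Spaces.linear scale scale (\<lambda>x. br (s x) y + br x (s y))"
      "Vector_Spaces.linear scale scale (\<lambda>y. s (br x y))"
      "Vector_Spaces.linear scale scale (\<lambda>y. br (s x) y + br x (s y))" for x y
      by (simp_all add: Vector_Spaces.linear_iff lin_add[OF s] lin_scale[OF s] br_add_left br_add_right
          br_scale_left br_scale_right scale_right_distrib vector_space_axioms algebra_simps)
    have "s (br x y) = br (s x) y + br x (s y)" if y: "y \<in> ?G d" for x y d
    proof (rule lin_eq_on_span[OF l1(1,2), of x "\<Union>c. ?G c"])
      fix a assume "a \<in> (\<Union>c. ?G c)"
      then obtain c where a: "a \<in> ?G c" by blast
      then show "s (br a y) = br (s a) y + br a (s y)"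
        using sG[OF a] sG[OF y] sG[OF gen_eig_br[OF a y]]
        by (simp add: br_scale_left br_scale_right scale_left_distrib)
    qed (simp add: spG)
    then show ?thesis
      by (intro lin_eq_on_span[OF l1(3,4), of y "\<Union>c. ?G c"]) (auto simp: spG)
  qed
  then obtain x0 where x0: "\<And>y. s y = br x0 y" using derivation_inner[OF s] by blast
  have "br x0 h' \<in> t" if "h' \<in> t" for h'
    using sG[OF t_gen_eig[OF h that]] x0[of h'] subspace_0[OF subspace_t] by simp
  then have x0t: "x0 \<in> t" by (rule t_norm)
  have "h - x0 = 0"
  proof (rule locally_nilpotent_zero)
    show zt: "h - x0 \<in> t" using h x0t subspace_t by (simp add: subspace_diff)
    show "br h' (h - x0) = 0" if "h' \<in> t" for h' using t_abelian[OF that zt] .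
    show "v \<in> gen_eig (br (h - x0)) 0" for v
    proof -
      have "?G c \<subseteq> gen_eig (br (h - x0)) 0" for c
      proof
        fix v assume v: "v \<in> ?G c"
        have "(br (h - x0) ^^ n) v = ((\<lambda>v. br h v - c *s v) ^^ n) v
          \<and> ((\<lambda>v. br h v - c *s v) ^^ n) v \<in> ?G c" for n
        proof (induction n)
          case (Suc n)
          let ?u = "((\<lambda>v. br h v - c *s v) ^^ n) v"
          have u: "?u \<in> ?G c" using Suc by blast
          have "br (h - x0) ?u = br h ?u - c *s ?u"
            using sG[OF u] x0[of ?u] by (simp add: br_diff)
          moreover have "br h ?u - c *s ?u \<in> ?G c"
            using gen_eig_shift[OF lin_br u] u subG by (simp add: subspace_diff subspace_scale)
          ultimately show ?case using Suc by simp
        qed (simp add: v)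
        then show "v \<in> gen_eig (br (h - x0)) 0" using v unfolding gen_eig_def by auto
      qed
      then have "span (\<Union>c. ?G c) \<subseteq> gen_eig (br (h - x0)) 0"
        by (intro span_minimal subspace_gen_eig[OF lin_br]) auto
      then show ?thesis using spG by auto
    qed
  qed
  then show ?thesis using sG[OF x] x0[of x] by simp
qed

lemma gw_root_space: "gw \<nu> = root_space t \<nu>"
proof
  show "gw \<nu> \<subseteq> root_space t \<nu>"
    using ad_semisimple unfolding gen_weight_def root_space_def by auto
  show "root_space t \<nu> \<subseteq> gw \<nu>"
    unfolding gen_weight_def root_space_def gen_eig_def
    by (auto intro!: exI[of _ "Suc 0"])
qed

section \<open>Roots\<close>

abbreviation "rs \<equiv> root_space t"
abbreviation "\<Delta> \<equiv> roots t"
abbreviation "t_dual \<equiv> dual_space t"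

lemma subspace_rs: "subspace (rs \<nu>)"
  using subspace_gw unfolding gw_root_space .

lemma rsD: "x \<in> rs \<nu> \<Longrightarrow> h \<in> t \<Longrightarrow> br h x = \<nu> h *s x"
  unfolding root_space_def by blast

lemma rs_zero: "(\<And>h. h \<in> t \<Longrightarrow> \<nu> h = 0) \<Longrightarrow> rs \<nu> = t"
  using gw_zero' unfolding gw_root_space by blast

lemma rs_br: "x \<in> rs \<mu> \<Longrightarrow> y \<in> rs \<nu> \<Longrightarrow> br x y \<in> rs (\<lambda>h. \<mu> h + \<nu> h)"
  unfolding root_space_def
  by (auto simp: br_deriv[of _ x y] br_scale_left br_scale_right scale_left_distrib)

lemma dualD: "\<nu> \<in> t_dual \<Longrightarrow> x \<in> t \<Longrightarrow> y \<in> t \<Longrightarrow> \<nu> (x + y) = \<nu> x + \<nu> y"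
  "\<nu> \<in> t_dual \<Longrightarrow> x \<in> t \<Longrightarrow> \<nu> (c *s x) = c * \<nu> x"
  "\<nu> \<in> t_dual \<Longrightarrow> x \<notin> t \<Longrightarrow> \<nu> x = 0"
  unfolding dual_space_def by blast+

lemma dualI: "(\<And>x y. x \<in> t \<Longrightarrow> y \<in> t \<Longrightarrow> \<nu> (x + y) = \<nu> x + \<nu> y) \<Longrightarrow>
    (\<And>c x. x \<in> t \<Longrightarrow> \<nu> (c *s x) = c * \<nu> x) \<Longrightarrow> (\<And>x. x \<notin> t \<Longrightarrow> \<nu> x = 0) \<Longrightarrow> \<nu> \<in> t_dual"
  unfolding dual_space_def by blast

lemma dual_lincomb: "\<mu> \<in> t_dual \<Longrightarrow> \<nu> \<in> t_dual \<Longrightarrow> (\<lambda>h. a * \<mu> h + b * \<nu> h) \<in> t_dual"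
  by (rule dualI) (simp_all add: dualD algebra_simps)

lemma dual_uminus: "\<nu> \<in> t_dual \<Longrightarrow> - \<nu> \<in> t_dual"
  by (rule dualI) (simp_all add: dualD)

lemma dual_add: "\<mu> \<in> t_dual \<Longrightarrow> \<nu> \<in> t_dual \<Longrightarrow> \<mu> + \<nu> \<in> t_dual"
  by (rule dualI) (simp_all add: dualD algebra_simps)

lemma dual_diff: "\<mu> \<in> t_dual \<Longrightarrow> \<nu> \<in> t_dual \<Longrightarrow> \<mu> - \<nu> \<in> t_dual"
  by (rule dualI) (simp_all add: dualD algebra_simps)

lemma dual_zero: "0 \<in> t_dual"
  by (rule dualI) simp_all

lemma dual_sum: "(\<And>i. i \<in> I \<Longrightarrow> \<nu> i \<in> t_dual) \<Longrightarrow> (\<Sum>i\<in>I. \<nu> i) \<in> t_dual"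
  by (induction I rule: infinite_finite_induct) (auto intro: dual_zero dual_add)

lemma dual_ext:
  assumes "\<mu> \<in> t_dual" "\<nu> \<in> t_dual" "\<And>h. h \<in> t \<Longrightarrow> \<mu> h = \<nu> h"
  shows "\<mu> = \<nu>"
proof
  fix h
  show "\<mu> h = \<nu> h" using assms dualD(3)[of \<mu> h] dualD(3)[of \<nu> h] by (cases "h \<in> t") auto
qed

lemma root_dual: "\<gamma> \<in> \<Delta> \<Longrightarrow> \<gamma> \<in> t_dual"
  unfolding roots_def by blast

lemma root_nonzero: "\<gamma> \<in> \<Delta> \<Longrightarrow> \<exists>h\<in>t. \<gamma> h \<noteq> 0"
  using dual_ext[OF root_dual[of \<gamma>] dual_zero] unfolding roots_def by fastforce

lemma rootI: "\<gamma> \<in> t_dual \<Longrightarrow> h \<in> t \<Longrightarrow> \<gamma> h \<noteq> 0 \<Longrightarrow> x \<in> rs \<gamma> \<Longrightarrow> x \<noteq> 0 \<Longrightarrow> \<gamma> \<in> \<Delta>"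
  unfolding roots_def by auto

lemma root_space_decomposition: "span (t \<union> (\<Union>\<gamma>\<in>\<Delta>. rs \<gamma>)) = UNIV"
proof -
  have "gw \<nu> \<subseteq> span (t \<union> (\<Union>\<gamma>\<in>\<Delta>. rs \<gamma>))" if nu: "\<forall>x. x \<notin> t \<longrightarrow> \<nu> x = 0" for \<nu>
  proof (cases "gw \<nu> = {0}")
    case True
    then show ?thesis by (auto simp: span_zero)
  next
    case False
    then have d: "\<nu> \<in> t_dual" using weight_dual nu by blast
    show ?thesis
    proof (cases "\<nu> = 0")
      case True
      then have "gw \<nu> = t" by (intro gw_zero') auto
      then show ?thesis by (auto intro: span_base)
    next
      case ne: False
      then have "\<nu> \<in> \<Delta>" using d False unfolding roots_def gw_root_space by auto
      then show ?thesis unfolding gw_root_space by (auto intro: span_base)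
    qed
  qed
  then have "span (\<Union>\<nu>\<in>{\<nu>. \<forall>x. x \<notin> t \<longrightarrow> \<nu> x = 0}. gw \<nu>) \<subseteq> span (t \<union> (\<Union>\<gamma>\<in>\<Delta>. rs \<gamma>))"
    by (intro span_minimal subspace_span) auto
  then show ?thesis using gw_span by auto
qed

lemma killing_rs:
  assumes "x \<in> rs \<mu>" "y \<in> rs \<nu>" "h \<in> t" "\<mu> h + \<nu> h \<noteq> 0"
  shows "killing x y = 0"
  using killing_gw assms unfolding gw_root_space by blast

lemma rs_independent:
  assumes F: "finite F" "F \<subseteq> t_dual" and y: "\<And>\<gamma>. \<gamma> \<in> F \<Longrightarrow> y \<gamma> \<in> rs \<gamma>" and s: "(\<Sum>\<gamma>\<in>F. y \<gamma>) = 0"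
    and \<gamma>: "\<gamma> \<in> F"
  shows "y \<gamma> = 0"
proof -
  have "\<forall>\<gamma>\<in>F. y \<gamma> = 0"
  proof (rule gen_weight_independent[OF F(1) lin_br gw_stable _ _ s])
    show "\<exists>h\<in>t. \<kappa> h \<noteq> \<mu> h" if "\<kappa> \<in> F" "\<mu> \<in> F" "\<kappa> \<noteq> \<mu>" for \<kappa> \<mu>
      using that dual_ext[of \<kappa> \<mu>] F(2) by blast
  qed (use y in \<open>auto simp: gw_root_space\<close>)
  then show ?thesis using \<gamma> by blast
qed

text \<open>Root vectors for different roots are linearly independent.\<close>

lemma finite_roots: "finite \<Delta>"
proof (rule ccontr)
  assume "infinite \<Delta>"
  then obtain F where F: "F \<subseteq> \<Delta>" "finite F" "card F = Suc (dim UNIV)"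
    by (meson infinite_arbitrarily_large)
  have FT: "F \<subseteq> t_dual" using F(1) root_dual by blast
  have "\<exists>x. x \<in> rs \<gamma> \<and> x \<noteq> 0" if "\<gamma> \<in> F" for \<gamma>
    using that F(1) subspace_0[OF subspace_rs] unfolding roots_def by blast
  then obtain e where e: "\<And>\<gamma>. \<gamma> \<in> F \<Longrightarrow> e \<gamma> \<in> rs \<gamma> \<and> e \<gamma> \<noteq> 0" by metis
  have inj: "inj_on e F"
  proof (rule inj_onI)
    fix \<gamma> \<delta> assume gd: "\<gamma> \<in> F" "\<delta> \<in> F" "e \<gamma> = e \<delta>"
    have "\<gamma> h = \<delta> h" if "h \<in> t" for h
      using rsD[of "e \<gamma>" \<gamma> h] rsD[of "e \<delta>" \<delta> h] e[OF gd(1)] e[OF gd(2)] gd(3) that by auto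
    then show "\<gamma> = \<delta>" using dual_ext gd FT by blast
  qed
  have "independent (e ` F)"
  proof (rule independent_if_scalars_zero)
    show "finite (e ` F)" using F(2) by simp
    fix f x assume s: "(\<Sum>x\<in>e ` F. f x *s x) = 0" and "x \<in> e ` F"
    then obtain \<gamma> where g: "\<gamma> \<in> F" "x = e \<gamma>" by blast
    have "(\<Sum>\<gamma>\<in>F. f (e \<gamma>) *s e \<gamma>) = 0" using s by (simp add: sum.reindex[OF inj])
    then have "f (e \<gamma>) *s e \<gamma> = 0"
      using rs_independent[OF F(2) FT, of "\<lambda>\<gamma>. f (e \<gamma>) *s e \<gamma>" \<gamma>] g(1) e subspace_scale[OF subspace_rs] by blast
    then show "f x = 0" using e g by auto
  qed
  then have "card (e ` F) \<le> dim UNIV" by (intro independent_card_le_dim) auto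
  then show False using F(3) card_image[OF inj] by simp
qed

text \<open>Extend the functional to the whole algebra, represent the extension by the Killing
  form, and keep the component in \<open>t\<close>; the root components are orthogonal to
  \<open>t\<close>.\<close>

lemma exists_dual_vec:
  assumes f: "f \<in> t_dual"
  shows "\<exists>!x. x \<in> t \<and> (\<forall>h\<in>t. killing x h = f h)"
proof -
  obtain A where A: "A \<subseteq> t" "independent A" "t \<subseteq> span A" by (rule maximal_independent_subset)
  have sp: "span A = t" using A subspace_t by (simp add: span_subspace)
  interpret vp: vector_space_pair scale "(*) :: 'a \<Rightarrow> 'a \<Rightarrow> 'a"
    by (intro vector_space_pair.intro vector_space_axioms vector_space_field)
  obtain g where g: "Vector_Spaces.linear scale (*) g" "\<And>x. x \<in> A \<Longrightarrow> g x = f x"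
    using vp.linear_independent_extend[OF A(2), of f] by blast
  have f0: "f 0 = 0" using dualD(2)[OF f subspace_0[OF subspace_t], of 0] by simp
  have gf: "g x = f x" if "x \<in> t" for x
  proof -
    have "x \<in> span A" using that sp by simp
    then have "x \<in> t \<and> g x = f x"
    proof (induction rule: span_induct_alt)
      case base
      then show ?case using subspace_0[OF subspace_t] lin_zero[OF g(1)] f0 by simp
    next
      case (step c x y)
      have x: "x \<in> t" using step A(1) by blast
      have cx: "c *s x \<in> t" using x by (rule subspace_scale[OF subspace_t])
      show ?case using step x cx subspace_add[OF subspace_t cx] g(2)[of x]
        by (simp add: lin_add[OF g(1)] lin_scale[OF g(1)] dualD[OF f])
    qed
    then show ?thesis by blast
  qed
  obtain x0 where x0: "\<And>y. killing x0 y = g y" using killing_represents[OF g(1)] by metis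
  have "x0 \<in> span (t \<union> (\<Union>\<gamma>\<in>\<Delta>. rs \<gamma>))" by (simp add: root_space_decomposition)
  then obtain a b where ab: "x0 = a + b" "a \<in> span t" "b \<in> span (\<Union>\<gamma>\<in>\<Delta>. rs \<gamma>)"
    unfolding span_Un by blast
  have at: "a \<in> t" using ab(2) subspace_t by (simp add: span_eq_iff[THEN iffD2])
  have bh: "killing b h = 0" if h: "h \<in> t" for h
    using ab(3)
  proof (induction rule: span_induct_alt)
    case (step c x y)
    then obtain \<gamma> where "\<gamma> \<in> \<Delta>" "x \<in> rs \<gamma>" by blast
    moreover obtain h' where "h' \<in> t" "\<gamma> h' \<noteq> 0" using root_nonzero calculation(1) by blast
    ultimately have "killing x h = 0"
      using killing_rs[of x \<gamma> h "\<lambda>_. 0" h'] rs_zero[of "\<lambda>_. 0"] h by auto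
    then show ?case using step by (simp add: killing_add killing_scale)
  qed simp
  have "killing a h = f h" if "h \<in> t" for h
    using x0[of h] bh[OF that] gf[OF that] ab(1) by (simp add: killing_add)
  then show ?thesis
  proof (intro ex1I[of _ a] conjI ballI at)
    fix x assume x: "x \<in> t \<and> (\<forall>h\<in>t. killing x h = f h)"
    assume a: "\<And>h. h \<in> t \<Longrightarrow> killing a h = f h"
    have "x - a = 0"
      by (rule t_nondeg) (use x a at in \<open>auto simp: killing_diff subspace_diff[OF subspace_t]\<close>)
    then show "x = a" by simp
  qed auto
qed

text \<open>The identification of the dual of \<open>t\<close> with \<open>t\<close> by the
  Killing form. The bilinear form on functionals is \<open>(\<mu>, \<nu>) = \<mu> (dual_vec
  \<nu>)\<close>.\<close>

definition dual_vec :: "('b \<Rightarrow> 'a) \<Rightarrow> 'b"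
  where "dual_vec f = (THE x. x \<in> t \<and> (\<forall>h\<in>t. killing x h = f h))"

lemma dual_vec: "f \<in> t_dual \<Longrightarrow> dual_vec f \<in> t" and killing_dual_vec: "f \<in> t_dual \<Longrightarrow> h \<in> t \<Longrightarrow> killing (dual_vec f) h = f h"
  using theI'[OF exists_dual_vec, of f] unfolding dual_vec_def by blast+

lemma dual_vec_eqI: "f \<in> t_dual \<Longrightarrow> x \<in> t \<Longrightarrow> (\<And>h. h \<in> t \<Longrightarrow> killing x h = f h) \<Longrightarrow> dual_vec f = x"
  using exists_dual_vec[of f] dual_vec[of f] killing_dual_vec[of f] by blast

lemma dual_vec_uminus: "f \<in> t_dual \<Longrightarrow> dual_vec (- f) = - dual_vec f"
  by (rule dual_vec_eqI) (auto simp: dual_uminus subspace_neg[OF subspace_t] dual_vec killing_neg killing_dual_vec)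

lemma ip_sym: "\<mu> \<in> t_dual \<Longrightarrow> \<nu> \<in> t_dual \<Longrightarrow> \<mu> (dual_vec \<nu>) = \<nu> (dual_vec \<mu>)"
  using killing_dual_vec[of \<mu> "dual_vec \<nu>"] killing_dual_vec[of \<nu> "dual_vec \<mu>"] dual_vec killing_sym by metis

lemma br_opposite:
  assumes g: "\<gamma> \<in> t_dual" and x: "x \<in> rs \<gamma>" and y: "y \<in> rs (- \<gamma>)"
  shows "br x y = killing x y *s dual_vec \<gamma>"
proof -
  have "br x y \<in> rs (\<lambda>h. \<gamma> h + (- \<gamma>) h)" using x y by (rule rs_br)
  then have xt: "br x y \<in> t" using rs_zero[of "\<lambda>h. \<gamma> h + (- \<gamma>) h"] by simp
  have "br x y - killing x y *s dual_vec \<gamma> = 0"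
  proof (rule t_nondeg)
    show "br x y - killing x y *s dual_vec \<gamma> \<in> t"
      using xt dual_vec[OF g] subspace_t by (simp add: subspace_diff subspace_scale)
    fix h assume h: "h \<in> t"
    have "br y h = \<gamma> h *s y" using br_skew[of y h] rsD[OF y h] by simp
    then show "killing (br x y - killing x y *s dual_vec \<gamma>) h = 0"
      using killing_dual_vec[OF g h] by (simp add: killing_diff killing_scale killing_inv)
  qed
  then show ?thesis by simp
qed

lemma root_partner:
  assumes g: "\<gamma> \<in> \<Delta>" and x: "x \<in> rs \<gamma>" "x \<noteq> 0"
  obtains y where "y \<in> rs (- \<gamma>)" "killing x y = 1"
proof -
  have "\<exists>y\<in>rs (- \<gamma>). killing x y \<noteq> 0"
  proof (rule ccontr)
    assume neg: "\<not> (\<exists>y\<in>rs (- \<gamma>). killing x y \<noteq> 0)"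
    have zero: "Vector_Spaces.linear scale (*) (\<lambda>_. 0 :: 'a)"
      by (simp add: Vector_Spaces.linear_iff vector_space_axioms vector_space_field)
    obtain h0 where h0: "h0 \<in> t" "\<gamma> h0 \<noteq> 0" using root_nonzero[OF g] by blast
    have "killing x y = 0" for y
    proof (rule lin_eq_on_span[OF lin_killing zero, where A = "t \<union> (\<Union>\<gamma>\<in>\<Delta>. rs \<gamma>)"])
      show "y \<in> span (t \<union> (\<Union>\<gamma>\<in>\<Delta>. rs \<gamma>))" by (simp add: root_space_decomposition)
      fix a assume "a \<in> t \<union> (\<Union>\<gamma>\<in>\<Delta>. rs \<gamma>)"
      then consider "a \<in> t" | \<delta> where "\<delta> \<in> \<Delta>" "a \<in> rs \<delta>" by blast
      then show "killing x a = 0"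
      proof cases
        case 1
        then show ?thesis using killing_rs[OF x(1), of a "\<lambda>_. 0" h0] h0 rs_zero[of "\<lambda>_. 0"] by simp
      next
        case 2
        show ?thesis
        proof (cases "\<delta> = - \<gamma>")
          case True
          then show ?thesis using neg 2 by blast
        next
          case False
          then obtain h where "h \<in> t" "\<delta> h \<noteq> (- \<gamma>) h"
            using dual_ext[OF root_dual[OF 2(1)] dual_uminus[OF root_dual[OF g]]] by blast
          then have "\<gamma> h + \<delta> h \<noteq> 0" by (simp add: add_eq_0_iff)
          then show ?thesis using killing_rs[OF x(1) 2(2) \<open>h \<in> t\<close>] by blast
        qed
      qed
    qed
    then show False using nondeg x(2) by blast
  qed
  then obtain y where y: "y \<in> rs (- \<gamma>)" "killing x y \<noteq> 0" by blast
  have "inverse (killing x y) *s y \<in> rs (- \<gamma>)" by (rule subspace_scale[OF subspace_rs y(1)])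
  moreover have "killing x (inverse (killing x y) *s y) = 1" using y(2) by (simp add: killing_scale)
  ultimately show ?thesis by (rule that)
qed

text \<open>Normalised by \<open>\<Phi>(x, y) = 1\<close>, so that \<open>[x, y]\<close> is
  \<open>dual_vec \<beta>\<close> rather than the coroot: the Casimir element pairs root vectors
  in this way. The notion is symmetric under exchange of \<open>x\<close> and \<open>y\<close>
  and of \<open>\<beta>\<close> and \<open>- \<beta>\<close>, which turns every statement on
  lowering into one on raising.\<close>

definition sl2_pair :: "'b \<Rightarrow> 'b \<Rightarrow> ('b \<Rightarrow> 'a) \<Rightarrow> bool"
  where "sl2_pair x y \<beta> \<longleftrightarrow> \<beta> \<in> \<Delta> \<and> x \<in> rs \<beta> \<and> y \<in> rs (- \<beta>) \<and> killing x y = 1"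

lemma sl2_pairD:
  assumes "sl2_pair x y \<beta>"
  shows "\<beta> \<in> \<Delta>" "\<beta> \<in> t_dual" "x \<in> rs \<beta>" "y \<in> rs (- \<beta>)" "killing x y = 1" "br x y = dual_vec \<beta>"
  using assms br_opposite[of \<beta> x y] root_dual unfolding sl2_pair_def by auto

lemma sl2_pair_swap:
  assumes "sl2_pair x y \<beta>"
  shows "sl2_pair y x (- \<beta>)"
proof -
  note D = sl2_pairD[OF assms]
  obtain h where "h \<in> t" "\<beta> h \<noteq> 0" using root_nonzero D(1) by blast
  moreover have "y \<noteq> 0" using D(5) by auto
  ultimately have "- \<beta> \<in> \<Delta>" by (intro rootI[OF dual_uminus[OF D(2)] _ _ D(4)]) auto
  moreover have "killing y x = 1" using D(5) killing_sym by simp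
  ultimately show ?thesis using D(3,4) unfolding sl2_pair_def by simp
qed

definition ef :: "('b \<Rightarrow> 'a) \<Rightarrow> 'b \<times> 'b"
  where "ef \<beta> = (SOME p. sl2_pair (fst p) (snd p) \<beta>)"
definition "e \<beta> = fst (ef \<beta>)"
definition "f \<beta> = snd (ef \<beta>)"

lemma ef: assumes "\<beta> \<in> \<Delta>" shows "sl2_pair (e \<beta>) (f \<beta>) \<beta>"
proof -
  obtain x where x: "x \<in> rs \<beta>" "x \<noteq> 0"
    using assms subspace_0[OF subspace_rs] unfolding roots_def by blast
  obtain y where "y \<in> rs (- \<beta>)" "killing x y = 1" using root_partner[OF assms x] .
  then have "\<exists>p. sl2_pair (fst p) (snd p) \<beta>" using x assms unfolding sl2_pair_def by auto
  then show ?thesis unfolding ef_def e_def f_def by (rule someI_ex)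
qed

lemma root_uminus: "\<beta> \<in> \<Delta> \<Longrightarrow> - \<beta> \<in> \<Delta>"
  using sl2_pairD(1)[OF sl2_pair_swap[OF ef]] .

lemma e_nonzero: "\<beta> \<in> \<Delta> \<Longrightarrow> e \<beta> \<noteq> 0"
  using sl2_pairD(5)[OF ef] by fastforce

section \<open>Strings of weights\<close>

lemma lowering_weight:
  assumes y: "y \<in> rs (- \<beta>)" and u: "u \<in> rs \<mu>"
  shows "(br y ^^ m) u \<in> rs (\<lambda>h. \<mu> h - of_nat m * \<beta> h)"
proof (induction m)
  case (Suc m)
  have "br y ((br y ^^ m) u) \<in> rs (\<lambda>h. (- \<beta>) h + (\<mu> h - of_nat m * \<beta> h))" using y Suc by (rule rs_br)
  moreover have "(\<lambda>h. (- \<beta>) h + (\<mu> h - of_nat m * \<beta> h)) = (\<lambda>h. \<mu> h - of_nat (Suc m) * \<beta> h)"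
    by (auto simp: algebra_simps)
  ultimately show ?case by simp
qed (simp add: u)

text \<open>The usual formula for commuting \<open>E\<close> past a power of \<open>F\<close>,
  in the above normalisation.\<close>

lemma sl2_commutator:
  assumes p: "sl2_pair x y \<beta>" and u: "u \<in> rs \<mu>"
  shows "br x ((br y ^^ Suc m) u) = (br y ^^ Suc m) (br x u)
    + (of_nat (Suc m) * (\<mu> (dual_vec \<beta>) - of_nat m * \<beta> (dual_vec \<beta>) / 2)) *s (br y ^^ m) u"
proof (induction m)
  case 0
  show ?case using sl2_pairD(6)[OF p] rsD[OF u dual_vec[OF sl2_pairD(2)[OF p]]]
    by (simp add: br_deriv[of x y u])
next
  case (Suc m)
  let ?w = "(br y ^^ Suc m) u" and ?c = "of_nat (Suc m) * (\<mu> (dual_vec \<beta>) - of_nat m * \<beta> (dual_vec \<beta>) / 2)"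
  let ?d = "\<mu> (dual_vec \<beta>) - of_nat (Suc m) * \<beta> (dual_vec \<beta>)"
  have w: "br (dual_vec \<beta>) ?w = ?d *s ?w"
    using rsD[OF lowering_weight[OF sl2_pairD(4)[OF p] u] dual_vec[OF sl2_pairD(2)[OF p]]] .
  have "br x ((br y ^^ Suc (Suc m)) u) = br (br x y) ?w + br y (br x ?w)"
    by (simp add: br_deriv[of x y])
  also have "\<dots> = ?d *s ?w + ((br y ^^ Suc (Suc m)) (br x u) + ?c *s ?w)"
    unfolding Suc sl2_pairD(6)[OF p] w by (simp add: br_add_right br_scale_right)
  also have "\<dots> = (br y ^^ Suc (Suc m)) (br x u) + (?d + ?c) *s ?w"
    by (simp only: scale_left_distrib ac_simps)
  also have "?d + ?c = of_nat (Suc (Suc m)) * (\<mu> (dual_vec \<beta>) - of_nat (Suc m) * \<beta> (dual_vec \<beta>) / 2)"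
    by (simp add: field_simps)
  finally show ?case .
qed

text \<open>The weights \<open>\<mu> - m \<beta>\<close> are pairwise different, and only
  finitely many of them occur.\<close>

lemma lowering_nilpotent:
  assumes p: "sl2_pair x y \<beta>" and u: "u \<in> rs \<mu>" and mu: "\<mu> \<in> t_dual"
  shows "\<exists>m. (br y ^^ m) u = 0"
proof (rule ccontr)
  assume "\<not> (\<exists>m. (br y ^^ m) u = 0)"
  then have nz: "(br y ^^ m) u \<noteq> 0" for m by blast
  let ?w = "\<lambda>m h. \<mu> h - of_nat m * \<beta> h"
  obtain h where h: "h \<in> t" "\<beta> h \<noteq> 0" using root_nonzero[OF sl2_pairD(1)[OF p]] by blast
  have "inj ?w"
  proof (rule injI)
    fix m n assume "?w m = ?w n"
    then have "\<mu> h - of_nat m * \<beta> h = \<mu> h - of_nat n * \<beta> h" by (rule fun_cong)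
    then show "m = n" using h(2) by simp
  qed
  moreover have "?w m \<in> insert 0 \<Delta>" for m
  proof -
    have d: "?w m \<in> t_dual" using dual_lincomb[OF mu sl2_pairD(2)[OF p], of 1 "- of_nat m"] by simp
    have "(br y ^^ m) u \<in> rs (?w m)" by (rule lowering_weight[OF sl2_pairD(4)[OF p] u])
    then show ?thesis using nz[of m] d unfolding roots_def by auto
  qed
  ultimately have "infinite (insert 0 \<Delta>)"
    by (meson finite_subset image_subsetI infinite_UNIV_nat finite_imageD)
  then show False using finite_roots by simp
qed

lemma lowering_length:
  assumes p: "sl2_pair x y \<beta>" and u: "u \<in> rs \<mu>" "u \<noteq> 0" and mu: "\<mu> \<in> t_dual"
  obtains m where "\<And>j. j \<le> m \<Longrightarrow> (br y ^^ j) u \<noteq> 0" "(br y ^^ Suc m) u = 0"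
proof -
  define n where "n = (LEAST m. (br y ^^ m) u = 0)"
  have n: "(br y ^^ n) u = 0" unfolding n_def by (rule LeastI_ex[OF lowering_nilpotent[OF p u(1) mu]])
  have l: "(br y ^^ j) u \<noteq> 0" if "j < n" for j using not_less_Least that unfolding n_def by blast
  obtain m where "n = Suc m" using n u(2) by (cases n) auto
  then show ?thesis using n l that[of m] by (simp add: less_Suc_eq_le del: funpow.simps(2))
qed

text \<open>Commute \<open>x\<close> past the first power of \<open>y\<close> that kills
  \<open>u\<close>. This holds also for \<open>(\<beta>, \<beta>) = 0\<close>, which is excluded
  only afterwards.\<close>

lemma highest_weight_integral:
  assumes p: "sl2_pair x y \<beta>" and u: "u \<in> rs \<mu>" "u \<noteq> 0" and mu: "\<mu> \<in> t_dual" and hw: "br x u = 0"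
  obtains m where "2 * \<mu> (dual_vec \<beta>) = of_nat m * \<beta> (dual_vec \<beta>)" "\<And>j. j \<le> m \<Longrightarrow> (br y ^^ j) u \<noteq> 0"
proof -
  obtain m where m: "\<And>j. j \<le> m \<Longrightarrow> (br y ^^ j) u \<noteq> 0" "(br y ^^ Suc m) u = 0"
    using lowering_length[OF p u mu] by blast
  have "(br y ^^ Suc m) (br x u) = 0" using hw lin_zero[OF lin_funpow[OF lin_br]] by simp
  then have "(of_nat (Suc m) * (\<mu> (dual_vec \<beta>) - of_nat m * \<beta> (dual_vec \<beta>) / 2)) *s (br y ^^ m) u = 0"
    using sl2_commutator[OF p u(1), of m] m(2) by simp
  then have "\<mu> (dual_vec \<beta>) - of_nat m * \<beta> (dual_vec \<beta>) / 2 = 0" using m(1)[of m] by (simp del: of_nat_Suc)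
  then have "2 * \<mu> (dual_vec \<beta>) = of_nat m * \<beta> (dual_vec \<beta>)" by (simp add: field_simps)
  then show ?thesis using m(1) by (rule that)
qed

text \<open>Raise \<open>u\<close> to the top of its string.\<close>

lemma weight_integral:
  assumes p: "sl2_pair x y \<beta>" and u: "u \<in> rs \<mu>" "u \<noteq> 0" and mu: "\<mu> \<in> t_dual"
  obtains c :: int where "2 * \<mu> (dual_vec \<beta>) = of_int c * \<beta> (dual_vec \<beta>)"
proof -
  have b: "\<beta> \<in> t_dual" by (rule sl2_pairD(2)[OF p])
  obtain r where r: "(br x ^^ r) u \<noteq> 0" "(br x ^^ Suc r) u = 0"
    using lowering_length[OF sl2_pair_swap[OF p] u mu] by (metis order_refl)
  let ?\<nu> = "\<lambda>h. \<mu> h - of_nat r * (- \<beta>) h"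
  have "(br x ^^ r) u \<in> rs ?\<nu>"
    using lowering_weight[of x "- \<beta>" u \<mu> r] sl2_pairD(3)[OF p] u(1) by simp
  moreover have "?\<nu> \<in> t_dual" using dual_lincomb[OF mu b, of 1 "of_nat r"] by simp
  moreover have "br x ((br x ^^ r) u) = 0" using r(2) by simp
  ultimately obtain m where "2 * ?\<nu> (dual_vec \<beta>) = of_nat m * \<beta> (dual_vec \<beta>)"
    using highest_weight_integral[OF p _ r(1)] by blast
  then have "2 * \<mu> (dual_vec \<beta>) = of_int (int m - 2 * int r) * \<beta> (dual_vec \<beta>)" by (simp add: algebra_simps)
  then show ?thesis by (rule that)
qed

text \<open>If \<open>(\<beta>, \<beta>) = 0\<close>, then by integrality \<open>dual_vec
  \<beta>\<close> pairs to zero with all roots, so it is central.\<close>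

lemma root_nonisotropic:
  assumes b: "\<beta> \<in> \<Delta>"
  shows "\<beta> (dual_vec \<beta>) \<noteq> 0"
proof
  assume z: "\<beta> (dual_vec \<beta>) = 0"
  have tb: "dual_vec \<beta> \<in> t" using dual_vec root_dual b by blast
  have ann: "br (dual_vec \<beta>) x = 0" for x
  proof -
    have lz: "Vector_Spaces.linear scale scale (\<lambda>_. 0)" by (simp add: Vector_Spaces.linear_iff vector_space_axioms)
    show ?thesis
    proof (rule lin_eq_on_span[OF lin_br lz, where A = "t \<union> (\<Union>\<gamma>\<in>\<Delta>. rs \<gamma>)"])
      show "x \<in> span (t \<union> (\<Union>\<gamma>\<in>\<Delta>. rs \<gamma>))" by (simp add: root_space_decomposition)
      fix a assume "a \<in> t \<union> (\<Union>\<gamma>\<in>\<Delta>. rs \<gamma>)"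
      then consider "a \<in> t" | \<delta> where "\<delta> \<in> \<Delta>" "a \<in> rs \<delta>" by blast
      then show "br (dual_vec \<beta>) a = 0"
      proof cases
        case 1
        then show ?thesis using t_abelian[OF tb] by blast
      next
        case 2
        show ?thesis
        proof (cases "a = 0")
          case False
          obtain c :: int where "2 * \<delta> (dual_vec \<beta>) = of_int c * \<beta> (dual_vec \<beta>)"
            using weight_integral[OF ef[OF b] 2(2) False root_dual[OF 2(1)]] .
          then show ?thesis using z rsD[OF 2(2) tb] by simp
        qed simp
      qed
    qed
  qed
  have "dual_vec \<beta> = 0"
  proof (rule nondeg)
    show "killing (dual_vec \<beta>) y = 0" for y unfolding killing_def trace_def ann
      by (simp add: lin_zero[OF rep_linear])
  qed
  then have "\<beta> h = 0" if "h \<in> t" for h using killing_dual_vec[OF root_dual[OF b] that] by simp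
  then show False using root_nonzero[OF b] by blast
qed

text \<open>An element of the root space of \<open>- \<beta>\<close> orthogonal to
  \<open>x\<close> is killed by \<open>x\<close>, so it would be a highest weight vector of
  weight \<open>- \<beta>\<close>; but highest weights are non-negative multiples of
  \<open>\<beta> / 2\<close> on \<open>dual_vec \<beta>\<close>.\<close>

lemma rs_one_dim:
  assumes p: "sl2_pair x y \<beta>" and v: "v \<in> rs (- \<beta>)"
  shows "v = killing x v *s y"
proof (rule ccontr)
  assume ne: "v \<noteq> killing x v *s y"
  note D = sl2_pairD[OF p]
  let ?v = "v - killing x v *s y"
  have vr: "?v \<in> rs (- \<beta>)" using v D(4) subspace_rs by (simp add: subspace_diff subspace_scale)
  have "killing x ?v = 0" using D(5) by (simp add: killing_diff killing_scale)
  then have "br x ?v = 0" using br_opposite[OF D(2,3) vr] by simp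
  then obtain m where m: "2 * (- \<beta>) (dual_vec \<beta>) = of_nat m * \<beta> (dual_vec \<beta>)"
    using highest_weight_integral[OF p vr _ dual_uminus[OF D(2)]] ne by auto
  have "of_nat (m + 2) * \<beta> (dual_vec \<beta>) = of_nat m * \<beta> (dual_vec \<beta>) + 2 * \<beta> (dual_vec \<beta>)"
    by (simp add: algebra_simps)
  then have "of_nat (m + 2) * \<beta> (dual_vec \<beta>) = 0" unfolding m[symmetric] by simp
  moreover have "(of_nat (m + 2) :: 'a) \<noteq> 0" by (simp only: of_nat_eq_0_iff)
  ultimately show False using root_nonisotropic[OF D(1)] by (metis mult_eq_0_iff)
qed

lemma rs_one_dim': "sl2_pair x y \<beta> \<Longrightarrow> v \<in> rs \<beta> \<Longrightarrow> v = killing y v *s x"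
  using rs_one_dim[OF sl2_pair_swap] by simp

section \<open>Rationality and positivity\<close>

lemma t_dual_frame:
  obtains A hA where "finite A" "A \<subseteq> t" "\<And>a. a \<in> A \<Longrightarrow> hA a \<in> t"
    "\<And>x. x \<in> t \<Longrightarrow> x = (\<Sum>a\<in>A. killing (hA a) x *s a)"
proof -
  obtain A where A: "A \<subseteq> t" "independent A" "t \<subseteq> span A" by (rule maximal_independent_subset)
  have sp: "span A = t" using A subspace_t by (simp add: span_subspace)
  have fin: "finite A" by (rule finiteI_independent[OF A(2)])
  define \<phi> where "\<phi> a x = (if x \<in> t then representation A x a else 0)" for a x
  have d: "\<phi> a \<in> t_dual" for a
    unfolding \<phi>_def
    by (rule dualI) (simp_all add: subspace_add[OF subspace_t] subspace_scale[OF subspace_t]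
        representation_add[OF A(2)] representation_scale[OF A(2)] sp)
  show ?thesis
  proof (rule that[of A "\<lambda>a. dual_vec (\<phi> a)"])
    fix x assume x: "x \<in> t"
    have "x = (\<Sum>a\<in>A. representation A x a *s a)"
      by (rule sum_representation_eq[symmetric]) (use A sp x fin in auto)
    also have "\<dots> = (\<Sum>a\<in>A. killing (dual_vec (\<phi> a)) x *s a)"
      unfolding killing_dual_vec[OF d x] using x by (simp add: \<phi>_def)
    finally show "x = (\<Sum>a\<in>A. killing (dual_vec (\<phi> a)) x *s a)" .
  qed (use fin A(1) dual_vec[OF d] in auto)
qed

lemma rs_orthogonal_t: "\<gamma> \<in> \<Delta> \<Longrightarrow> x \<in> rs \<gamma> \<Longrightarrow> h \<in> t \<Longrightarrow> killing x h = 0"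
  using killing_rs[of x \<gamma> h "\<lambda>_. 0"] root_nonzero[of \<gamma>] rs_zero[of "\<lambda>_. 0"] by auto

lemma rs_orthogonal:
  assumes "\<gamma> \<in> t_dual" "\<delta> \<in> t_dual" "x \<in> rs \<gamma>" "y \<in> rs \<delta>" "\<gamma> + \<delta> \<noteq> 0"
  shows "killing x y = 0"
proof -
  obtain h where "h \<in> t" "(\<gamma> + \<delta>) h \<noteq> 0 h"
    using dual_ext[OF dual_add[OF assms(1,2)] dual_zero] assms(5) by blast
  then show ?thesis using killing_rs[OF assms(3,4)] by simp
qed

text \<open>Stated for a frame of \<open>t\<close> given in advance, since no canonical basis of
  \<open>t\<close> is at hand.\<close>

lemma root_expansion:
  assumes A: "finite A" "A \<subseteq> t" "\<And>a. a \<in> A \<Longrightarrow> hA a \<in> t"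
    "\<And>x. x \<in> t \<Longrightarrow> x = (\<Sum>a\<in>A. killing (hA a) x *s a)"
  shows "x = (\<Sum>a\<in>A. killing (hA a) x *s a) + (\<Sum>\<delta>\<in>\<Delta>. killing (f \<delta>) x *s e \<delta>)"
proof -
  define E where "E x = (\<Sum>a\<in>A. killing (hA a) x *s a) + (\<Sum>\<delta>\<in>\<Delta>. killing (f \<delta>) x *s e \<delta>)" for x
  have E: "Vector_Spaces.linear scale scale E"
    unfolding E_def Vector_Spaces.linear_iff
    by (simp add: killing_add killing_scale scale_left_distrib sum.distrib scale_sum_right
        scale_right_distrib vector_space_axioms algebra_simps)
  have "x = E x"
  proof (rule lin_eq_on_span[OF _ E, where A = "t \<union> (\<Union>\<gamma>\<in>\<Delta>. rs \<gamma>)"])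
    show "Vector_Spaces.linear scale scale (\<lambda>x. x)" by (simp add: Vector_Spaces.linear_iff vector_space_axioms)
    show "x \<in> span (t \<union> (\<Union>\<gamma>\<in>\<Delta>. rs \<gamma>))" by (simp add: root_space_decomposition)
    fix y assume "y \<in> t \<union> (\<Union>\<gamma>\<in>\<Delta>. rs \<gamma>)"
    then consider "y \<in> t" | \<gamma> where "\<gamma> \<in> \<Delta>" "y \<in> rs \<gamma>" by blast
    then show "y = E y"
    proof cases
      case 1
      have "killing (f \<delta>) y = 0" if "\<delta> \<in> \<Delta>" for \<delta>
        using rs_orthogonal_t[OF root_uminus[OF that] sl2_pairD(4)[OF ef[OF that]] 1] .
      then show ?thesis unfolding E_def using A(4)[OF 1] by simp
    next
      case 2
      have "killing (hA a) y = 0" if "a \<in> A" for a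
        using rs_orthogonal_t[OF 2 A(3)[OF that]] killing_sym by simp
      moreover have "killing (f \<delta>) y *s e \<delta> = (if \<delta> = \<gamma> then y else 0)" if d: "\<delta> \<in> \<Delta>" for \<delta>
      proof (cases "\<delta> = \<gamma>")
        case True
        then show ?thesis using rs_one_dim'[OF ef[OF 2(1)] 2(2)] by simp
      next
        case False
        then have "- \<delta> + \<gamma> \<noteq> 0" by (metis add.inverse_inverse add_eq_0_iff)
        then have "killing (f \<delta>) y = 0"
          using rs_orthogonal[OF dual_uminus[OF root_dual[OF d]] root_dual[OF 2(1)] sl2_pairD(4)[OF ef[OF d]] 2(2)]
          by blast
        then show ?thesis using False by simp
      qed
      ultimately show ?thesis unfolding E_def using 2(1) finite_roots by (simp add: sum.delta)
    qed
  qed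
  then show ?thesis unfolding E_def .
qed

text \<open>The trace of \<open>ad h ad h'\<close> in the frame of root vectors.\<close>

lemma killing_t:
  assumes h: "h \<in> t" "h' \<in> t"
  shows "killing h h' = (\<Sum>\<delta>\<in>\<Delta>. \<delta> h * \<delta> h')"
proof -
  obtain A hA where A: "finite A" "A \<subseteq> t" "\<And>a. a \<in> A \<Longrightarrow> hA a \<in> t"
    "\<And>x. x \<in> t \<Longrightarrow> x = (\<Sum>a\<in>A. killing (hA a) x *s a)"
    using t_dual_frame by blast
  note ex = root_expansion[OF A]
  have "trace (\<lambda>x. br h (br h' x)) = (\<Sum>i\<in>A <+> \<Delta>. case_sum (\<lambda>a. killing (hA a)) (\<lambda>\<delta>. killing (f \<delta>)) i
      (br h (br h' (case_sum (\<lambda>a. a) e i))))"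
  proof (rule trace_frame[OF lin_br_br])
    show "finite (A <+> \<Delta>)" using A(1) finite_roots by simp
    show "Vector_Spaces.linear scale (*) (case_sum (\<lambda>a. killing (hA a)) (\<lambda>\<delta>. killing (f \<delta>)) i)" for i
      by (cases i) (simp_all add: lin_killing)
    show "x = (\<Sum>i\<in>A <+> \<Delta>. case_sum (\<lambda>a. killing (hA a)) (\<lambda>\<delta>. killing (f \<delta>)) i x *s case_sum (\<lambda>a. a) e i)" for x
      using ex[of x] A(1) finite_roots by (simp add: sum.Plus)
  qed
  also have "\<dots> = (\<Sum>a\<in>A. killing (hA a) (br h (br h' a))) + (\<Sum>\<delta>\<in>\<Delta>. killing (f \<delta>) (br h (br h' (e \<delta>))))"
    using A(1) finite_roots by (simp add: sum.Plus)
  also have "(\<Sum>a\<in>A. killing (hA a) (br h (br h' a))) = 0"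
    using A(2) t_abelian[OF h(2)] by (intro sum.neutral) (auto simp: subset_iff)
  also have "(\<Sum>\<delta>\<in>\<Delta>. killing (f \<delta>) (br h (br h' (e \<delta>)))) = (\<Sum>\<delta>\<in>\<Delta>. \<delta> h * \<delta> h')"
  proof (rule sum.cong[OF refl])
    fix \<delta> assume d: "\<delta> \<in> \<Delta>"
    note D = sl2_pairD[OF ef[OF d]]
    have "killing (f \<delta>) (e \<delta>) = 1" using D(5) killing_sym by simp
    then show "killing (f \<delta>) (br h (br h' (e \<delta>))) = \<delta> h * \<delta> h'"
      using rsD[OF D(3) h(1)] rsD[OF D(3) h(2)] by (simp add: br_scale_right killing_scale)
  qed
  finally show ?thesis unfolding killing_def by simp
qed

text \<open>Since \<open>(\<beta>, \<beta>) = \<Sum>\<^sub>\<delta> (\<delta>,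
  \<beta>)\<^sup>2\<close> and \<open>2 (\<delta>, \<beta>)\<close> is an integral multiple of
  \<open>(\<beta>, \<beta>)\<close>, the norm is \<open>4 / s\<close> for a sum \<open>s\<close>
  of squares of integers.\<close>

lemma root_norm:
  assumes b: "\<beta> \<in> \<Delta>"
  obtains q where "q > 0" "\<beta> (dual_vec \<beta>) = of_rat q"
proof -
  let ?b = "\<beta> (dual_vec \<beta>)"
  have nz: "?b \<noteq> 0" by (rule root_nonisotropic[OF b])
  have tb: "dual_vec \<beta> \<in> t" using dual_vec root_dual b by blast
  have "\<exists>c::int. 2 * \<delta> (dual_vec \<beta>) = of_int c * ?b" if d: "\<delta> \<in> \<Delta>" for \<delta>
    using weight_integral[OF ef[OF b] sl2_pairD(3)[OF ef[OF d]] e_nonzero[OF d] root_dual[OF d]] by blast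
  then obtain c :: "('b \<Rightarrow> 'a) \<Rightarrow> int" where c: "\<And>\<delta>. \<delta> \<in> \<Delta> \<Longrightarrow> 2 * \<delta> (dual_vec \<beta>) = of_int (c \<delta>) * ?b" by metis
  define s where "s = (\<Sum>\<delta>\<in>\<Delta>. c \<delta> * c \<delta>)"
  have "4 * ?b = (\<Sum>\<delta>\<in>\<Delta>. (2 * \<delta> (dual_vec \<beta>)) * (2 * \<delta> (dual_vec \<beta>)))"
    unfolding killing_dual_vec[OF root_dual[OF b] tb, symmetric] killing_t[OF tb tb]
    by (simp add: sum_distrib_left mult.assoc mult.left_commute)
  also have "\<dots> = (\<Sum>\<delta>\<in>\<Delta>. of_int (c \<delta> * c \<delta>) * (?b * ?b))"
    by (intro sum.cong refl) (simp add: c)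
  also have "\<dots> = of_int s * ?b * ?b" unfolding s_def by (simp add: sum_distrib_right mult.assoc)
  finally have eq: "of_int s * ?b = 4" using nz by simp
  have "s \<ge> 0" unfolding s_def by (intro sum_nonneg) simp
  moreover have "s \<noteq> 0" using eq by auto
  ultimately have "s > 0" by simp
  then have "?b = of_rat (4 / of_int s)" using eq by (simp add: of_rat_divide field_simps)
  moreover have "4 / of_int s > (0::rat)" using \<open>s > 0\<close> by simp
  ultimately show ?thesis using that by blast
qed

lemma root_ip_rational:
  assumes b: "\<beta> \<in> \<Delta>" and g: "\<gamma> \<in> \<Delta>"
  obtains q where "\<gamma> (dual_vec \<beta>) = of_rat q"
proof -
  obtain c :: int where c: "2 * \<gamma> (dual_vec \<beta>) = of_int c * \<beta> (dual_vec \<beta>)"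
    using weight_integral[OF ef[OF b] sl2_pairD(3)[OF ef[OF g]] e_nonzero[OF g] root_dual[OF g]] .
  obtain q where "\<beta> (dual_vec \<beta>) = of_rat q" using root_norm[OF b] .
  then have "\<gamma> (dual_vec \<beta>) = of_rat (of_int c * q / 2)" using c by (simp add: of_rat_divide of_rat_mult field_simps)
  then show ?thesis by (rule that)
qed

text \<open>A vector of negative weight \<open>c\<close> can be raised at least \<open>-
  c\<close> times. Lower \<open>e \<gamma>\<close> to the bottom \<open>w\<close> of its string,
  which has weight \<open>c - 2 q\<close> and survives \<open>2 q - c\<close> raisings; on the
  way up, one-dimensionality of the root space brings \<open>w\<close> back to a multiple of
  \<open>e \<gamma>\<close>.\<close>

lemma raising_nonzero:
  assumes p: "sl2_pair x y \<beta>" and g: "\<gamma> \<in> \<Delta>" and c: "2 * \<gamma> (dual_vec \<beta>) = of_int c * \<beta> (dual_vec \<beta>)" "c < 0"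
  shows "(br x ^^ nat (- c)) (e \<gamma>) \<noteq> 0"
proof -
  note D = sl2_pairD[OF p] and G = sl2_pairD[OF ef[OF g]]
  note nx = lin_funpow[OF lin_br, of _ x]
  obtain q where q: "(br y ^^ q) (e \<gamma>) \<noteq> 0" "(br y ^^ Suc q) (e \<gamma>) = 0"
    using lowering_length[OF p G(3) e_nonzero[OF g] G(2)] by (metis order_refl)
  let ?w = "(br y ^^ q) (e \<gamma>)" and ?\<nu> = "\<lambda>h. \<gamma> h - of_nat q * \<beta> h"
  have w: "?w \<in> rs ?\<nu>" by (rule lowering_weight[OF D(4) G(3)])
  have "?\<nu> \<in> t_dual" using dual_lincomb[OF G(2) D(2), of 1 "- of_nat q"] by simp
  then obtain M where M: "2 * ?\<nu> (dual_vec (- \<beta>)) = of_nat M * (- \<beta>) (dual_vec (- \<beta>))"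
    "\<And>j. j \<le> M \<Longrightarrow> (br x ^^ j) ?w \<noteq> 0"
    using highest_weight_integral[OF sl2_pair_swap[OF p] w q(1)] q(2) by auto
  have "of_int (2 * int q - c) * \<beta> (dual_vec \<beta>) = of_int (int M) * \<beta> (dual_vec \<beta>)"
  proof -
    have n: "\<nu> (- z) = - \<nu> z" if "\<nu> \<in> t_dual" "z \<in> t" for \<nu> z
      using dualD(2)[OF that, of "-1"] by simp
    have "2 * (of_nat q * \<beta> (dual_vec \<beta>)) - 2 * \<gamma> (dual_vec \<beta>) = of_nat M * \<beta> (dual_vec \<beta>)"
      using M(1) by (simp add: dual_vec_uminus[OF D(2)] n[OF D(2) dual_vec[OF D(2)]] n[OF G(2) dual_vec[OF D(2)]] algebra_simps)
    then show ?thesis using c(1) by (simp add: algebra_simps)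
  qed
  then have "(of_int (2 * int q - c) :: 'a) = of_int (int M)"
    using root_nonisotropic[OF D(1)] mult_right_cancel by blast
  then have "2 * int q - c = int M" by (rule of_int_eq_iff[THEN iffD1])
  then have M': "M = (q + nat (- c)) + q" using c(2) by linarith
  have "(br x ^^ q) ?w \<in> rs (\<lambda>h. ?\<nu> h - of_nat q * (- \<beta>) h)"
    using lowering_weight[of x "- \<beta>" ?w ?\<nu> q] w D(3) by simp
  then have "(br x ^^ q) ?w \<in> rs \<gamma>" by (simp add: algebra_simps)
  then obtain s where s: "(br x ^^ q) ?w = s *s e \<gamma>" using rs_one_dim'[OF ef[OF g]] by blast
  have "(br x ^^ M) ?w = (br x ^^ (q + nat (- c))) ((br x ^^ q) ?w)"
    unfolding M' by (simp only: funpow_add o_apply)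
  also have "\<dots> = s *s (br x ^^ q) ((br x ^^ nat (- c)) (e \<gamma>))"
    unfolding s lin_scale[OF nx] by (simp only: funpow_add o_apply)
  finally show ?thesis using M(2)[of M] lin_zero[OF nx] by auto
qed

text \<open>The scalar is \<open>(\<beta>, \<beta>) / 2 \<cdot> r (c + r + 1)\<close>, where
  \<open>r\<close> is the number of times that \<open>e \<gamma>\<close> can be raised and
  \<open>c\<close> is the value of \<open>\<gamma>\<close> on the coroot of
  \<open>\<beta>\<close>. It comes from commuting \<open>y\<close> past \<open>x\<^sup>r\<close>
  applied to \<open>[x, e \<gamma>]\<close>, which is zero. If \<open>r > 0\<close>, the last
  factor is positive: for negative \<open>c\<close> one has \<open>r \<ge> - c\<close>.\<close>

lemma lowering_raising_scalar:
  assumes p: "sl2_pair x y \<beta>" and g: "\<gamma> \<in> \<Delta>"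
  obtains q where "br y (br x (e \<gamma>)) = of_rat q *s e \<gamma>" "q \<ge> 0" "q = 0 \<longleftrightarrow> br x (e \<gamma>) = 0"
proof -
  note D = sl2_pairD[OF p] and G = sl2_pairD[OF ef[OF g]]
  obtain b where b: "b > 0" "\<beta> (dual_vec \<beta>) = of_rat b" using root_norm[OF D(1)] .
  obtain c :: int where c: "2 * \<gamma> (dual_vec \<beta>) = of_int c * \<beta> (dual_vec \<beta>)"
    using weight_integral[OF p G(3) e_nonzero[OF g] G(2)] .
  obtain r where r: "(br x ^^ r) (e \<gamma>) \<noteq> 0" "(br x ^^ Suc r) (e \<gamma>) = 0" "\<And>j. j \<le> r \<Longrightarrow> (br x ^^ j) (e \<gamma>) \<noteq> 0"
    using lowering_length[OF sl2_pair_swap[OF p] G(3) e_nonzero[OF g] G(2)] by (metis order_refl)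
  show ?thesis
  proof (cases r)
    case 0
    then have "br x (e \<gamma>) = 0" using r(2) by simp
    then show ?thesis by (intro that[of 0]) simp_all
  next
    case (Suc m)
    let ?n = "b / 2 * of_nat r * of_int (c + int r + 1)"
    have nz: "br x (e \<gamma>) \<noteq> 0" using r(3)[of 1] Suc by simp
    have "br y (br x (e \<gamma>)) \<in> rs (\<lambda>h. (- \<beta>) h + (\<beta> h + \<gamma> h))"
      by (rule rs_br[OF D(4) rs_br[OF D(3) G(3)]])
    then have "br y (br x (e \<gamma>)) \<in> rs \<gamma>" by simp
    then obtain n where n: "br y (br x (e \<gamma>)) = n *s e \<gamma>" using rs_one_dim'[OF ef[OF g]] by blast
    let ?\<mu> = "\<lambda>h. \<beta> h + \<gamma> h"
    let ?w = "br x (e \<gamma>)"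
    have w: "?w \<in> rs ?\<mu>" by (rule rs_br[OF D(3) G(3)])
    have ng: "\<nu> (- z) = - \<nu> z" if "\<nu> \<in> t_dual" "z \<in> t" for \<nu> z
      using dualD(2)[OF that, of "-1"] by simp
    have e1: "(br x ^^ Suc m) ?w = 0" using r(2) Suc by (simp add: funpow_Suc_right del: funpow.simps(2))
    have e2: "(br x ^^ m) ?w = (br x ^^ r) (e \<gamma>)" using Suc by (simp add: funpow_Suc_right del: funpow.simps(2))
    have e3: "(br x ^^ Suc m) (e \<gamma>) = (br x ^^ r) (e \<gamma>)" using Suc by simp
    have "br y ((br x ^^ Suc m) ?w) = (br x ^^ Suc m) (br y ?w)
      + (of_nat (Suc m) * (?\<mu> (dual_vec (- \<beta>)) - of_nat m * (- \<beta>) (dual_vec (- \<beta>)) / 2)) *s (br x ^^ m) ?w"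
      by (rule sl2_commutator[OF sl2_pair_swap[OF p] w])
    then have "0 = (n + of_nat (Suc m) * (?\<mu> (dual_vec (- \<beta>)) - of_nat m * (- \<beta>) (dual_vec (- \<beta>)) / 2)) *s (br x ^^ r) (e \<gamma>)"
      unfolding e1 e2 n lin_scale[OF lin_funpow[OF lin_br]] e3 by (simp add: scale_left_distrib del: of_nat_Suc)
    then have "n + of_nat (Suc m) * (?\<mu> (dual_vec (- \<beta>)) - of_nat m * (- \<beta>) (dual_vec (- \<beta>)) / 2) = 0"
      using r(1) by (simp del: of_nat_Suc)
    moreover have "?\<mu> (dual_vec (- \<beta>)) - of_nat m * (- \<beta>) (dual_vec (- \<beta>)) / 2
        = - (\<beta> (dual_vec \<beta>) + \<gamma> (dual_vec \<beta>) + of_nat m * \<beta> (dual_vec \<beta>) / 2)"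
      by (simp add: dual_vec_uminus[OF D(2)] ng[OF D(2) dual_vec[OF D(2)]] ng[OF G(2) dual_vec[OF D(2)]])
    ultimately have "n + of_nat (Suc m) * - (\<beta> (dual_vec \<beta>) + \<gamma> (dual_vec \<beta>) + of_nat m * \<beta> (dual_vec \<beta>) / 2) = 0"
      by (simp only:)
    then have "n = of_nat (Suc m) * (\<beta> (dual_vec \<beta>) + \<gamma> (dual_vec \<beta>) + of_nat m * \<beta> (dual_vec \<beta>) / 2)"
      by (simp only: mult_minus_right add_uminus_conv_diff right_minus_eq)
    also have "\<gamma> (dual_vec \<beta>) = of_int c * \<beta> (dual_vec \<beta>) / 2" using c by (simp add: field_simps)
    also have "of_nat (Suc m) * (\<beta> (dual_vec \<beta>) + of_int c * \<beta> (dual_vec \<beta>) / 2 + of_nat m * \<beta> (dual_vec \<beta>) / 2) = of_rat ?n"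
      unfolding b(2) Suc by (simp add: of_rat_mult of_rat_add of_rat_divide field_simps)
    finally have n': "n = of_rat ?n" .
    have pos: "c + int r + 1 > 0"
    proof (cases "c < 0")
      case True
      have "nat (- c) \<le> r"
      proof (rule ccontr)
        assume "\<not> nat (- c) \<le> r"
        then have "(br x ^^ nat (- c)) (e \<gamma>) = 0"
          using funpow_zero_mono[OF lin_br r(2)] by simp
        then show False using raising_nonzero[OF p g c True] by simp
      qed
      then show ?thesis by linarith
    next
      case False
      then show ?thesis by simp
    qed
    have "?n > 0"
    proof (intro mult_pos_pos)
      show "0 < rat_of_int (c + int r + 1)" using pos by (simp only: of_int_0_less_iff)
    qed (use b(1) Suc in simp_all)
    then have "?n \<ge> 0" "(?n = 0) = (br x (e \<gamma>) = 0)" using nz by (simp_all only: less_imp_le) (metis less_irrefl)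
    then show ?thesis using n unfolding n' by (intro that[of ?n])
  qed
qed

lemma raising_nonzero_if_negative:
  assumes p: "sl2_pair x y \<beta>" and g: "\<gamma> \<in> \<Delta>" and n: "\<gamma> (dual_vec \<beta>) = of_rat q" "q < 0"
  shows "br x (e \<gamma>) \<noteq> 0"
proof -
  note D = sl2_pairD[OF p] and G = sl2_pairD[OF ef[OF g]]
  obtain b where b: "b > 0" "\<beta> (dual_vec \<beta>) = of_rat b" using root_norm[OF D(1)] .
  obtain c :: int where c: "2 * \<gamma> (dual_vec \<beta>) = of_int c * \<beta> (dual_vec \<beta>)"
    using weight_integral[OF p G(3) e_nonzero[OF g] G(2)] .
  have "of_rat (2 * q) = (of_rat (of_int c * b) :: 'a)" using c n(1) b(2) by (simp add: of_rat_mult)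
  then have "2 * q = of_int c * b" by (simp only: of_rat_eq_iff)
  then have "c < 0" using b(1) n(2)
    by (metis mult_less_0_iff not_less_iff_gr_or_eq of_int_less_0_iff zero_less_numeral)
  then have "(br x ^^ nat (- c)) (e \<gamma>) \<noteq> 0" using raising_nonzero[OF p g c] by blast
  moreover obtain k where "nat (- c) = Suc k" using \<open>c < 0\<close> by (cases "nat (- c)") auto
  ultimately show ?thesis using lin_zero[OF lin_funpow[OF lin_br]]
    by (auto simp: funpow_Suc_right simp del: funpow.simps(2))
qed

end

section \<open>The grading attached to a simple root\<close>

locale graded_cartan = killing_cartan +
  fixes S :: "('b \<Rightarrow> 'a) set" and \<alpha> :: "'b \<Rightarrow> 'a" and B :: "'b set" and d :: "'b \<Rightarrow> 'b"
  assumes simple: "simple_roots t S" and \<alpha>: "\<alpha> \<in> S"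
    and dual: "dual_bases (grade t S \<alpha> 0) B d"
begin

lemma S_roots: "S \<subseteq> \<Delta>" and finite_S: "finite S"
  and S_indep: "\<not> module.dependent (\<lambda>c f h. c * f h) S"
  and root_comb: "\<gamma> \<in> \<Delta> \<Longrightarrow> \<exists>n. \<gamma> = int_comb S n \<and> ((\<forall>\<beta>\<in>S. n \<beta> \<ge> 0) \<or> (\<forall>\<beta>\<in>S. n \<beta> \<le> 0))"
  using simple unfolding simple_roots_def by blast+

text \<open>Simple roots are independent, so they can be prescribed arbitrary values.\<close>

lemma simple_coordinates:
  obtains x where "x \<in> t" "\<And>\<beta>. \<beta> \<in> S \<Longrightarrow> \<beta> x = c \<beta>"
proof -
  interpret fm: module "\<lambda>c (f :: 'b \<Rightarrow> 'a) h. c * f h"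
    by unfold_locales (auto simp: fun_eq_iff algebra_simps)
  have ST: "\<beta> \<in> t_dual" if "\<beta> \<in> S" for \<beta> using S_roots root_dual that by blast
  have inj: "inj_on dual_vec S"
  proof (rule inj_onI)
    fix \<beta> \<beta>' assume "\<beta> \<in> S" "\<beta>' \<in> S" "dual_vec \<beta> = dual_vec \<beta>'"
    then show "\<beta> = \<beta>'" using dual_ext[OF ST ST] killing_dual_vec[OF ST] by metis
  qed
  have ind: "independent (dual_vec ` S)"
  proof (rule independent_if_scalars_zero)
    show "finite (dual_vec ` S)" using finite_S by simp
    fix u x assume s: "(\<Sum>x\<in>dual_vec ` S. u x *s x) = 0" and "x \<in> dual_vec ` S"
    then obtain \<beta> where b: "\<beta> \<in> S" "x = dual_vec \<beta>" by blast
    have s': "(\<Sum>\<beta>\<in>S. u (dual_vec \<beta>) *s dual_vec \<beta>) = 0" using s by (simp add: sum.reindex[OF inj])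
    have "(\<Sum>\<beta>\<in>S. (\<lambda>h. u (dual_vec \<beta>) * \<beta> h)) = 0"
    proof
      fix h
      have "(\<Sum>\<beta>\<in>S. u (dual_vec \<beta>) * \<beta> h) = 0"
      proof (cases "h \<in> t")
        case True
        have "(\<Sum>\<beta>\<in>S. u (dual_vec \<beta>) * \<beta> h) = killing (\<Sum>\<beta>\<in>S. u (dual_vec \<beta>) *s dual_vec \<beta>) h"
          by (simp add: killing_sum killing_scale killing_dual_vec[OF ST True])
        then show ?thesis using s' by simp
      next
        case False
        then show ?thesis by (simp add: dualD(3)[OF ST])
      qed
      moreover have "(\<Sum>\<beta>\<in>S. (\<lambda>h. u (dual_vec \<beta>) * \<beta> h)) h = (\<Sum>\<beta>\<in>S. u (dual_vec \<beta>) * \<beta> h)"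
        using finite_S by (induction S rule: finite_induct) auto
      ultimately show "(\<Sum>\<beta>\<in>S. (\<lambda>h. u (dual_vec \<beta>) * \<beta> h)) h = 0 h" by simp
    qed
    then have "u (dual_vec \<beta>) = 0"
      using fm.independentD[OF S_indep finite_S subset_refl, of "\<lambda>\<beta>. u (dual_vec \<beta>)"] b(1) by blast
    then show "u x = 0" using b(2) by simp
  qed
  interpret vp: vector_space_pair scale "(*) :: 'a \<Rightarrow> 'a \<Rightarrow> 'a"
    by (intro vector_space_pair.intro vector_space_axioms vector_space_field)
  obtain g where g: "Vector_Spaces.linear scale (*) g"
      "\<And>x. x \<in> dual_vec ` S \<Longrightarrow> g x = c (inv_into S dual_vec x)"
    using vp.linear_independent_extend[OF ind, of "\<lambda>x. c (inv_into S dual_vec x)"] by blast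
  define f' where "f' x = (if x \<in> t then g x else 0)" for x
  have f': "f' \<in> t_dual" unfolding f'_def
    by (rule dualI) (simp_all add: subspace_add[OF subspace_t] subspace_scale[OF subspace_t]
        lin_add[OF g(1)] lin_scale[OF g(1)])
  show ?thesis
  proof (rule that[OF dual_vec[OF f']])
    fix \<beta> assume b: "\<beta> \<in> S"
    have "\<beta> (dual_vec f') = f' (dual_vec \<beta>)" by (rule ip_sym[OF ST[OF b] f'])
    also have "\<dots> = c \<beta>" using dual_vec[OF ST[OF b]] g(2)[of "dual_vec \<beta>"] b inj by (simp add: f'_def)
    finally show "\<beta> (dual_vec f') = c \<beta>" .
  qed
qed

text \<open>The fundamental coweight of \<open>\<alpha>\<close>: the grading is given by its
  eigenvalues. The second element measures the height of a root and orders the weights.\<close>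

definition cowt where "cowt = (SOME x. x \<in> t \<and> (\<forall>\<beta>\<in>S. \<beta> x = (if \<beta> = \<alpha> then 1 else 0)))"
definition ht_vec where "ht_vec = (SOME x. x \<in> t \<and> (\<forall>\<beta>\<in>S. \<beta> x = 1))"

lemma cowt: "cowt \<in> t" "\<And>\<beta>. \<beta> \<in> S \<Longrightarrow> \<beta> cowt = (if \<beta> = \<alpha> then 1 else 0)"
proof -
  have "\<exists>x. x \<in> t \<and> (\<forall>\<beta>\<in>S. \<beta> x = (if \<beta> = \<alpha> then 1 else 0))"
    using simple_coordinates[of "\<lambda>\<beta>. if \<beta> = \<alpha> then 1 else 0"] by metis
  from someI_ex[OF this] show "cowt \<in> t" "\<And>\<beta>. \<beta> \<in> S \<Longrightarrow> \<beta> cowt = (if \<beta> = \<alpha> then 1 else 0)"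
    unfolding cowt_def by blast+
qed

lemma ht_vec: "ht_vec \<in> t" "\<And>\<beta>. \<beta> \<in> S \<Longrightarrow> \<beta> ht_vec = 1"
proof -
  have "\<exists>x. x \<in> t \<and> (\<forall>\<beta>\<in>S. \<beta> x = 1)" using simple_coordinates[of "\<lambda>_. 1"] by metis
  from someI_ex[OF this] show "ht_vec \<in> t" "\<And>\<beta>. \<beta> \<in> S \<Longrightarrow> \<beta> ht_vec = 1"
    unfolding ht_vec_def by blast+
qed

lemma int_comb_cowt: "int_comb S n cowt = of_int (n \<alpha>)"
proof -
  have "int_comb S n cowt = (\<Sum>\<beta>\<in>S. if \<beta> = \<alpha> then of_int (n \<beta>) else 0)"
    unfolding int_comb_def by (intro sum.cong) (simp_all add: cowt(2))
  then show ?thesis using \<alpha> finite_S by simp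
qed

lemma int_comb_ht_vec: "int_comb S n ht_vec = of_int (\<Sum>\<beta>\<in>S. n \<beta>)"
  unfolding int_comb_def by (simp add: ht_vec(2))

lemma ht_iff: assumes "\<gamma> \<in> \<Delta>" shows "ht S \<alpha> \<gamma> = i \<longleftrightarrow> \<gamma> cowt = of_int i"
proof -
  obtain n where n: "\<gamma> = int_comb S n" using root_comb[OF assms] by blast
  have "ht S \<alpha> \<gamma> = n \<alpha>" unfolding ht_def
  proof (rule the_equality)
    show "\<exists>n'. \<gamma> = int_comb S n' \<and> n' \<alpha> = n \<alpha>" using n by blast
    fix i assume "\<exists>n'. \<gamma> = int_comb S n' \<and> n' \<alpha> = i"
    then obtain n' where "\<gamma> = int_comb S n'" "n' \<alpha> = i" by blast
    then show "i = n \<alpha>" using int_comb_cowt[of n] int_comb_cowt[of n'] n by simp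
  qed
  then show ?thesis using int_comb_cowt[of n] n by simp
qed

lemma root_height:
  assumes "\<gamma> \<in> \<Delta>"
  obtains m :: int where "\<gamma> ht_vec = of_int m" "m \<noteq> 0"
proof -
  obtain n where n: "\<gamma> = int_comb S n" "(\<forall>\<beta>\<in>S. n \<beta> \<ge> 0) \<or> (\<forall>\<beta>\<in>S. n \<beta> \<le> 0)"
    using root_comb[OF assms] by blast
  have "(\<Sum>\<beta>\<in>S. n \<beta>) \<noteq> 0"
  proof
    assume z: "(\<Sum>\<beta>\<in>S. n \<beta>) = 0"
    have "\<forall>\<beta>\<in>S. n \<beta> = 0"
      using n(2)
    proof
      assume "\<forall>\<beta>\<in>S. n \<beta> \<ge> 0"
      then show ?thesis using z finite_S by (simp add: sum_nonneg_eq_0_iff)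
    next
      assume neg: "\<forall>\<beta>\<in>S. n \<beta> \<le> 0"
      have "(\<Sum>\<beta>\<in>S. - n \<beta>) = 0" using z by (simp add: sum_negf)
      then show ?thesis using neg finite_S sum_nonneg_eq_0_iff[of S "\<lambda>\<beta>. - n \<beta>"] by auto
    qed
    then have "\<gamma> h = 0" for h using n(1) unfolding int_comb_def by simp
    then show False using root_nonzero[OF assms] by blast
  qed
  then show ?thesis using that[of "\<Sum>\<beta>\<in>S. n \<beta>"] n(1) int_comb_ht_vec[of n] by simp
qed

lemma root_coeff_expansion_vanish:
  assumes "\<delta> \<in> \<Delta>" "br cowt x = c *s x" "\<delta> cowt \<noteq> c"
  shows "killing (f \<delta>) x = 0"
proof -
  have "br cowt (f \<delta>) = - \<delta> cowt *s f \<delta>" using rsD[OF sl2_pairD(4)[OF ef[OF assms(1)]] cowt(1)] by simp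
  then have "c * killing (f \<delta>) x = \<delta> cowt * killing (f \<delta>) x"
    using killing_inv'[of cowt "f \<delta>" x] assms(2) by (auto simp: killing_scale killing_neg)
  then show ?thesis using assms(3) by simp
qed

lemma subspace_cowt: "subspace {x. br cowt x = c *s x}"
proof -
  have "{x. br cowt x = c *s x} = {x. br cowt x - c *s x \<in> {0}}" by auto
  then show ?thesis using lin_preimage[OF lin_sub_scale[OF lin_br] subspace_single_0] by simp
qed

lemma grade_eigenspace: "grade t S \<alpha> i = {x. br cowt x = of_int i *s x}"
proof
  show "grade t S \<alpha> i \<subseteq> {x. br cowt x = of_int i *s x}"
    unfolding grade_def
  proof (rule span_minimal[OF _ subspace_cowt], rule subsetI)
    fix x assume "x \<in> (if i = 0 then t else {}) \<union> (\<Union>\<gamma>\<in>{\<gamma> \<in> \<Delta>. ht S \<alpha> \<gamma> = i}. rs \<gamma>)"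
    then consider "i = 0" "x \<in> t" | \<gamma> where "\<gamma> \<in> \<Delta>" "ht S \<alpha> \<gamma> = i" "x \<in> rs \<gamma>"
      by (auto split: if_splits)
    then show "x \<in> {x. br cowt x = of_int i *s x}"
    proof cases
      case 1
      then show ?thesis using t_abelian[OF cowt(1)] by simp
    next
      case 2
      then show ?thesis using ht_iff[OF 2(1), of i] rsD[OF 2(3) cowt(1)] by simp
    qed
  qed
  show "{x. br cowt x = of_int i *s x} \<subseteq> grade t S \<alpha> i"
  proof
    fix x assume x: "x \<in> {x. br cowt x = of_int i *s x}"
    obtain A hA where A: "finite A" "A \<subseteq> t" "\<And>a. a \<in> A \<Longrightarrow> hA a \<in> t"
      "\<And>x. x \<in> t \<Longrightarrow> x = (\<Sum>a\<in>A. killing (hA a) x *s a)"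
      using t_dual_frame by blast
    have "x = (\<Sum>a\<in>A. killing (hA a) x *s a) + (\<Sum>\<delta>\<in>\<Delta>. killing (f \<delta>) x *s e \<delta>)"
      by (rule root_expansion[OF A])
    also have "\<dots> \<in> grade t S \<alpha> i"
      unfolding grade_def
    proof (intro span_add span_sum)
      fix a assume a: "a \<in> A"
      show "killing (hA a) x *s a \<in> span ((if i = 0 then t else {}) \<union> (\<Union>\<gamma>\<in>{\<gamma> \<in> \<Delta>. ht S \<alpha> \<gamma> = i}. rs \<gamma>))"
      proof (cases "i = 0")
        case True
        then show ?thesis using a A(2) by (intro span_scale span_base) auto
      next
        case False
        have "of_int i * killing (hA a) x = 0"
          using killing_inv'[of cowt "hA a" x] t_abelian[OF cowt(1) A(3)[OF a]] x by (simp add: killing_scale)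
        then show ?thesis using False by (simp add: span_zero)
      qed
    next
      fix \<delta> assume dl: "\<delta> \<in> \<Delta>"
      show "killing (f \<delta>) x *s e \<delta> \<in> span ((if i = 0 then t else {}) \<union> (\<Union>\<gamma>\<in>{\<gamma> \<in> \<Delta>. ht S \<alpha> \<gamma> = i}. rs \<gamma>))"
      proof (cases "\<delta> cowt = of_int i")
        case True
        then have "ht S \<alpha> \<delta> = i" using ht_iff[OF dl] by simp
        then show ?thesis using dl sl2_pairD(3)[OF ef[OF dl]] by (intro span_scale span_base) auto
      next
        case False
        then have "killing (f \<delta>) x = 0" using root_coeff_expansion_vanish[OF dl] x by blast
        then show ?thesis by (simp add: span_zero)
      qed
    qed
    finally show "x \<in> grade t S \<alpha> i" .
  qed
qed

text \<open>\<open>G0\<close> and \<open>V\<close> are the pieces of degree 0 and 1,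
  \<open>\<Delta>1\<close> is the set of roots of degree 1, and \<open>P\<close> is the set of
  positive roots of degree 0.\<close>

definition G0 where "G0 = {x. br cowt x = 0}"
definition V where "V = {x. br cowt x = x}"
definition \<Delta>1 where "\<Delta>1 = {\<gamma> \<in> \<Delta>. \<gamma> cowt = 1}"
definition P where "P = {\<beta> \<in> \<Delta>. \<beta> cowt = 0 \<and> (\<exists>m::int. m > 0 \<and> \<beta> ht_vec = of_int m)}"

lemma grade0: "grade t S \<alpha> 0 = G0" and grade1: "grade t S \<alpha> 1 = V"
  unfolding grade_eigenspace G0_def V_def by simp_all

lemma P_roots: "P \<subseteq> \<Delta>" and finite_P: "finite P" and \<Delta>1_roots: "\<Delta>1 \<subseteq> \<Delta>" and finite_\<Delta>1: "finite \<Delta>1"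
  using finite_roots finite_subset unfolding P_def \<Delta>1_def by auto

lemma subspace_V: "subspace V"
  using subspace_cowt[of 1] unfolding V_def by simp

lemma G0_br_V: "x \<in> G0 \<Longrightarrow> y \<in> V \<Longrightarrow> br x y \<in> V"
  and G0_br_G0: "x \<in> G0 \<Longrightarrow> y \<in> G0 \<Longrightarrow> br x y \<in> G0"
  unfolding G0_def V_def by (simp_all add: br_deriv[of cowt x y])

lemma t_G0: "t \<subseteq> G0" unfolding G0_def using t_abelian[OF cowt(1)] by blast

lemma rs_G0: "\<beta> cowt = 0 \<Longrightarrow> x \<in> rs \<beta> \<Longrightarrow> x \<in> G0"
  and rs_V: "\<beta> cowt = 1 \<Longrightarrow> x \<in> rs \<beta> \<Longrightarrow> x \<in> V"
  unfolding G0_def V_def using rsD[OF _ cowt(1)] by auto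

lemma ef_G0: assumes "\<beta> \<in> P" shows "e \<beta> \<in> G0" "f \<beta> \<in> G0"
  using assms sl2_pairD(3,4)[OF ef[of \<beta>]] rs_G0[of \<beta>] rs_G0[of "- \<beta>"] unfolding P_def by auto

lemma zero_grade_roots: "{\<beta> \<in> \<Delta>. \<beta> cowt = 0} = P \<union> uminus ` P"
proof
  show "{\<beta> \<in> \<Delta>. \<beta> cowt = 0} \<subseteq> P \<union> uminus ` P"
  proof
    fix \<beta> assume b: "\<beta> \<in> {\<beta> \<in> \<Delta>. \<beta> cowt = 0}"
    obtain m :: int where m: "\<beta> ht_vec = of_int m" "m \<noteq> 0" using root_height b by blast
    show "\<beta> \<in> P \<union> uminus ` P"
    proof (cases "m > 0")
      case True
      then show ?thesis using b m unfolding P_def by auto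
    next
      case False
      then have "- m > 0" "(- \<beta>) ht_vec = of_int (- m)" using m by auto
      then have "- \<beta> \<in> P" using b root_uminus unfolding P_def
        by (auto intro!: exI[of _ "- m"])
      then show ?thesis by (metis UnI2 image_eqI minus_minus)
    qed
  qed
qed (use root_uminus in \<open>auto simp: P_def\<close>)

lemma P_not_neg: "\<beta> \<in> P \<Longrightarrow> - \<beta> \<notin> P"
proof
  assume "\<beta> \<in> P" "- \<beta> \<in> P"
  then obtain m m' :: int where "m > 0" "\<beta> ht_vec = of_int m" "m' > 0" "- \<beta> ht_vec = of_int m'"
    unfolding P_def by auto
  then have "of_int (m + m') = (0 :: 'a)" by (metis add.right_inverse of_int_add)
  then have "m + m' = 0" by (simp only: of_int_eq_0_iff)
  then show False using \<open>m > 0\<close> \<open>m' > 0\<close> by simp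
qed

text \<open>The normalised pair chosen for \<open>- \<beta>\<close> is the pair for
  \<open>\<beta>\<close> exchanged, up to inverse scalars.\<close>

lemma opposite_term:
  assumes b: "\<beta> \<in> \<Delta>"
  shows "killing (f (- \<beta>)) x *s e (- \<beta>) = killing (e \<beta>) x *s f \<beta>"
proof -
  note D = sl2_pairD[OF ef[OF b]] and N = sl2_pairD[OF ef[OF root_uminus[OF b]]]
  have e': "e (- \<beta>) = killing (e \<beta>) (e (- \<beta>)) *s f \<beta>" by (rule rs_one_dim[OF ef[OF b] N(3)])
  have f': "f (- \<beta>) = killing (f \<beta>) (f (- \<beta>)) *s e \<beta>"
    using rs_one_dim'[OF ef[OF b], of "f (- \<beta>)"] N(4) by simp
  let ?c = "killing (e \<beta>) (e (- \<beta>))" and ?c' = "killing (f \<beta>) (f (- \<beta>))"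
  have "1 = killing (e (- \<beta>)) (f (- \<beta>))" using N(5) by simp
  also have "\<dots> = killing (?c *s f \<beta>) (?c' *s e \<beta>)" using e' f' by simp
  also have "\<dots> = ?c * ?c'" using D(5) killing_sym[of "f \<beta>" "e \<beta>"] by (simp add: killing_scale)
  finally have cc: "?c * ?c' = 1" by simp
  have "killing (f (- \<beta>)) x *s e (- \<beta>) = killing (?c' *s e \<beta>) x *s (?c *s f \<beta>)" using e' f' by simp
  also have "\<dots> = (?c * ?c') *s (killing (e \<beta>) x *s f \<beta>)" by (simp add: killing_scale mult.commute mult.left_commute)
  finally show ?thesis using cc by simp
qed

lemma V_expansion: assumes "x \<in> V" shows "x = (\<Sum>\<gamma>\<in>\<Delta>1. killing (f \<gamma>) x *s e \<gamma>)"
proof -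
  obtain A hA where A: "finite A" "A \<subseteq> t" "\<And>a. a \<in> A \<Longrightarrow> hA a \<in> t"
    "\<And>x. x \<in> t \<Longrightarrow> x = (\<Sum>a\<in>A. killing (hA a) x *s a)"
    using t_dual_frame by blast
  have x: "br cowt x = x" using assms unfolding V_def by simp
  have "killing (hA a) x = 0" if "a \<in> A" for a
    using killing_inv'[of cowt "hA a" x] t_abelian[OF cowt(1) A(3)[OF that]] x by simp
  then have "x = (\<Sum>\<delta>\<in>\<Delta>. killing (f \<delta>) x *s e \<delta>)" using root_expansion[OF A, of x] by simp
  also have "\<dots> = (\<Sum>\<delta>\<in>\<Delta>1. killing (f \<delta>) x *s e \<delta>)"
    using root_coeff_expansion_vanish[of _ x 1] x
    by (intro sum.mono_neutral_right finite_roots \<Delta>1_roots) (auto simp: \<Delta>1_def)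
  finally show ?thesis .
qed

lemma G0_expansion:
  assumes A: "finite A" "A \<subseteq> t" "\<And>a. a \<in> A \<Longrightarrow> hA a \<in> t"
    "\<And>x. x \<in> t \<Longrightarrow> x = (\<Sum>a\<in>A. killing (hA a) x *s a)" and x: "x \<in> G0"
  shows "x = (\<Sum>a\<in>A. killing (hA a) x *s a)
    + (\<Sum>\<beta>\<in>P. killing (f \<beta>) x *s e \<beta> + killing (e \<beta>) x *s f \<beta>)"
proof -
  have x': "br cowt x = 0" using x unfolding G0_def by simp
  have inj: "inj_on uminus P" by (rule inj_onI) (metis minus_minus)
  have "(\<Sum>\<delta>\<in>\<Delta>. killing (f \<delta>) x *s e \<delta>) = (\<Sum>\<delta>\<in>{\<beta> \<in> \<Delta>. \<beta> cowt = 0}. killing (f \<delta>) x *s e \<delta>)"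
    using root_coeff_expansion_vanish[of _ x 0] x'
    by (intro sum.mono_neutral_right finite_roots) auto
  also have "\<dots> = (\<Sum>\<delta>\<in>P. killing (f \<delta>) x *s e \<delta>) + (\<Sum>\<delta>\<in>uminus ` P. killing (f \<delta>) x *s e \<delta>)"
    unfolding zero_grade_roots using finite_P P_not_neg by (intro sum.union_disjoint) auto
  also have "(\<Sum>\<delta>\<in>uminus ` P. killing (f \<delta>) x *s e \<delta>) = (\<Sum>\<beta>\<in>P. killing (e \<beta>) x *s f \<beta>)"
    using P_roots by (simp add: sum.reindex[OF inj]) (intro sum.cong refl opposite_term, blast)
  finally show ?thesis using root_expansion[OF A, of x] by (simp add: sum.distrib)
qed

section \<open>Casimir sums\<close>

lemma B: "finite B" "B \<subseteq> G0" "\<And>b. b \<in> B \<Longrightarrow> d b \<in> G0"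
  and B_expansion: "x \<in> G0 \<Longrightarrow> x = (\<Sum>b\<in>B. killing (d b) x *s b)"
  and d_expansion: "x \<in> G0 \<Longrightarrow> x = (\<Sum>b\<in>B. killing x b *s d b)"
proof -
  have ind: "independent B" "span B = G0" "independent (d ` B)" "span (d ` B) = G0"
    and dl: "\<And>b c. b \<in> B \<Longrightarrow> c \<in> B \<Longrightarrow> killing (d b) c = (if b = c then 1 else 0)"
    using dual unfolding dual_bases_def grade0 by auto
  show fin: "finite B" by (rule finiteI_independent[OF ind(1)])
  show "B \<subseteq> G0" using span_superset[of B] ind(2) by simp
  show "d b \<in> G0" if "b \<in> B" for b using that span_superset[of "d ` B"] ind(4) by auto
  have inj: "inj_on d B" using dl by (intro inj_onI) (metis one_neq_zero)
  show "x = (\<Sum>b\<in>B. killing (d b) x *s b)" if x: "x \<in> G0"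
  proof -
    have xs: "x = (\<Sum>b\<in>B. representation B x b *s b)"
      by (rule sum_representation_eq[symmetric]) (use ind x fin in auto)
    have "killing (d c) x = representation B x c" if c: "c \<in> B" for c
    proof -
      have "killing (d c) x = (\<Sum>b\<in>B. representation B x b * killing (d c) b)"
        by (subst xs) (simp add: killing_sum killing_scale)
      also have "\<dots> = (\<Sum>b\<in>B. if c = b then representation B x b else 0)"
        by (intro sum.cong) (simp_all add: dl c)
      finally show ?thesis using c fin by simp
    qed
    then show ?thesis by (subst xs) (intro sum.cong, simp_all)
  qed
  show "x = (\<Sum>b\<in>B. killing x b *s d b)" if x: "x \<in> G0"
  proof -
    have "x = (\<Sum>z\<in>d ` B. representation (d ` B) x z *s z)"
      by (rule sum_representation_eq[symmetric]) (use ind x fin in auto)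
    then have xs: "x = (\<Sum>b\<in>B. representation (d ` B) x (d b) *s d b)" by (simp add: sum.reindex[OF inj])
    have "killing x c = representation (d ` B) x (d c)" if c: "c \<in> B" for c
    proof -
      have "killing x c = (\<Sum>b\<in>B. representation (d ` B) x (d b) * killing (d b) c)"
        by (subst xs) (simp add: killing_sum killing_scale)
      also have "\<dots> = (\<Sum>b\<in>B. if b = c then representation (d ` B) x (d b) else 0)"
        by (intro sum.cong) (simp_all add: dl c)
      finally show ?thesis using c fin by simp
    qed
    then show ?thesis by (subst xs) (intro sum.cong, simp_all)
  qed
qed

text \<open>Any bilinear expression in a pair of dual bases is independent of their choice; here
  it is rewritten in terms of \<open>t\<close> and root vectors.\<close>

lemma casimir_sum:
  assumes A: "finite A" "A \<subseteq> t" "\<And>a. a \<in> A \<Longrightarrow> hA a \<in> t"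
      "\<And>x. x \<in> t \<Longrightarrow> x = (\<Sum>a\<in>A. killing (hA a) x *s a)"
    and F1: "\<And>y. Vector_Spaces.linear scale sM (\<lambda>x. F x y)"
    and F2: "\<And>x. Vector_Spaces.linear scale sM (F x)"
  shows "(\<Sum>b\<in>B. F (d b) b) = (\<Sum>a\<in>A. F (hA a) a) + (\<Sum>\<beta>\<in>P. F (f \<beta>) (e \<beta>) + F (e \<beta>) (f \<beta>))"
proof -
  have col: "(\<Sum>b\<in>B. sM (killing c b) (F (d b) z)) = F c z" if "c \<in> G0" for c z
  proof -
    have "(\<Sum>b\<in>B. sM (killing c b) (F (d b) z)) = F (\<Sum>b\<in>B. killing c b *s d b) z"
      by (simp add: lin_sum[OF F1] lin_scale[OF F1])
    then show ?thesis using d_expansion[OF that] by simp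
  qed
  have "F (d b) b = (\<Sum>a\<in>A. sM (killing (hA a) b) (F (d b) a)) +
     (\<Sum>\<beta>\<in>P. sM (killing (f \<beta>) b) (F (d b) (e \<beta>)) + sM (killing (e \<beta>) b) (F (d b) (f \<beta>)))"
    if b: "b \<in> B" for b
  proof -
    have "b \<in> G0" using b B(2) by blast
    then show ?thesis
      by (subst G0_expansion[OF A, of b])
        (simp_all add: lin_sum[OF F2] lin_scale[OF F2] lin_add[OF F2])
  qed
  then have "(\<Sum>b\<in>B. F (d b) b) = (\<Sum>b\<in>B. (\<Sum>a\<in>A. sM (killing (hA a) b) (F (d b) a)) +
     (\<Sum>\<beta>\<in>P. sM (killing (f \<beta>) b) (F (d b) (e \<beta>)) + sM (killing (e \<beta>) b) (F (d b) (f \<beta>))))"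
    by (rule sum.cong[OF refl])
  also have "\<dots> = (\<Sum>a\<in>A. \<Sum>b\<in>B. sM (killing (hA a) b) (F (d b) a)) +
     (\<Sum>\<beta>\<in>P. (\<Sum>b\<in>B. sM (killing (f \<beta>) b) (F (d b) (e \<beta>))) + (\<Sum>b\<in>B. sM (killing (e \<beta>) b) (F (d b) (f \<beta>))))"
    unfolding sum.distrib by (simp add: sum.swap[of _ B])
  also have "\<dots> = (\<Sum>a\<in>A. F (hA a) a) + (\<Sum>\<beta>\<in>P. F (f \<beta>) (e \<beta>) + F (e \<beta>) (f \<beta>))"
    using A(3) t_G0 ef_G0 by (simp add: col subset_iff)
  finally show ?thesis .
qed

text \<open>The tensor \<open>\<Sum> d b \<otimes> b\<close> is invariant, because the form
  is.\<close>

lemma casimir_invariant: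
  assumes F1: "\<And>y. Vector_Spaces.linear scale sM (\<lambda>x. F x y)"
    and F2: "\<And>x. Vector_Spaces.linear scale sM (F x)" and x: "x \<in> G0"
  shows "(\<Sum>b\<in>B. F (br x (d b)) b) + (\<Sum>b\<in>B. F (d b) (br x b)) = 0"
proof -
  have "F (br x (d b)) b = (\<Sum>c\<in>B. sM (killing (br x (d b)) c) (F (d c) b))" if "b \<in> B" for b
    by (subst d_expansion[OF G0_br_G0[OF x B(3)[OF that]]]) (simp add: lin_sum[OF F1] lin_scale[OF F1])
  then have "(\<Sum>b\<in>B. F (br x (d b)) b) = (\<Sum>b\<in>B. \<Sum>c\<in>B. sM (killing (br x (d b)) c) (F (d c) b))"
    by (rule sum.cong[OF refl])
  also have "\<dots> = (\<Sum>c\<in>B. \<Sum>b\<in>B. sM (killing (br x (d b)) c) (F (d c) b))" by (rule sum.swap)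
  also have "\<dots> = (\<Sum>c\<in>B. F (d c) (\<Sum>b\<in>B. killing (br x (d b)) c *s b))"
    by (simp add: lin_sum[OF F2] lin_scale[OF F2])
  also have "\<dots> = (\<Sum>c\<in>B. F (d c) (- br x c))"
  proof (intro sum.cong refl arg_cong[where f = "F _"])
    fix c assume "c \<in> B"
    then have "br x c \<in> G0" using G0_br_G0[OF x] B(2) by blast
    then have "- br x c = - (\<Sum>b\<in>B. killing (d b) (br x c) *s b)" using B_expansion by metis
    also have "\<dots> = (\<Sum>b\<in>B. killing (br x (d b)) c *s b)"
      by (simp add: sum_negf[symmetric] killing_inv'[of x])
    finally show "(\<Sum>b\<in>B. killing (br x (d b)) c *s b) = - br x c" by simp
  qed
  finally show ?thesis by (simp add: lin_neg[OF F2] sum_negf)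
qed

section \<open>The Casimir element on weight vectors\<close>

definition rep_on :: "('a \<Rightarrow> 'm::ab_group_add \<Rightarrow> 'm) \<Rightarrow> ('b \<Rightarrow> 'm \<Rightarrow> 'm) \<Rightarrow> bool"
  where "rep_on sM R \<longleftrightarrow> (\<forall>x. Vector_Spaces.linear sM sM (R x)) \<and>
    (\<forall>m. Vector_Spaces.linear scale sM (\<lambda>x. R x m)) \<and>
    (\<forall>x y m. R (br x y) m = R x (R y m) - R y (R x m))"

lemma rep_onD:
  assumes "rep_on sM R"
  shows "Vector_Spaces.linear sM sM (R x)" "Vector_Spaces.linear scale sM (\<lambda>x. R x m)"
    "R (br x y) m = R x (R y m) - R y (R x m)"
  using assms unfolding rep_on_def by blast+

lemma rep_on_adjoint: "rep_on scale br"
  unfolding rep_on_def by (simp add: lin_br lin_br_left br_br)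

lemma rep_on_vs: "rep_on sM R \<Longrightarrow> vector_space sM"
  using rep_onD(1) by (auto simp: Vector_Spaces.linear_iff)

abbreviation cas :: "('b \<Rightarrow> 'm::ab_group_add \<Rightarrow> 'm) \<Rightarrow> 'm \<Rightarrow> 'm"
  where "cas R m \<equiv> casimir B d R m"

lemma rep_bilinear:
  assumes R: "rep_on sM R"
  shows "Vector_Spaces.linear scale sM (\<lambda>x. R x (R y m))" "Vector_Spaces.linear scale sM (\<lambda>y. R x (R y m))"
proof -
  show "Vector_Spaces.linear scale sM (\<lambda>x. R x (R y m))" by (rule rep_onD(2)[OF R])
  show "Vector_Spaces.linear scale sM (\<lambda>y. R x (R y m))"
    using rep_onD(1)[OF R, of x] rep_onD(2)[OF R, of m] by (simp add: Vector_Spaces.linear_iff)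
qed

lemma linear_cas:
  assumes R: "rep_on sM R"
  shows "Vector_Spaces.linear sM sM (cas R)"
proof -
  interpret M: vector_space sM by (rule rep_on_vs[OF R])
  show ?thesis unfolding casimir_def Vector_Spaces.linear_iff
    by (auto simp: lin_add[OF rep_onD(1)[OF R]] lin_scale[OF rep_onD(1)[OF R]] sum.distrib
        M.scale_sum_right M.vector_space_axioms)
qed

lemma cas_commute:
  assumes R: "rep_on sM R" and x: "x \<in> G0"
  shows "R x (cas R m) = cas R (R x m)"
proof -
  have "R x (cas R m) - cas R (R x m)
    = (\<Sum>b\<in>B. R (br x (d b)) (R b m)) + (\<Sum>b\<in>B. R (d b) (R (br x b) m))"
    unfolding casimir_def
    by (simp add: lin_sum[OF rep_onD(1)[OF R]] rep_onD(3)[OF R] lin_diff[OF rep_onD(1)[OF R]]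
        sum.distrib[symmetric] sum_subtractf[symmetric])
  also have "\<dots> = 0" by (rule casimir_invariant[OF rep_bilinear[OF R] x])
  finally show ?thesis by simp
qed

lemma dual_apply_sum:
  assumes "\<nu> \<in> t_dual" "A \<subseteq> t"
  shows "\<nu> (\<Sum>a\<in>A. c a *s a) = (\<Sum>a\<in>A. c a * \<nu> a)"
  using assms(2)
proof (induction A rule: infinite_finite_induct)
  case (insert a A)
  have "(\<Sum>a\<in>A. c a *s a) \<in> t"
    using insert.prems by (intro subspace_sum[OF subspace_t] subspace_scale[OF subspace_t]) auto
  then show ?case using insert by (simp add: dualD[OF assms(1)] subspace_scale[OF subspace_t])
qed (use dualD(2)[OF assms(1) subspace_0[OF subspace_t], of 0] in simp_all)

text \<open>The value \<open>(\<nu>, \<nu> + 2 \<rho>)\<close> of the Casimir element on a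
  highest weight vector, where \<open>2 \<rho>\<close> is the sum of the roots in
  \<open>P\<close>.\<close>

definition hw_scalar :: "('b \<Rightarrow> 'a) \<Rightarrow> 'a"
  where "hw_scalar \<nu> = \<nu> (dual_vec \<nu>) + (\<Sum>\<beta>\<in>P. \<nu> (dual_vec \<beta>))"

text \<open>Reordering \<open>e\<^sub>\<beta> f\<^sub>\<beta> = f\<^sub>\<beta> e\<^sub>\<beta>
  + dual_vec \<beta>\<close>. The second summand is kept for vectors that are not of highest
  weight, such as the root vectors of \<open>V\<close>.\<close>

lemma cas_weight:
  assumes R: "rep_on sM R" and \<nu>: "\<nu> \<in> t_dual" and m: "\<And>h. h \<in> t \<Longrightarrow> R h m = sM (\<nu> h) m"
  shows "cas R m = sM (hw_scalar \<nu>) m + sM 2 (\<Sum>\<beta>\<in>P. R (f \<beta>) (R (e \<beta>) m))"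
proof -
  interpret M: vector_space sM by (rule rep_on_vs[OF R])
  obtain A hA where A: "finite A" "A \<subseteq> t" "\<And>a. a \<in> A \<Longrightarrow> hA a \<in> t"
    "\<And>x. x \<in> t \<Longrightarrow> x = (\<Sum>a\<in>A. killing (hA a) x *s a)"
    using t_dual_frame by blast
  have "cas R m = (\<Sum>a\<in>A. R (hA a) (R a m)) + (\<Sum>\<beta>\<in>P. R (f \<beta>) (R (e \<beta>) m) + R (e \<beta>) (R (f \<beta>) m))"
    unfolding casimir_def by (rule casimir_sum[OF A rep_bilinear[OF R]])
  also have "(\<Sum>a\<in>A. R (hA a) (R a m)) = sM (\<nu> (dual_vec \<nu>)) m"
  proof -
    have "\<nu> (dual_vec \<nu>) = \<nu> (\<Sum>a\<in>A. killing (hA a) (dual_vec \<nu>) *s a)" using A(4)[OF dual_vec[OF \<nu>]] by simp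
    also have "\<dots> = (\<Sum>a\<in>A. \<nu> (hA a) * \<nu> a)"
      unfolding dual_apply_sum[OF \<nu> A(2)]
      using killing_dual_vec[OF \<nu> A(3)] killing_sym by (intro sum.cong) auto
    finally have eq: "\<nu> (dual_vec \<nu>) = (\<Sum>a\<in>A. \<nu> (hA a) * \<nu> a)" .
    have "R (hA a) (R a m) = sM (\<nu> (hA a) * \<nu> a) m" if "a \<in> A" for a
    proof -
      have "a \<in> t" using that A(2) by blast
      then show ?thesis using m A(3)[OF that]
        by (simp add: lin_scale[OF rep_onD(1)[OF R]] mult.commute)
    qed
    then show ?thesis unfolding eq by (simp add: M.scale_sum_left)
  qed
  also have "(\<Sum>\<beta>\<in>P. R (f \<beta>) (R (e \<beta>) m) + R (e \<beta>) (R (f \<beta>) m))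
    = (\<Sum>\<beta>\<in>P. sM 2 (R (f \<beta>) (R (e \<beta>) m)) + sM (\<nu> (dual_vec \<beta>)) m)"
  proof (rule sum.cong[OF refl])
    fix \<beta> assume "\<beta> \<in> P"
    then have b: "\<beta> \<in> \<Delta>" using P_roots by blast
    note D = sl2_pairD[OF ef[OF b]]
    have "R (e \<beta>) (R (f \<beta>) m) = R (f \<beta>) (R (e \<beta>) m) + sM (\<nu> (dual_vec \<beta>)) m"
      using rep_onD(3)[OF R, of "e \<beta>" "f \<beta>" m] m[OF dual_vec[OF D(2)]] unfolding D(6) by (simp add: algebra_simps)
    moreover have "sM 2 z = z + z" for z using M.scale_left_distrib[of 1 1 z] by simp
    ultimately show "R (f \<beta>) (R (e \<beta>) m) + R (e \<beta>) (R (f \<beta>) m)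
      = sM 2 (R (f \<beta>) (R (e \<beta>) m)) + sM (\<nu> (dual_vec \<beta>)) m" by simp
  qed
  finally show ?thesis unfolding hw_scalar_def
    by (simp add: sum.distrib M.scale_left_distrib M.scale_sum_left M.scale_sum_right algebra_simps)
qed

text \<open>The scalar by which \<open>ad f\<^sub>\<beta> ad e\<^sub>\<beta>\<close> acts on the
  root line of \<open>\<gamma>\<close>.\<close>

definition ladder :: "('b \<Rightarrow> 'a) \<Rightarrow> ('b \<Rightarrow> 'a) \<Rightarrow> rat"
  where "ladder \<beta> \<gamma> = (SOME q. br (f \<beta>) (br (e \<beta>) (e \<gamma>)) = of_rat q *s e \<gamma> \<and> q \<ge> 0 \<and>
    (q = 0 \<longleftrightarrow> br (e \<beta>) (e \<gamma>) = 0))"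

lemma ladder:
  assumes "\<beta> \<in> \<Delta>" "\<gamma> \<in> \<Delta>"
  shows "br (f \<beta>) (br (e \<beta>) (e \<gamma>)) = of_rat (ladder \<beta> \<gamma>) *s e \<gamma>" "ladder \<beta> \<gamma> \<ge> 0"
    "ladder \<beta> \<gamma> = 0 \<longleftrightarrow> br (e \<beta>) (e \<gamma>) = 0"
proof -
  have "\<exists>q. br (f \<beta>) (br (e \<beta>) (e \<gamma>)) = of_rat q *s e \<gamma> \<and> q \<ge> 0 \<and> (q = 0 \<longleftrightarrow> br (e \<beta>) (e \<gamma>) = 0)"
    using lowering_raising_scalar[OF ef[OF assms(1)] assms(2)] by metis
  from someI_ex[OF this] show "br (f \<beta>) (br (e \<beta>) (e \<gamma>)) = of_rat (ladder \<beta> \<gamma>) *s e \<gamma>" "ladder \<beta> \<gamma> \<ge> 0"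
    "ladder \<beta> \<gamma> = 0 \<longleftrightarrow> br (e \<beta>) (e \<gamma>) = 0" unfolding ladder_def by blast+
qed

definition ip_rat :: "('b \<Rightarrow> 'a) \<Rightarrow> ('b \<Rightarrow> 'a) \<Rightarrow> rat"
  where "ip_rat \<gamma> \<beta> = (SOME q. \<gamma> (dual_vec \<beta>) = of_rat q)"

lemma ip_rat: "\<beta> \<in> \<Delta> \<Longrightarrow> \<gamma> \<in> \<Delta> \<Longrightarrow> \<gamma> (dual_vec \<beta>) = of_rat (ip_rat \<gamma> \<beta>)"
proof -
  assume "\<beta> \<in> \<Delta>" "\<gamma> \<in> \<Delta>"
  then have "\<exists>q. \<gamma> (dual_vec \<beta>) = of_rat q" using root_ip_rational by metis
  then show ?thesis unfolding ip_rat_def by (rule someI_ex)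
qed

lemma of_rat_sum: "of_rat (\<Sum>i\<in>I. g i) = (\<Sum>i\<in>I. of_rat (g i) :: 'a)"
  by (induction I rule: infinite_finite_induct) (simp_all add: of_rat_add)

definition root_scalar :: "('b \<Rightarrow> 'a) \<Rightarrow> rat"
  where "root_scalar \<gamma> = ip_rat \<gamma> \<gamma> + (\<Sum>\<beta>\<in>P. ip_rat \<gamma> \<beta>) + 2 * (\<Sum>\<beta>\<in>P. ladder \<beta> \<gamma>)"

lemma cas_root_vector:
  assumes g: "\<gamma> \<in> \<Delta>"
  shows "cas br (e \<gamma>) = of_rat (root_scalar \<gamma>) *s e \<gamma>"
proof -
  note G = sl2_pairD[OF ef[OF g]]
  have "cas br (e \<gamma>) = hw_scalar \<gamma> *s e \<gamma> + 2 *s (\<Sum>\<beta>\<in>P. br (f \<beta>) (br (e \<beta>) (e \<gamma>)))"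
    by (rule cas_weight[OF rep_on_adjoint G(2) rsD[OF G(3)]])
  also have "(\<Sum>\<beta>\<in>P. br (f \<beta>) (br (e \<beta>) (e \<gamma>))) = of_rat (\<Sum>\<beta>\<in>P. ladder \<beta> \<gamma>) *s e \<gamma>"
    unfolding of_rat_sum scale_sum_left using ladder(1)[OF _ g] P_roots by (intro sum.cong) auto
  also have "hw_scalar \<gamma> = of_rat (ip_rat \<gamma> \<gamma> + (\<Sum>\<beta>\<in>P. ip_rat \<gamma> \<beta>))"
    unfolding hw_scalar_def using ip_rat[OF _ g] g P_roots by (auto simp: of_rat_add of_rat_sum intro!: sum.cong)
  finally show ?thesis unfolding root_scalar_def
    by (simp add: of_rat_add of_rat_mult scale_left_distrib)
qed

lemma \<alpha>_\<Delta>1: "\<alpha> \<in> \<Delta>1"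
  using \<alpha> S_roots cowt(2)[OF \<alpha>] unfolding \<Delta>1_def by auto

text \<open>The vectors on which the Casimir element acts as on \<open>e \<alpha>\<close> form a
  submodule, so it suffices to reach every \<open>e \<gamma>\<close> from \<open>e
  \<alpha>\<close>. As \<open>(\<gamma>, \<gamma>) > 0\<close>, some simple root
  \<open>\<beta>\<close> satisfies \<open>(\<gamma>, \<beta>) > 0\<close>; then \<open>e
  \<gamma>\<close> is a multiple of \<open>[e \<beta>, y]\<close> for \<open>y = [f \<beta>, e
  \<gamma>]\<close>. If \<open>\<beta> \<noteq> \<alpha>\<close>, then \<open>y\<close> is a
  root vector of \<open>V\<close> of smaller height; if \<open>\<beta> = \<alpha>\<close>, then
  \<open>y\<close> has degree 0 and \<open>e \<gamma>\<close> is a multiple of \<open>[y, e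
  \<alpha>]\<close>.\<close>

lemma cas_V_roots: "\<gamma> \<in> \<Delta>1 \<Longrightarrow> \<gamma> ht_vec = of_int m \<Longrightarrow> cas br (e \<gamma>) = of_rat (root_scalar \<alpha>) *s e \<gamma>"
proof (induction "nat m" arbitrary: m \<gamma> rule: less_induct)
  case less
  define K where "K = {x. cas br x = of_rat (root_scalar \<alpha>) *s x}"
  have C: "Vector_Spaces.linear scale scale (cas br)" by (rule linear_cas[OF rep_on_adjoint])
  have Ksc: "c *s x \<in> K" if "x \<in> K" for c x
    using that unfolding K_def by (simp add: lin_scale[OF C] mult.commute)
  have Kst: "br x y \<in> K" if "x \<in> G0" "y \<in> K" for x y
    using cas_commute[OF rep_on_adjoint that(1), of y] that(2) unfolding K_def by (simp add: br_scale_right)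
  have aR: "\<alpha> \<in> \<Delta>" using \<alpha> S_roots by blast
  have aK: "e \<alpha> \<in> K" unfolding K_def using cas_root_vector[OF aR] by simp
  have gR: "\<gamma> \<in> \<Delta>" and gw: "\<gamma> cowt = 1" using less.prems(1) unfolding \<Delta>1_def by auto
  note G = sl2_pairD[OF ef[OF gR]]
  obtain n where n: "\<gamma> = int_comb S n" "(\<forall>\<beta>\<in>S. n \<beta> \<ge> 0) \<or> (\<forall>\<beta>\<in>S. n \<beta> \<le> 0)"
    using root_comb[OF gR] by blast
  have "of_int (n \<alpha>) = (of_int 1 :: 'a)" using int_comb_cowt[of n] n(1) gw by simp
  then have na: "n \<alpha> = 1" by (simp only: of_int_eq_iff)
  then have n0: "n \<beta> \<ge> 0" if "\<beta> \<in> S" for \<beta> using n(2) \<alpha> that by force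
  have "of_int m = (of_int (\<Sum>\<beta>\<in>S. n \<beta>) :: 'a)" using int_comb_ht_vec[of n] n(1) less.prems(2) by simp
  then have m: "m = (\<Sum>\<beta>\<in>S. n \<beta>)" by (simp only: of_int_eq_iff)
  have m1: "m \<ge> 1" unfolding m using member_le_sum[OF \<alpha>, of n] n0 finite_S na by auto
  obtain q where q: "q > 0" "\<gamma> (dual_vec \<gamma>) = of_rat q" using root_norm[OF gR] .
  \<comment> \<open>The norm of \<open>\<gamma>\<close> is a combination of the
    \<open>(\<gamma>, \<beta>)\<close> with non-negative coefficients.\<close>
  have "\<exists>\<beta>\<in>S. ip_rat \<gamma> \<beta> > 0"
  proof (rule ccontr)
    assume "\<not> (\<exists>\<beta>\<in>S. ip_rat \<gamma> \<beta> > 0)"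
    then have neg: "(\<Sum>\<beta>\<in>S. of_int (n \<beta>) * ip_rat \<gamma> \<beta>) \<le> 0"
      using n0 by (intro sum_nonpos mult_nonneg_nonpos) (auto simp: not_less)
    have "\<gamma> (dual_vec \<gamma>) = (\<Sum>\<beta>\<in>S. of_int (n \<beta>) * \<beta> (dual_vec \<gamma>))"
      using fun_cong[OF n(1), of "dual_vec \<gamma>"] unfolding int_comb_def by simp
    also have "\<dots> = (\<Sum>\<beta>\<in>S. of_int (n \<beta>) * \<gamma> (dual_vec \<beta>))"
      using ip_sym[OF G(2) root_dual] S_roots by (intro sum.cong) (auto simp: subset_iff)
    also have "\<dots> = of_rat (\<Sum>\<beta>\<in>S. of_int (n \<beta>) * ip_rat \<gamma> \<beta>)"
      unfolding of_rat_sum using ip_rat[OF _ gR] S_roots by (intro sum.cong) (auto simp: of_rat_mult)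
    finally show False using q neg by (simp only: of_rat_eq_iff)
  qed
  then obtain \<beta> where b: "\<beta> \<in> S" "ip_rat \<gamma> \<beta> > 0" by blast
  have bR: "\<beta> \<in> \<Delta>" using b(1) S_roots by blast
  note D = sl2_pairD[OF ef[OF bR]]
  note sw = sl2_pair_swap[OF ef[OF bR]]
  have "\<gamma> (- dual_vec \<beta>) = - \<gamma> (dual_vec \<beta>)" using dualD(2)[OF G(2) dual_vec[OF D(2)], of "-1"] by simp
  then have "\<gamma> (dual_vec (- \<beta>)) = of_rat (- ip_rat \<gamma> \<beta>)"
    using ip_rat[OF bR gR] by (simp add: dual_vec_uminus[OF D(2)] of_rat_minus)
  then have ynz: "br (f \<beta>) (e \<gamma>) \<noteq> 0"
    by (rule raising_nonzero_if_negative[OF sw gR]) (use b(2) in simp)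
  let ?y = "br (f \<beta>) (e \<gamma>)"
  obtain r where r: "br (e \<beta>) ?y = of_rat r *s e \<gamma>" "r \<noteq> 0"
    using lowering_raising_scalar[OF sw gR] ynz by metis
  have yr: "?y \<in> rs (\<lambda>h. (- \<beta>) h + \<gamma> h)" by (rule rs_br[OF D(4) G(3)])
  have "br (e \<beta>) ?y \<in> K"
  proof (cases "\<beta> = \<alpha>")
    case True
    have "?y \<in> G0" using rs_G0[OF _ yr] gw cowt(2)[OF b(1)] True by simp
    then have "br ?y (e \<beta>) \<in> K" using Kst aK True by blast
    then show ?thesis using br_skew[of "e \<beta>" ?y] Ksc[of "br ?y (e \<beta>)" "-1"] by simp
  next
    case False
    let ?\<delta> = "\<gamma> - \<beta>"
    have wd: "?\<delta> cowt = 1" using gw cowt(2)[OF b(1)] False by simp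
    have yd: "?y \<in> rs ?\<delta>" using yr by (simp add: fun_diff_def algebra_simps)
    have dR: "?\<delta> \<in> \<Delta>" by (rule rootI[OF dual_diff[OF G(2) D(2)] cowt(1) _ yd ynz]) (simp only: wd, simp)
    have "?\<delta> ht_vec = of_int (m - 1)" using less.prems(2) ht_vec(2)[OF b(1)] by simp
    moreover have "nat (m - 1) < nat m" using m1 by simp
    ultimately have "e ?\<delta> \<in> K" unfolding K_def using less.hyps[of "m - 1" ?\<delta>] dR wd by (auto simp: \<Delta>1_def)
    then have "?y \<in> K" using rs_one_dim'[OF ef[OF dR] yd] Ksc by metis
    moreover have "e \<beta> \<in> G0" using rs_G0[OF _ D(3)] cowt(2)[OF b(1)] False by simp
    ultimately show ?thesis using Kst by blast
  qed
  then have "inverse (of_rat r) *s (of_rat r *s e \<gamma>) \<in> K" unfolding r(1) by (rule Ksc)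
  then have "e \<gamma> \<in> K" using r(2) by simp
  then show ?case unfolding K_def by simp
qed

lemma cas_V: assumes "x \<in> V" shows "cas br x = of_rat (root_scalar \<alpha>) *s x"
proof -
  have C: "Vector_Spaces.linear scale scale (cas br)" by (rule linear_cas[OF rep_on_adjoint])
  have r: "cas br (e \<gamma>) = of_rat (root_scalar \<alpha>) *s e \<gamma>" if "\<gamma> \<in> \<Delta>1" for \<gamma>
  proof -
    have "\<gamma> \<in> \<Delta>" using that \<Delta>1_roots by blast
    then obtain m :: int where "\<gamma> ht_vec = of_int m" using root_height by metis
    then show ?thesis using cas_V_roots that by blast
  qed
  have "cas br x = cas br (\<Sum>\<gamma>\<in>\<Delta>1. killing (f \<gamma>) x *s e \<gamma>)" using V_expansion[OF assms] by simp
  also have "\<dots> = (\<Sum>\<gamma>\<in>\<Delta>1. of_rat (root_scalar \<alpha>) *s (killing (f \<gamma>) x *s e \<gamma>))"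
    by (simp add: lin_sum[OF C] lin_scale[OF C] r mult.commute)
  also have "\<dots> = of_rat (root_scalar \<alpha>) *s x" unfolding scale_sum_right[symmetric] using V_expansion[OF assms] by simp
  finally show ?thesis .
qed

lemma e_V: "\<gamma> \<in> \<Delta>1 \<Longrightarrow> e \<gamma> \<in> V"
  using rs_V sl2_pairD(3)[OF ef] unfolding \<Delta>1_def by blast

lemma casimir_scalar_V: "casimir_scalar B d V = root_scalar \<alpha>"
  unfolding casimir_scalar_def
proof (rule the_equality)
  show "\<forall>x\<in>V. cas br x = of_rat (root_scalar \<alpha>) *s x" using cas_V by blast
  fix q assume "\<forall>x\<in>V. cas br x = of_rat q *s x"
  then have "(of_rat q :: 'a) *s e \<alpha> = of_rat (root_scalar \<alpha>) *s e \<alpha>" using cas_V e_V[OF \<alpha>_\<Delta>1] by metis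
  then have "(of_rat q :: 'a) = of_rat (root_scalar \<alpha>)"
    using e_nonzero \<alpha>_\<Delta>1 \<Delta>1_roots unfolding scale_cancel_right by blast
  then show "q = root_scalar \<alpha>" by simp
qed

lemma root_scalar_\<Delta>1: assumes "\<gamma> \<in> \<Delta>1" shows "root_scalar \<gamma> = root_scalar \<alpha>"
proof -
  have g: "\<gamma> \<in> \<Delta>" using assms \<Delta>1_roots by blast
  have "(of_rat (root_scalar \<gamma>) :: 'a) *s e \<gamma> = of_rat (root_scalar \<alpha>) *s e \<gamma>"
    using cas_root_vector[OF g] cas_V[OF e_V[OF assms]] by metis
  then have "(of_rat (root_scalar \<gamma>) :: 'a) = of_rat (root_scalar \<alpha>)" using e_nonzero[OF g] unfolding scale_cancel_right by blast
  then show ?thesis by simp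
qed

section \<open>The inequality\<close>

text \<open>The antisymmetrised product of two brackets depends only on \<open>[x, y]\<close>
  and \<open>[u, v]\<close>. With \<open>u\<close>, \<open>v\<close> of degree \<open>-
  1\<close> this identifies the mixed terms of the Casimir element on products.\<close>

lemma killing_quadratic:
  "killing (br x u) (br y v) - killing (br x v) (br y u) = killing (br x y) (br u v)"
proof -
  have "killing (br x u) (br y v) - killing (br x v) (br y u)
    = killing x (br u (br y v) - br v (br y u))" unfolding killing_inv by (simp add: killing_diff)
  also have "br u (br y v) - br v (br y u) = br y (br u v)"
    unfolding br_deriv[of y u v] using br_skew[of y u] br_skew[of u "br y v"] br_skew[of v "br y u"]
      br_skew[of "br y u" v] by (simp add: br_neg)
  finally show ?thesis unfolding killing_inv[of x y] .
qed

text \<open>The part of \<open>(\<gamma>, \<delta>)\<close> caused by \<open>\<gamma> -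
  \<delta>\<close> being a positive root of degree 0.\<close>

definition step_coeff :: "('b \<Rightarrow> 'a) \<Rightarrow> ('b \<Rightarrow> 'a) \<Rightarrow> rat"
  where "step_coeff \<gamma> \<delta> = (if \<gamma> - \<delta> \<in> P then ladder (\<gamma> - \<delta>) \<delta> else 0)"

lemma killing_step:
  assumes g: "\<gamma> \<in> \<Delta>" and dl: "\<delta> \<in> \<Delta>" and b: "\<gamma> - \<delta> \<in> P"
  shows "killing (br (e \<gamma>) (f \<delta>)) (br (e \<delta>) (f \<gamma>)) = of_rat (ladder (\<gamma> - \<delta>) \<delta>)"
proof -
  define \<beta> where "\<beta> = \<gamma> - \<delta>"
  have bR: "\<beta> \<in> \<Delta>" using b P_roots unfolding \<beta>_def by blast
  note D = sl2_pairD[OF ef[OF bR]] and G = sl2_pairD[OF ef[OF g]] and L = sl2_pairD[OF ef[OF dl]]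
  have fd: "killing (f \<delta>) (e \<delta>) = 1" using L(5) killing_sym by simp
  let ?v = "br (e \<beta>) (e \<delta>)" and ?u = "br (e \<gamma>) (f \<delta>)"
  have "?v \<in> rs (\<lambda>h. \<beta> h + \<delta> h)" by (rule rs_br[OF D(3) L(3)])
  then have "?v \<in> rs \<gamma>" unfolding \<beta>_def by simp
  then have v: "?v = killing (f \<gamma>) ?v *s e \<gamma>" by (rule rs_one_dim'[OF ef[OF g]])
  have "?u \<in> rs (\<lambda>h. \<gamma> h + (- \<delta>) h)" by (rule rs_br[OF G(3) L(4)])
  then have "?u \<in> rs \<beta>" unfolding \<beta>_def by (simp add: fun_diff_def)
  then have u: "?u = killing (f \<beta>) ?u *s e \<beta>" by (rule rs_one_dim'[OF ef[OF bR]])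
  have "of_rat (ladder \<beta> \<delta>) = killing (f \<delta>) (br (f \<beta>) ?v)"
    unfolding ladder(1)[OF bR dl] using fd by (simp add: killing_scale)
  also have "\<dots> = killing (f \<gamma>) ?v * killing (f \<delta>) (br (f \<beta>) (e \<gamma>))"
    by (subst v) (simp add: br_scale_right killing_scale)
  also have "killing (f \<gamma>) ?v = killing (e \<beta>) (br (e \<delta>) (f \<gamma>))"
    using killing_sym[of "f \<gamma>" ?v] killing_inv by simp
  also have "killing (f \<delta>) (br (f \<beta>) (e \<gamma>)) = killing (f \<beta>) ?u"
    using killing_sym[of "f \<delta>" "br (f \<beta>) (e \<gamma>)"] killing_inv by simp
  also have "killing (e \<beta>) (br (e \<delta>) (f \<gamma>)) * killing (f \<beta>) ?u = killing ?u (br (e \<delta>) (f \<gamma>))"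
    using arg_cong[OF u, of "\<lambda>u. killing u (br (e \<delta>) (f \<gamma>))"] by (simp only: killing_scale mult.commute)
  finally show ?thesis unfolding \<beta>_def by (rule sym)
qed

text \<open>The identity \<open>killing_quadratic\<close> for the root vectors of
  \<open>\<gamma>\<close> and \<open>\<delta>\<close>.\<close>

lemma ip_rat_pair:
  assumes g: "\<gamma> \<in> \<Delta>1" and dl: "\<delta> \<in> \<Delta>1" and ne: "\<gamma> \<noteq> \<delta>"
  shows "ip_rat \<gamma> \<delta> = step_coeff \<gamma> \<delta> + step_coeff \<delta> \<gamma> - ladder \<delta> \<gamma>"
proof -
  have gR: "\<gamma> \<in> \<Delta>" "\<gamma> cowt = 1" and dR: "\<delta> \<in> \<Delta>" "\<delta> cowt = 1" using g dl unfolding \<Delta>1_def by auto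
  note G = sl2_pairD[OF ef[OF gR(1)]] and L = sl2_pairD[OF ef[OF dR(1)]]
  have m: "killing (br (e \<gamma>) (e \<delta>)) (br (f \<gamma>) (f \<delta>)) = - of_rat (ladder \<delta> \<gamma>)"
  proof -
    have "killing (br (e \<gamma>) (e \<delta>)) (br (f \<gamma>) (f \<delta>)) = killing (f \<gamma>) (br (f \<delta>) (br (e \<gamma>) (e \<delta>)))"
      using killing_sym[of "br (e \<gamma>) (e \<delta>)"] killing_inv by simp
    also have "\<dots> = - killing (f \<gamma>) (br (f \<delta>) (br (e \<delta>) (e \<gamma>)))"
      using br_skew[of "e \<gamma>" "e \<delta>"] by (simp add: br_neg killing_neg)
    also have "\<dots> = - of_rat (ladder \<delta> \<gamma>)"
      unfolding ladder(1)[OF dR(1) gR(1)] using G(5) killing_sym[of "f \<gamma>" "e \<gamma>"] by (simp add: killing_scale)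
    finally show ?thesis .
  qed
  have A: "killing (br (e \<gamma>) (f \<delta>)) (br (e \<delta>) (f \<gamma>)) = of_rat (step_coeff \<gamma> \<delta> + step_coeff \<delta> \<gamma>)"
  proof (cases "\<gamma> - \<delta> \<in> P")
    case True
    then have "\<delta> - \<gamma> \<notin> P" using P_not_neg[OF True] by simp
    then show ?thesis using killing_step[OF gR(1) dR(1) True] True unfolding step_coeff_def by simp
  next
    case F1: False
    show ?thesis
    proof (cases "\<delta> - \<gamma> \<in> P")
      case True
      then show ?thesis using killing_step[OF dR(1) gR(1) True] F1 killing_sym[of "br (e \<gamma>) (f \<delta>)"]
        unfolding step_coeff_def by simp
    next
      case False
      have "\<gamma> - \<delta> \<notin> \<Delta>"
      proof
        assume "\<gamma> - \<delta> \<in> \<Delta>"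
        then have "\<gamma> - \<delta> \<in> P \<union> uminus ` P" unfolding zero_grade_roots[symmetric] using gR dR by simp
        then have "\<gamma> - \<delta> \<in> uminus ` P" using F1 by blast
        then have "\<delta> - \<gamma> \<in> P" by (auto simp: minus_equation_iff[of _ "_ - _"] dest: sym)
        then show False using False by blast
      qed
      obtain h where h: "h \<in> t" "\<gamma> h \<noteq> \<delta> h" using dual_ext[OF G(2) L(2)] ne by blast
      have u: "br (e \<gamma>) (f \<delta>) \<in> rs (\<lambda>h. \<gamma> h + (- \<delta>) h)" by (rule rs_br[OF G(3) L(4)])
      then have u': "br (e \<gamma>) (f \<delta>) \<in> rs (\<gamma> - \<delta>)" by (simp add: fun_diff_def)
      have "br (e \<gamma>) (f \<delta>) = 0"
        using rootI[OF dual_diff[OF G(2) L(2)] h(1) _ u'] h(2) \<open>\<gamma> - \<delta> \<notin> \<Delta>\<close> by auto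
      then show ?thesis using F1 False unfolding step_coeff_def by simp
    qed
  qed
  have "killing (br (e \<gamma>) (f \<gamma>)) (br (e \<delta>) (f \<delta>)) = \<gamma> (dual_vec \<delta>)"
    unfolding G(6) L(6) by (rule killing_dual_vec[OF G(2) dual_vec[OF L(2)]])
  then have "of_rat (ip_rat \<gamma> \<delta>) - of_rat (step_coeff \<gamma> \<delta> + step_coeff \<delta> \<gamma>) = (- of_rat (ladder \<delta> \<gamma>) :: 'a)"
    using killing_quadratic[of "e \<gamma>" "f \<gamma>" "e \<delta>" "f \<delta>"] ip_rat[OF dR(1) gR(1)] m A by simp
  then have "(of_rat (ip_rat \<gamma> \<delta>) :: 'a) = of_rat (step_coeff \<gamma> \<delta> + step_coeff \<delta> \<gamma> - ladder \<delta> \<gamma>)"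
    by (simp add: of_rat_diff algebra_simps)
  then show ?thesis by (simp only: of_rat_eq_iff)
qed

definition hw_value :: "('b \<Rightarrow> 'a) set \<Rightarrow> rat"
  where "hw_value I = (\<Sum>\<gamma>\<in>I. \<Sum>\<delta>\<in>I. ip_rat \<gamma> \<delta>) + (\<Sum>\<gamma>\<in>I. \<Sum>\<beta>\<in>P. ip_rat \<gamma> \<beta>)"

lemma hw_scalar_sum:
  assumes I: "finite I" "I \<subseteq> \<Delta>"
  shows "hw_scalar (\<Sum>\<gamma>\<in>I. \<gamma>) = of_rat (hw_value I)"
proof -
  let ?L = "\<Sum>\<gamma>\<in>I. \<gamma>"
  have IT: "\<gamma> \<in> t_dual" if "\<gamma> \<in> I" for \<gamma> using that I(2) root_dual by blast
  have L: "?L \<in> t_dual" by (rule dual_sum) (rule IT)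
  have app: "?L x = (\<Sum>\<gamma>\<in>I. \<gamma> x)" for x using I(1) by (induction I rule: finite_induct) auto
  have "?L (dual_vec ?L) = (\<Sum>\<gamma>\<in>I. \<Sum>\<delta>\<in>I. \<delta> (dual_vec \<gamma>))"
    by (subst app) (intro sum.cong refl, simp add: ip_sym[OF IT L] app)
  also have "\<dots> = (\<Sum>\<gamma>\<in>I. \<Sum>\<delta>\<in>I. \<gamma> (dual_vec \<delta>))" by (rule sum.swap)
  also have "\<dots> = of_rat (\<Sum>\<gamma>\<in>I. \<Sum>\<delta>\<in>I. ip_rat \<gamma> \<delta>)"
    unfolding of_rat_sum using ip_rat I(2) by (intro sum.cong) auto
  finally have 1: "?L (dual_vec ?L) = of_rat (\<Sum>\<gamma>\<in>I. \<Sum>\<delta>\<in>I. ip_rat \<gamma> \<delta>)" .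
  have "(\<Sum>\<beta>\<in>P. ?L (dual_vec \<beta>)) = (\<Sum>\<gamma>\<in>I. \<Sum>\<beta>\<in>P. \<gamma> (dual_vec \<beta>))" unfolding app by (rule sum.swap)
  also have "\<dots> = of_rat (\<Sum>\<gamma>\<in>I. \<Sum>\<beta>\<in>P. ip_rat \<gamma> \<beta>)"
    unfolding of_rat_sum using ip_rat I(2) P_roots by (intro sum.cong) auto
  finally show ?thesis unfolding hw_scalar_def hw_value_def 1 of_rat_add by simp
qed

text \<open>For \<open>\<lambda> = \<Sum>I\<close> the difference of the two sides is \<open>2 X
  + Y\<close>. Here \<open>Y\<close> sums the \<open>ladder\<close> scalars of pairs in
  \<open>I\<close>, which vanish exactly when the pair commutes, and \<open>X\<close> sums
  \<open>ladder \<beta> \<delta>\<close> for \<open>\<delta> \<in> I\<close> and those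
  \<open>\<beta> \<in> P\<close> for which \<open>\<delta> + \<beta>\<close> lies outside
  \<open>I\<close>: the terms with \<open>\<delta> + \<beta> \<in> I\<close> cancel against
  inner products of roots.\<close>

lemma hw_value_bound:
  assumes I: "I \<subseteq> \<Delta>1"
  shows "hw_value I \<le> of_nat (card I) * root_scalar \<alpha>"
    and "hw_value I = of_nat (card I) * root_scalar \<alpha> \<Longrightarrow> \<gamma> \<in> I \<Longrightarrow> \<delta> \<in> I \<Longrightarrow> br (e \<gamma>) (e \<delta>) = 0"
proof -
  have fin: "finite I" using I finite_\<Delta>1 finite_subset by blast
  have IR: "\<gamma> \<in> \<Delta>" if "\<gamma> \<in> I" for \<gamma> using that I \<Delta>1_roots by blast
  define X where "X = (\<Sum>\<delta>\<in>I. (\<Sum>\<beta>\<in>P. ladder \<beta> \<delta>) - (\<Sum>\<gamma>\<in>I. step_coeff \<gamma> \<delta>))"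
  define Y where "Y = (\<Sum>\<gamma>\<in>I. \<Sum>\<delta>\<in>I - {\<gamma>}. ladder \<delta> \<gamma>)"
  have st0: "step_coeff \<gamma> \<gamma> = 0" for \<gamma>
  proof -
    have "0 \<notin> P" using P_roots by (auto simp: roots_def)
    then show ?thesis unfolding step_coeff_def by simp
  qed
  have off: "(\<Sum>\<delta>\<in>I - {\<gamma>}. ip_rat \<gamma> \<delta>) = (\<Sum>\<delta>\<in>I. step_coeff \<gamma> \<delta>) + (\<Sum>\<delta>\<in>I. step_coeff \<delta> \<gamma>) - (\<Sum>\<delta>\<in>I - {\<gamma>}. ladder \<delta> \<gamma>)"
    if g: "\<gamma> \<in> I" for \<gamma>
  proof -
    have "(\<Sum>\<delta>\<in>I - {\<gamma>}. ip_rat \<gamma> \<delta>) = (\<Sum>\<delta>\<in>I - {\<gamma>}. step_coeff \<gamma> \<delta> + step_coeff \<delta> \<gamma> - ladder \<delta> \<gamma>)"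
      by (rule sum.cong[OF refl], rule ip_rat_pair) (use I g in auto)
    moreover have "(\<Sum>\<delta>\<in>I - {\<gamma>}. step_coeff \<gamma> \<delta>) = (\<Sum>\<delta>\<in>I. step_coeff \<gamma> \<delta>)"
      "(\<Sum>\<delta>\<in>I - {\<gamma>}. step_coeff \<delta> \<gamma>) = (\<Sum>\<delta>\<in>I. step_coeff \<delta> \<gamma>)"
      using st0 fin by (simp_all add: sum_diff1)
    ultimately show ?thesis by (simp add: sum.distrib sum_subtractf)
  qed
  have diag: "(\<Sum>\<delta>\<in>I. ip_rat \<gamma> \<delta>) = ip_rat \<gamma> \<gamma> + (\<Sum>\<delta>\<in>I - {\<gamma>}. ip_rat \<gamma> \<delta>)" if "\<gamma> \<in> I" for \<gamma>
    using that fin by (simp add: sum.remove)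
  have total: "of_nat (card I) * root_scalar \<alpha> = (\<Sum>\<gamma>\<in>I. root_scalar \<gamma>)" using root_scalar_\<Delta>1 I by (simp add: subset_iff)
  have "of_nat (card I) * root_scalar \<alpha> - hw_value I = (\<Sum>\<gamma>\<in>I. 2 * (\<Sum>\<beta>\<in>P. ladder \<beta> \<gamma>) - (\<Sum>\<delta>\<in>I - {\<gamma>}. ip_rat \<gamma> \<delta>))"
  proof -
    have "hw_value I = (\<Sum>\<gamma>\<in>I. (\<Sum>\<delta>\<in>I. ip_rat \<gamma> \<delta>) + (\<Sum>\<beta>\<in>P. ip_rat \<gamma> \<beta>))"
      unfolding hw_value_def by (rule sum.distrib[symmetric])
    then have "(\<Sum>\<gamma>\<in>I. root_scalar \<gamma>) - hw_value I = (\<Sum>\<gamma>\<in>I. root_scalar \<gamma> - ((\<Sum>\<delta>\<in>I. ip_rat \<gamma> \<delta>) + (\<Sum>\<beta>\<in>P. ip_rat \<gamma> \<beta>)))"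
      by (simp only: sum_subtractf)
    also have "\<dots> = (\<Sum>\<gamma>\<in>I. 2 * (\<Sum>\<beta>\<in>P. ladder \<beta> \<gamma>) - (\<Sum>\<delta>\<in>I - {\<gamma>}. ip_rat \<gamma> \<delta>))"
      by (intro sum.cong refl) (simp add: diag root_scalar_def)
    finally show ?thesis unfolding total .
  qed
  also have "\<dots> = (\<Sum>\<gamma>\<in>I. 2 * (\<Sum>\<beta>\<in>P. ladder \<beta> \<gamma>) - (\<Sum>\<delta>\<in>I. step_coeff \<gamma> \<delta>) - (\<Sum>\<delta>\<in>I. step_coeff \<delta> \<gamma>)
      + (\<Sum>\<delta>\<in>I - {\<gamma>}. ladder \<delta> \<gamma>))"
    by (intro sum.cong refl) (simp add: off)
  also have "\<dots> = 2 * X + Y"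
  proof -
    have "(\<Sum>\<gamma>\<in>I. \<Sum>\<delta>\<in>I. step_coeff \<gamma> \<delta>) = (\<Sum>\<delta>\<in>I. \<Sum>\<gamma>\<in>I. step_coeff \<gamma> \<delta>)" by (rule sum.swap)
    then show ?thesis unfolding X_def Y_def by (simp add: sum.distrib sum_subtractf sum_distrib_left sum_negf)
  qed
  finally have key: "of_nat (card I) * root_scalar \<alpha> - hw_value I = 2 * X + Y" .
  have X0: "X \<ge> 0" unfolding X_def
  proof (rule sum_nonneg)
    fix \<delta> assume dl: "\<delta> \<in> I"
    let ?J = "{\<gamma> \<in> I. \<gamma> - \<delta> \<in> P}"
    have inj: "inj_on (\<lambda>\<gamma>. \<gamma> - \<delta>) ?J" by (rule inj_onI) simp
    have "(\<Sum>\<gamma>\<in>I. step_coeff \<gamma> \<delta>) = (\<Sum>\<gamma>\<in>?J. ladder (\<gamma> - \<delta>) \<delta>)"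
      unfolding step_coeff_def using fin by (simp add: sum.inter_filter)
    also have "\<dots> = (\<Sum>\<beta>\<in>(\<lambda>\<gamma>. \<gamma> - \<delta>) ` ?J. ladder \<beta> \<delta>)" by (simp add: sum.reindex[OF inj])
    also have "\<dots> \<le> (\<Sum>\<beta>\<in>P. ladder \<beta> \<delta>)"
      using finite_P ladder(2)[OF _ IR[OF dl]] P_roots by (intro sum_mono2) auto
    finally show "0 \<le> (\<Sum>\<beta>\<in>P. ladder \<beta> \<delta>) - (\<Sum>\<gamma>\<in>I. step_coeff \<gamma> \<delta>)" by simp
  qed
  have in0: "0 \<le> (\<Sum>\<delta>\<in>I - {\<gamma>}. ladder \<delta> \<gamma>)" if "\<gamma> \<in> I" for \<gamma>
    using ladder(2) IR that by (intro sum_nonneg) auto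
  have Y0: "Y \<ge> 0" unfolding Y_def by (rule sum_nonneg) (rule in0)
  show "hw_value I \<le> of_nat (card I) * root_scalar \<alpha>" using key X0 Y0 by linarith
  assume eq: "hw_value I = of_nat (card I) * root_scalar \<alpha>" and gd: "\<gamma> \<in> I" "\<delta> \<in> I"
  have "Y = 0" using key X0 Y0 eq by linarith
  then have "(\<Sum>\<gamma>'\<in>I - {\<delta>}. ladder \<gamma>' \<delta>) = 0"
    unfolding Y_def using sum_nonneg_eq_0_iff[OF fin in0] gd(2) by auto
  then have "ladder \<gamma> \<delta> = 0" if "\<gamma> \<noteq> \<delta>"
    using sum_nonneg_eq_0_iff[of "I - {\<delta>}" "\<lambda>\<gamma>'. ladder \<gamma>' \<delta>"] fin ladder(2) IR gd that by auto
  then show "br (e \<gamma>) (e \<delta>) = 0"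
    using ladder(3)[OF IR[OF gd(1)] IR[OF gd(2)]] br_self by (cases "\<gamma> = \<delta>") auto
qed

end

section \<open>The exterior power as a representation\<close>

text \<open>A linear map with kernel \<open>N\<close> serves as the quotient map, with quotient
  a subspace of the same type.\<close>

lemma (in vector_space) exists_projection:
  assumes N: "subspace N"
  shows "\<exists>\<pi>. Vector_Spaces.linear scale scale \<pi> \<and> (\<forall>p. \<pi> p = 0 \<longleftrightarrow> p \<in> N) \<and> (\<forall>p. p - \<pi> p \<in> N)"
proof -
  obtain A where A: "A \<subseteq> N" "independent A" "N \<subseteq> span A" by (rule maximal_independent_subset)
  obtain C where C: "A \<subseteq> C" "C \<subseteq> UNIV" "independent C" "UNIV \<subseteq> span C"
    using maximal_independent_subset_extend[OF subset_UNIV A(2)] by blast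
  interpret vp: vector_space_pair scale scale by (intro vector_space_pair.intro vector_space_axioms)
  obtain \<pi> where \<pi>: "Vector_Spaces.linear scale scale \<pi>" "\<And>c. c \<in> C \<Longrightarrow> \<pi> c = (if c \<in> A then 0 else c)"
    using vp.linear_independent_extend[OF C(3), of "\<lambda>c. if c \<in> A then 0 else c"] by blast
  have diff: "p - \<pi> p \<in> N" for p
  proof -
    have "p \<in> span C" using C(4) by blast
    then show ?thesis
    proof (induction rule: span_induct_alt)
      case base
      then show ?case using subspace_0[OF N] lin_zero[OF \<pi>(1)] by simp
    next
      case (step c x y)
      have "x - \<pi> x \<in> N" using \<pi>(2)[of x] step A(1) subspace_0[OF N] by auto
      then have "c *s (x - \<pi> x) + (y - \<pi> y) \<in> N" using step by (intro subspace_add[OF N] subspace_scale[OF N])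
      then show ?case by (simp add: lin_add[OF \<pi>(1)] lin_scale[OF \<pi>(1)] scale_right_diff_distrib algebra_simps)
    qed
  qed
  have "\<pi> p = 0" if "p \<in> N" for p
  proof -
    have "p \<in> span A" using that A(3) by blast
    then show ?thesis
      by (induction rule: span_induct_alt)
        (use \<pi>(2) C(1) in \<open>auto simp: lin_zero[OF \<pi>(1)] lin_add[OF \<pi>(1)] lin_scale[OF \<pi>(1)]\<close>)
  qed
  moreover have "p \<in> N" if "\<pi> p = 0" for p using diff[of p] that by simp
  ultimately show ?thesis using \<pi>(1) diff by blast
qed

lemma gen_expansion: "p = (\<Sum>x\<in>Poly_Mapping.keys p. fscale (Poly_Mapping.lookup p x) (gen x))"
proof (rule poly_mapping_eqI)
  fix y
  have "Poly_Mapping.lookup (\<Sum>x\<in>Poly_Mapping.keys p. fscale (Poly_Mapping.lookup p x) (gen x)) y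
    = (\<Sum>x\<in>Poly_Mapping.keys p. Poly_Mapping.lookup p x * (if x = y then 1 else 0))"
    by (simp add: Poly_Mapping.lookup_sum lookup_fscale lookup_single when_def)
  also have "\<dots> = (\<Sum>x\<in>Poly_Mapping.keys p. if x = y then Poly_Mapping.lookup p x else 0)"
    by (intro sum.cong) auto
  also have "\<dots> = Poly_Mapping.lookup p y" by (simp add: in_keys_iff)
  finally show "Poly_Mapping.lookup p y =
    Poly_Mapping.lookup (\<Sum>x\<in>Poly_Mapping.keys p. fscale (Poly_Mapping.lookup p x) (gen x)) y" by simp
qed

lemma span_gen: "free.span (range gen) = UNIV"
proof -
  have "p \<in> free.span (range gen)" for p :: "'a \<Rightarrow>\<^sub>0 'b::field"
    by (subst gen_expansion) (intro free.span_sum free.span_scale free.span_base rangeI)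
  then show ?thesis by blast
qed

lemma sum_keys_superset:
  assumes "finite A" "Poly_Mapping.keys p \<subseteq> A"
  shows "(\<Sum>x\<in>Poly_Mapping.keys p. fscale (Poly_Mapping.lookup p x) (g x))
    = (\<Sum>x\<in>A. fscale (Poly_Mapping.lookup p x) (g x))"
  using assms by (intro sum.mono_neutral_left) (auto simp: in_keys_iff)

lemma vector_space_fscale: "vector_space (fscale :: 'k::field \<Rightarrow> ('b \<Rightarrow>\<^sub>0 'k) \<Rightarrow> _)"
  by (rule free.vector_space_axioms)

lemma lin_compose:
  "Vector_Spaces.linear s1 s2 g \<Longrightarrow> Vector_Spaces.linear s2 s3 h \<Longrightarrow> Vector_Spaces.linear s1 s3 (\<lambda>x. h (g x))"
  unfolding Vector_Spaces.linear_iff by simp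

lemma lin_free_extend:
  fixes g :: "'a \<Rightarrow> ('b \<Rightarrow>\<^sub>0 'k::field)"
  shows "Vector_Spaces.linear fscale fscale (free_extend g)"
  unfolding Vector_Spaces.linear_iff
proof (intro conjI allI vector_space_fscale)
  fix p q :: "'a \<Rightarrow>\<^sub>0 'k"
  let ?A = "Poly_Mapping.keys p \<union> Poly_Mapping.keys q"
  have "free_extend g (p + q) = (\<Sum>x\<in>?A. fscale (Poly_Mapping.lookup (p + q) x) (g x))"
    unfolding free_extend_def by (rule sum_keys_superset) (simp, rule Poly_Mapping.keys_add)
  also have "\<dots> = (\<Sum>x\<in>?A. fscale (Poly_Mapping.lookup p x) (g x)) + (\<Sum>x\<in>?A. fscale (Poly_Mapping.lookup q x) (g x))"
    by (simp add: Poly_Mapping.lookup_add free.scale_left_distrib sum.distrib)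
  also have "\<dots> = free_extend g p + free_extend g q"
    unfolding free_extend_def by (simp add: sum_keys_superset[of ?A])
  finally show "free_extend g (p + q) = free_extend g p + free_extend g q" .
next
  fix c and p :: "'a \<Rightarrow>\<^sub>0 'k"
  have "free_extend g (fscale c p) = (\<Sum>x\<in>Poly_Mapping.keys p. fscale (Poly_Mapping.lookup (fscale c p) x) (g x))"
    unfolding free_extend_def by (rule sum_keys_superset) (auto simp: in_keys_iff lookup_fscale)
  then show "free_extend g (fscale c p) = fscale c (free_extend g p)"
    unfolding free_extend_def by (simp add: lookup_fscale free.scale_sum_right)
qed

lemma free_extend_gen: "free_extend g (gen x) = g x"
  unfolding free_extend_def by (simp add: in_keys_iff lookup_single)

text \<open>The exterior power of the whole algebra, on which every element acts. The exterior
  power of a subspace embeds into it (\<open>ext_null_subspace\<close>), so that operators need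
  not be restricted.\<close>

locale exterior_power = lie_algebra +
  fixes k :: nat
begin

definition cls :: "('b list \<Rightarrow>\<^sub>0 'a) \<Rightarrow> ('b list \<Rightarrow>\<^sub>0 'a)"
  where "cls = (SOME \<pi>. Vector_Spaces.linear fscale fscale \<pi> \<and>
    (\<forall>p. \<pi> p = 0 \<longleftrightarrow> p \<in> ext_null scale UNIV k) \<and> (\<forall>p. p - \<pi> p \<in> ext_null scale UNIV k))"

lemma cls: shows lin_cls: "Vector_Spaces.linear fscale fscale cls"
  and cls_zero: "cls p = 0 \<longleftrightarrow> p \<in> ext_null scale UNIV k"
  and cls_diff: "p - cls p \<in> ext_null scale UNIV k"
proof -
  have "free.subspace (ext_null scale UNIV k)" unfolding ext_null_def by (rule free.subspace_span)
  from someI_ex[OF free.exists_projection[OF this]]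
  show "Vector_Spaces.linear fscale fscale cls" "cls p = 0 \<longleftrightarrow> p \<in> ext_null scale UNIV k"
    "p - cls p \<in> ext_null scale UNIV k" unfolding cls_def by blast+
qed

definition ext_rel :: "'b set \<Rightarrow> ('b list \<Rightarrow>\<^sub>0 'a) set"
  where "ext_rel W =
    {gen (xs[i := a + b]) - gen (xs[i := a]) - gen (xs[i := b]) | xs i a b.
        xs \<in> tuples W k \<and> i < k \<and> a \<in> W \<and> b \<in> W} \<union>
    {gen (xs[i := c *s a]) - fscale c (gen (xs[i := a])) | xs i c a.
        xs \<in> tuples W k \<and> i < k \<and> a \<in> W} \<union>
    {gen xs | xs. xs \<in> tuples W k \<and> \<not> distinct xs}"

lemma ext_null_span: "ext_null scale W k = free.span (ext_rel W)"
  unfolding ext_null_def ext_rel_def ..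

lemma ext_rel_cases [consumes 1, case_names add scl rep]:
  assumes "q \<in> ext_rel W"
  obtains xs i a b where "q = gen (xs[i := a + b]) - gen (xs[i := a]) - gen (xs[i := b])"
      "length xs = k" "i < k"
    | xs i c a where "q = gen (xs[i := c *s a]) - fscale c (gen (xs[i := a]))" "length xs = k" "i < k"
    | xs where "q = gen xs" "length xs = k" "\<not> distinct xs"
  using assms unfolding ext_rel_def tuples_def by blast

definition wedge :: "'b list \<Rightarrow> ('b list \<Rightarrow>\<^sub>0 'a)"
  where "wedge xs = cls (gen xs)"

lemma wedge_add:
  assumes "length xs = k" "i < k"
  shows "wedge (xs[i := a + b]) = wedge (xs[i := a]) + wedge (xs[i := b])"
proof -
  have "gen (xs[i := a + b]) - gen (xs[i := a]) - gen (xs[i := b]) \<in> ext_null scale UNIV k"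
    unfolding ext_null_def using assms by (intro free.span_base UnI1) (auto simp: tuples_def)
  then have "cls (gen (xs[i := a + b]) - gen (xs[i := a]) - gen (xs[i := b])) = 0" by (simp only: cls_zero)
  then show ?thesis unfolding wedge_def by (simp add: lin_diff[OF lin_cls] diff_eq_eq add.commute)
qed

lemma wedge_scale:
  assumes "length xs = k" "i < k"
  shows "wedge (xs[i := c *s a]) = fscale c (wedge (xs[i := a]))"
proof -
  have "gen (xs[i := c *s a]) - fscale c (gen (xs[i := a])) \<in> ext_null scale UNIV k"
    unfolding ext_null_def using assms by (intro free.span_base UnI1[OF UnI2]) (auto simp: tuples_def)
  then have "cls (gen (xs[i := c *s a]) - fscale c (gen (xs[i := a]))) = 0" by (simp only: cls_zero)
  then show ?thesis unfolding wedge_def by (simp add: lin_diff[OF lin_cls] lin_scale[OF lin_cls])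
qed

lemma wedge_repeated:
  assumes "length xs = k" "\<not> distinct xs"
  shows "wedge xs = 0"
proof -
  have "gen xs \<in> ext_null scale UNIV k"
    unfolding ext_null_def using assms by (intro free.span_base UnI2) (auto simp: tuples_def)
  then show ?thesis unfolding wedge_def by (simp only: cls_zero)
qed

lemma lin_wedge:
  assumes "length xs = k" "i < k"
  shows "Vector_Spaces.linear scale fscale (\<lambda>a. wedge (xs[i := a]))"
  unfolding Vector_Spaces.linear_iff
  using wedge_add[OF assms] wedge_scale[OF assms] vector_space_axioms vector_space_fscale by blast

lemma wedge_same:
  assumes "length xs = k" "i < k" "j < k" "i \<noteq> j"
  shows "wedge (xs[i := a, j := a]) = 0"
proof (rule wedge_repeated)
  show "\<not> distinct (xs[i := a, j := a])"
  proof
    assume "distinct (xs[i := a, j := a])"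
    then have "(xs[i := a, j := a]) ! i \<noteq> (xs[i := a, j := a]) ! j"
      using nth_eq_iff_index_eq[of "xs[i := a, j := a]" i j] assms by simp
    then show False using assms by (simp add: nth_list_update)
  qed
qed (use assms in simp)

lemma wedge_swap:
  assumes "length xs = k" "i < k" "j < k" "i \<noteq> j"
  shows "wedge (xs[i := a, j := b]) = - wedge (xs[i := b, j := a])"
proof -
  have j: "wedge (xs[i := c, j := a + b]) = wedge (xs[i := c, j := a]) + wedge (xs[i := c, j := b])" for c
    using wedge_add[of "xs[i := c]" j a b] assms by simp
  have i: "wedge (xs[i := a + b, j := c]) = wedge (xs[i := a, j := c]) + wedge (xs[i := b, j := c])" for c
    using wedge_add[of "xs[j := c]" i a b] assms by (simp add: list_update_swap[of i j])
  have "0 = wedge (xs[i := a + b, j := a + b])" using wedge_same[OF assms] by simp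
  also have "\<dots> = wedge (xs[i := a, j := b]) + wedge (xs[i := b, j := a])"
    unfolding j i using wedge_same[OF assms] by simp
  finally show ?thesis by (simp add: eq_neg_iff_add_eq_0)
qed

section \<open>The action on the exterior power\<close>

definition wedge_act :: "'b \<Rightarrow> 'b list \<Rightarrow> ('b list \<Rightarrow>\<^sub>0 'a)"
  where "wedge_act x xs = (\<Sum>i<length xs. wedge (xs[i := br x (xs ! i)]))"

lemma lin_ext_act: "Vector_Spaces.linear fscale fscale (ext_act br x)"
  unfolding ext_act_def by (rule lin_free_extend)

lemma cls_ext_act_gen: "cls (ext_act br x (gen xs)) = wedge_act x xs"
  unfolding ext_act_def free_extend_gen wedge_act_def wedge_def by (rule lin_sum[OF lin_cls])

lemma wedge_act_update:
  assumes "length xs = k" "i < k"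
  shows "wedge_act x (xs[i := c]) = wedge (xs[i := br x c])
    + (\<Sum>j\<in>{..<k} - {i}. wedge ((xs[j := br x (xs ! j)])[i := c]))"
proof -
  have "wedge_act x (xs[i := c]) = (\<Sum>j<k. wedge ((xs[i := c])[j := br x ((xs[i := c]) ! j)]))"
    unfolding wedge_act_def using assms by simp
  also have "\<dots> = wedge (xs[i := br x c])
    + (\<Sum>j\<in>{..<k} - {i}. wedge ((xs[i := c])[j := br x ((xs[i := c]) ! j)]))"
    using assms by (subst sum.remove[of _ i]) auto
  also have "(\<Sum>j\<in>{..<k} - {i}. wedge ((xs[i := c])[j := br x ((xs[i := c]) ! j)]))
    = (\<Sum>j\<in>{..<k} - {i}. wedge ((xs[j := br x (xs ! j)])[i := c]))"
    by (intro sum.cong refl) (auto simp: list_update_swap)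
  finally show ?thesis .
qed

lemma lin_wedge_act:
  assumes "length xs = k" "i < k"
  shows "Vector_Spaces.linear scale fscale (\<lambda>c. wedge_act x (xs[i := c]))"
  unfolding wedge_act_update[OF assms] Vector_Spaces.linear_iff
proof (intro conjI allI vector_space_axioms vector_space_fscale)
  have l: "Vector_Spaces.linear scale fscale (\<lambda>c. wedge ((xs[j := br x (xs ! j)])[i := c]))" for j
    using assms by (intro lin_wedge) auto
  note l0 = lin_wedge[OF assms]
  fix a b c
  show "wedge (xs[i := br x (a + b)]) + (\<Sum>j\<in>{..<k} - {i}. wedge ((xs[j := br x (xs ! j)])[i := a + b]))
    = wedge (xs[i := br x a]) + (\<Sum>j\<in>{..<k} - {i}. wedge ((xs[j := br x (xs ! j)])[i := a]))
    + (wedge (xs[i := br x b]) + (\<Sum>j\<in>{..<k} - {i}. wedge ((xs[j := br x (xs ! j)])[i := b])))"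
    by (simp add: br_add_right lin_add[OF l0] lin_add[OF l] sum.distrib)
  show "wedge (xs[i := br x (c *s a)]) + (\<Sum>j\<in>{..<k} - {i}. wedge ((xs[j := br x (xs ! j)])[i := c *s a]))
    = fscale c (wedge (xs[i := br x a]) + (\<Sum>j\<in>{..<k} - {i}. wedge ((xs[j := br x (xs ! j)])[i := a])))"
    by (simp add: br_scale_right lin_scale[OF l0] lin_scale[OF l] free.scale_right_distrib free.scale_sum_right)
qed

text \<open>If \<open>xs ! i = xs ! j\<close>, all terms but two have a repeated entry, and
  these two differ by a swap.\<close>

lemma wedge_act_repeated:
  assumes "length xs = k" "\<not> distinct xs"
  shows "wedge_act x xs = 0"
proof -
  obtain i j where ij: "i < k" "j < k" "i \<noteq> j" "xs ! i = xs ! j"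
    using assms unfolding distinct_conv_nth by auto
  define a where "a = xs ! i"
  have up: "xs[i := a] = xs" "xs[j := a] = xs"
    unfolding a_def by (rule list_update_id, unfold ij(4), rule list_update_id)
  have "wedge_act x xs = (\<Sum>l<k. wedge (xs[l := br x (xs ! l)]))" unfolding wedge_act_def using assms by simp
  also have "\<dots> = (\<Sum>l\<in>{i, j}. wedge (xs[l := br x (xs ! l)]))"
  proof (rule sum.mono_neutral_right)
    show "\<forall>l\<in>{..<k} - {i, j}. wedge (xs[l := br x (xs ! l)]) = 0"
    proof
      fix l assume l: "l \<in> {..<k} - {i, j}"
      show "wedge (xs[l := br x (xs ! l)]) = 0"
      proof (rule wedge_repeated)
        show "\<not> distinct (xs[l := br x (xs ! l)])"
        proof
          assume "distinct (xs[l := br x (xs ! l)])"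
          then have "(xs[l := br x (xs ! l)]) ! i \<noteq> (xs[l := br x (xs ! l)]) ! j"
            using nth_eq_iff_index_eq[of "xs[l := br x (xs ! l)]" i j] assms(1) ij by simp
          then show False using ij l by simp
        qed
      qed (use assms in simp)
    qed
  qed (use ij in auto)
  also have "\<dots> = wedge (xs[i := br x a]) + wedge (xs[j := br x a])"
    using ij by (simp add: a_def)
  also have "wedge (xs[i := br x a]) = wedge (xs[i := br x a, j := a])"
    by (metis up(2) list_update_swap ij(3))
  also have "wedge (xs[j := br x a]) = wedge (xs[i := a, j := br x a])" by (simp add: up)
  also have "wedge (xs[i := br x a, j := a]) = - wedge (xs[i := a, j := br x a])"
    by (rule wedge_swap[OF assms(1) ij(1,2,3)])
  finally show ?thesis by simp
qed

lemma ext_act_null: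
  assumes "p \<in> ext_null scale UNIV k"
  shows "cls (ext_act br x p) = 0"
proof -
  have L: "Vector_Spaces.linear fscale fscale (\<lambda>p. cls (ext_act br x p))"
    by (rule lin_compose[OF lin_ext_act lin_cls])
  have Z: "Vector_Spaces.linear fscale fscale (\<lambda>_ :: 'b list \<Rightarrow>\<^sub>0 'a. 0 :: 'b list \<Rightarrow>\<^sub>0 'a)"
    by (simp add: Vector_Spaces.linear_iff vector_space_fscale)
  show ?thesis
  proof (rule lin_eq_on_span[OF L Z assms[unfolded ext_null_span]])
    fix q assume "q \<in> ext_rel UNIV"
    then show "cls (ext_act br x q) = 0"
    proof (cases rule: ext_rel_cases)
      case (add xs i a b)
      then show ?thesis by (simp add: lin_diff[OF L] cls_ext_act_gen lin_add[OF lin_wedge_act])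
    next
      case (scl xs i c a)
      then show ?thesis by (simp add: lin_diff[OF L] lin_scale[OF L] cls_ext_act_gen lin_scale[OF lin_wedge_act])
    next
      case (rep xs)
      then show ?thesis by (simp add: cls_ext_act_gen wedge_act_repeated)
    qed
  qed
qed

text \<open>Relations hold only between lists of length \<open>k\<close>. Killing all other
  lists makes the action linear in \<open>x\<close> on the whole type.\<close>

definition trunc :: "('b list \<Rightarrow>\<^sub>0 'a) \<Rightarrow> ('b list \<Rightarrow>\<^sub>0 'a)"
  where "trunc = free_extend (\<lambda>xs. if length xs = k then gen xs else 0)"

definition R :: "'b \<Rightarrow> ('b list \<Rightarrow>\<^sub>0 'a) \<Rightarrow> ('b list \<Rightarrow>\<^sub>0 'a)"
  where "R x m = cls (ext_act br x (trunc m))"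

lemma lin_R: "Vector_Spaces.linear fscale fscale (R x)"
  unfolding R_def trunc_def by (rule lin_compose[OF lin_compose[OF lin_free_extend lin_ext_act] lin_cls])

lemma trunc_id: "p \<in> ext_free UNIV k \<Longrightarrow> trunc p = p"
  unfolding ext_free_def trunc_def
proof (rule lin_eq_on_span[OF lin_free_extend])
  show "Vector_Spaces.linear fscale fscale (\<lambda>p. p :: 'b list \<Rightarrow>\<^sub>0 'a)"
    by (simp add: Vector_Spaces.linear_iff vector_space_fscale)
qed (auto simp: tuples_def free_extend_gen)

lemma ext_null_free: "ext_null scale W k \<subseteq> ext_free W k" if W: "subspace W" for W
  unfolding ext_null_span
proof (rule free.span_minimal)
  have g: "gen xs \<in> ext_free W k" if "xs \<in> tuples W k" for xs
    unfolding ext_free_def using that by (intro free.span_base) auto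
  have u: "xs[i := a] \<in> tuples W k" if "xs \<in> tuples W k" "a \<in> W" for xs i a
    using that set_update_subset_insert[of xs i a] unfolding tuples_def by auto
  show "ext_rel W \<subseteq> ext_free W k"
    using g u subspace_add[OF W] subspace_scale[OF W]
    by (auto simp: ext_rel_def ext_free_def intro!: free.span_diff free.span_scale)
qed (simp add: ext_free_def)

lemma R_cls:
  assumes "p \<in> ext_free UNIV k"
  shows "R x (cls p) = cls (ext_act br x p)"
proof -
  have n: "p - cls p \<in> ext_null scale UNIV k" by (rule cls_diff)
  then have "p - cls p \<in> ext_free UNIV k" using ext_null_free[OF subspace_UNIV] by blast
  then have "p - (p - cls p) \<in> ext_free UNIV k" using assms unfolding ext_free_def by (rule free.span_diff[rotated])
  then have "trunc (cls p) = cls p" using trunc_id by simp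
  moreover have "cls (ext_act br x (p - cls p)) = 0" by (rule ext_act_null[OF n])
  ultimately show ?thesis unfolding R_def by (simp add: lin_diff[OF lin_ext_act] lin_diff[OF lin_cls])
qed

lemma gen_free: "length xs = k \<Longrightarrow> gen xs \<in> ext_free UNIV k"
  unfolding ext_free_def tuples_def by (intro free.span_base) auto

lemma R_wedge: "length xs = k \<Longrightarrow> R x (wedge xs) = wedge_act x xs"
  unfolding wedge_def by (simp add: R_cls[OF gen_free] cls_ext_act_gen)

lemma R_gen: "R x (gen xs) = (if length xs = k then wedge_act x xs else 0)"
  unfolding R_def trunc_def free_extend_gen
  by (simp add: cls_ext_act_gen lin_zero[OF lin_cls] lin_zero[OF lin_ext_act])

lemma lin_R_left: "Vector_Spaces.linear scale fscale (\<lambda>x. R x m)"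
proof -
  have D: "wedge_act (x + y) xs = wedge_act x xs + wedge_act y xs" "wedge_act (c *s x) xs = fscale c (wedge_act x xs)"
    if "length xs = k" for x y c xs
    unfolding wedge_act_def using that
    by (simp_all add: br_add_left br_scale_left wedge_add wedge_scale sum.distrib free.scale_sum_right)
  have m: "m \<in> free.span (range gen)" by (simp add: span_gen)
  have l: "Vector_Spaces.linear fscale fscale (\<lambda>m. R x m + R y m)" for x y
    by (simp add: Vector_Spaces.linear_iff lin_add[OF lin_R] lin_scale[OF lin_R] vector_space_fscale
        free.scale_right_distrib)
  have l': "Vector_Spaces.linear fscale fscale (\<lambda>m. fscale c (R x m))" for x c
    by (simp add: Vector_Spaces.linear_iff lin_add[OF lin_R] lin_scale[OF lin_R] vector_space_fscale
        free.scale_right_distrib mult.commute)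
  have "R (x + y) m = R x m + R y m" for x y
    by (rule lin_eq_on_span[OF lin_R l m]) (auto simp: R_gen D)
  moreover have "R (c *s x) m = fscale c (R x m)" for x c
    by (rule lin_eq_on_span[OF lin_R l' m]) (auto simp: R_gen D)
  ultimately show ?thesis by (simp add: Vector_Spaces.linear_iff vector_space_axioms vector_space_fscale)
qed

lemma R_wedge_act:
  assumes xs: "length xs = k"
  shows "R x (wedge_act y xs) = (\<Sum>i<k. wedge (xs[i := br x (br y (xs ! i))]))
    + (\<Sum>i<k. \<Sum>j\<in>{..<k} - {i}. wedge (xs[i := br y (xs ! i), j := br x (xs ! j)]))"
proof -
  have "R x (wedge_act y xs) = (\<Sum>i<k. wedge_act x (xs[i := br y (xs ! i)]))"
    unfolding wedge_act_def[of y] lin_sum[OF lin_R] using xs by (intro sum.cong) (simp_all add: R_wedge)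
  also have "\<dots> = (\<Sum>i<k. wedge (xs[i := br x (br y (xs ! i))])
    + (\<Sum>j\<in>{..<k} - {i}. wedge (xs[i := br y (xs ! i), j := br x (xs ! j)])))"
  proof (rule sum.cong[OF refl])
    fix i assume "i \<in> {..<k}"
    then have "i < k" by simp
    have "(\<Sum>j\<in>{..<k} - {i}. wedge ((xs[j := br x (xs ! j)])[i := br y (xs ! i)]))
      = (\<Sum>j\<in>{..<k} - {i}. wedge (xs[i := br y (xs ! i), j := br x (xs ! j)]))"
      by (intro sum.cong refl) (auto simp: list_update_swap)
    then show "wedge_act x (xs[i := br y (xs ! i)]) = wedge (xs[i := br x (br y (xs ! i))])
      + (\<Sum>j\<in>{..<k} - {i}. wedge (xs[i := br y (xs ! i), j := br x (xs ! j)]))"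
      using wedge_act_update[OF xs \<open>i < k\<close>, of x "br y (xs ! i)"] by simp
  qed
  finally show ?thesis by (simp add: sum.distrib)
qed

lemma R_bracket: "R (br x y) m = R x (R y m) - R y (R x m)"
proof -
  have m: "m \<in> free.span (range gen)" by (simp add: span_gen)
  have l: "Vector_Spaces.linear fscale fscale (\<lambda>m. R x (R y m) - R y (R x m))"
    by (simp add: Vector_Spaces.linear_iff lin_add[OF lin_R] lin_scale[OF lin_R] vector_space_fscale
        free.scale_right_diff_distrib)
  show ?thesis
  proof (rule lin_eq_on_span[OF lin_R l m])
  fix p :: "'b list \<Rightarrow>\<^sub>0 'a" assume "p \<in> range gen"
  then obtain xs where p: "p = gen xs" by blast
  show "R (br x y) p = R x (R y p) - R y (R x p)"
  proof (cases "length xs = k")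
    case False
    then show ?thesis unfolding p R_gen by (simp add: lin_zero[OF lin_R])
  next
    case True
    have off: "(\<Sum>i<k. \<Sum>j\<in>{..<k} - {i}. wedge (xs[i := br y (xs ! i), j := br x (xs ! j)]))
      = (\<Sum>i<k. \<Sum>j\<in>{..<k} - {i}. wedge (xs[i := br x (xs ! i), j := br y (xs ! j)]))"
    proof -
      let ?g = "\<lambda>i j. wedge (xs[i := br y (xs ! i), j := br x (xs ! j)])"
      have "(\<Sum>i<k. \<Sum>j\<in>{..<k} - {i}. ?g i j) = (\<Sum>i<k. \<Sum>j<k. if i \<noteq> j then ?g i j else 0)"
        by (intro sum.cong refl sum.mono_neutral_cong_left) auto
      also have "\<dots> = (\<Sum>j<k. \<Sum>i<k. if i \<noteq> j then ?g i j else 0)" by (rule sum.swap)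
      also have "\<dots> = (\<Sum>j<k. \<Sum>i\<in>{..<k} - {j}. wedge (xs[j := br x (xs ! j), i := br y (xs ! i)]))"
        by (intro sum.cong refl sum.mono_neutral_cong_right) (auto simp: list_update_swap)
      finally show ?thesis .
    qed
    have "wedge (xs[i := br (br x y) (xs ! i)])
      = wedge (xs[i := br x (br y (xs ! i))]) - wedge (xs[i := br y (br x (xs ! i))])" if "i < k" for i
      unfolding br_br by (rule lin_diff[OF lin_wedge[OF True that]])
    then have "wedge_act (br x y) xs = (\<Sum>i<k. wedge (xs[i := br x (br y (xs ! i))]))
      - (\<Sum>i<k. wedge (xs[i := br y (br x (xs ! i))]))"
      unfolding wedge_act_def using True by (simp add: sum_subtractf)
    then show ?thesis unfolding p R_gen using True by (simp add: R_wedge_act off)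
  qed
  qed
qed

section \<open>Subspaces\<close>

text \<open>A linear projection of the algebra onto \<open>W\<close> maps relations to relations
  in \<open>W\<close> and fixes the products of elements of \<open>W\<close>.\<close>

lemma ext_null_subspace:
  assumes W: "subspace W" and p: "p \<in> ext_free W k"
  shows "p \<in> ext_null scale W k \<longleftrightarrow> cls p = 0"
proof
  have "ext_null scale W k \<subseteq> ext_null scale UNIV k"
    unfolding ext_null_def tuples_def by (intro free.span_mono) blast
  then show "cls p = 0" if "p \<in> ext_null scale W k" using that cls_zero by blast
next
  assume "cls p = 0"
  then have pN: "p \<in> ext_null scale UNIV k" by (simp only: cls_zero)
  obtain A where A: "A \<subseteq> W" "independent A" "W \<subseteq> span A" by (rule maximal_independent_subset)
  have sp: "span A = W" using A W by (simp add: span_subspace)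
  interpret vp: vector_space_pair scale scale by (intro vector_space_pair.intro vector_space_axioms)
  obtain g where g: "Vector_Spaces.linear scale scale g" "\<And>x. x \<in> A \<Longrightarrow> g x = x" "range g = span A"
    using vp.linear_independent_extend_subspace[OF A(2), of "\<lambda>x. x"] by auto
  have gW: "g x \<in> W" for x using g(3) sp by blast
  have gid: "g x = x" if "x \<in> W" for x
    by (rule lin_eq_on_span[OF g(1) _, where A = A])
      (use g(2) that sp vector_space_axioms in \<open>auto simp: Vector_Spaces.linear_iff\<close>)
  define G where "G = free_extend (\<lambda>xs. gen (map g xs) :: 'b list \<Rightarrow>\<^sub>0 'a)"
  have G: "Vector_Spaces.linear fscale fscale G" unfolding G_def by (rule lin_free_extend)
  have Gg: "G (gen xs) = gen (map g xs)" for xs unfolding G_def by (rule free_extend_gen)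
  have "G p = p"
  proof (rule lin_eq_on_span[OF G _ p[unfolded ext_free_def]])
    show "Vector_Spaces.linear fscale fscale (\<lambda>p. p :: 'b list \<Rightarrow>\<^sub>0 'a)"
      by (simp add: Vector_Spaces.linear_iff vector_space_fscale)
    fix q :: "'b list \<Rightarrow>\<^sub>0 'a" assume "q \<in> gen ` tuples W k"
    then obtain xs where "q = gen xs" "set xs \<subseteq> W" unfolding tuples_def by blast
    then show "G q = q" using gid Gg by (simp add: map_idI subset_iff)
  qed
  moreover have "G q \<in> ext_null scale W k" if "q \<in> ext_null scale UNIV k" for q
  proof -
    have sub: "free.subspace {q. G q \<in> ext_null scale W k}"
      by (rule lin_preimage[OF G]) (simp add: ext_null_def)
    have mt: "map g xs \<in> tuples W k" if "length xs = k" for xs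
      using that gW unfolding tuples_def by auto
    have "ext_null scale UNIV k \<subseteq> {q. G q \<in> ext_null scale W k}"
      unfolding ext_null_span[of UNIV]
    proof (rule free.span_minimal[OF _ sub], rule subsetI)
      fix q assume "q \<in> ext_rel UNIV"
      then show "q \<in> {q. G q \<in> ext_null scale W k}"
      proof (cases rule: ext_rel_cases)
        case (add xs i a b)
        have "G q = gen ((map g xs)[i := g a + g b]) - gen ((map g xs)[i := g a]) - gen ((map g xs)[i := g b])"
          unfolding add(1) by (simp add: lin_diff[OF G] Gg map_update lin_add[OF g(1)])
        also have "\<dots> \<in> ext_null scale W k"
          unfolding ext_null_def using mt[OF add(2)] add(3) gW by (intro free.span_base UnI1) blast
        finally show ?thesis by simp
      next
        case (scl xs i c a)
        have "G q = gen ((map g xs)[i := c *s g a]) - fscale c (gen ((map g xs)[i := g a]))"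
          unfolding scl(1) by (simp add: lin_diff[OF G] lin_scale[OF G] Gg map_update lin_scale[OF g(1)])
        also have "\<dots> \<in> ext_null scale W k"
          unfolding ext_null_def using mt[OF scl(2)] scl(3) gW by (intro free.span_base UnI1[OF UnI2]) blast
        finally show ?thesis by simp
      next
        case (rep xs)
        have "\<not> distinct (map g xs)" using rep(3) by (simp add: distinct_map)
        then have "gen (map g xs) \<in> ext_null scale W k"
          unfolding ext_null_def using mt[OF rep(2)] by (intro free.span_base UnI2) blast
        then show ?thesis unfolding rep(1) by (simp add: Gg)
      qed
    qed
    then show ?thesis using that by blast
  qed
  ultimately show "p \<in> ext_null scale W k" using pN by metis
qed

lemma ext_act_free:
  fixes p :: "'b list \<Rightarrow>\<^sub>0 'a"
  assumes W: "\<And>v. v \<in> W \<Longrightarrow> br x v \<in> W" and p: "p \<in> ext_free W k"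
  shows "ext_act br x p \<in> ext_free W k"
proof -
  let ?F = "free.span (gen ` tuples W k) :: ('b list \<Rightarrow>\<^sub>0 'a) set"
  have "?F \<subseteq> {p. ext_act br x p \<in> ?F}"
  proof (rule free.span_minimal[OF subsetI lin_preimage[OF lin_ext_act free.subspace_span]])
    fix q :: "'b list \<Rightarrow>\<^sub>0 'a" assume "q \<in> gen ` tuples W k"
    then obtain xs where xs: "q = gen xs" "length xs = k" "set xs \<subseteq> W" unfolding tuples_def by blast
    have "xs[i := br x (xs ! i)] \<in> tuples W k" if "i < k" for i
    proof -
      have "br x (xs ! i) \<in> W" using W[of "xs ! i"] that xs(2,3) nth_mem[of i xs] by blast
      then have "set (xs[i := br x (xs ! i)]) \<subseteq> W"
        using set_update_subset_insert[of xs i "br x (xs ! i)"] xs(3) by blast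
      then show ?thesis using xs(2) unfolding tuples_def by simp
    qed
    then show "q \<in> {p. ext_act br x p \<in> ?F}"
      unfolding xs(1) ext_act_def mem_Collect_eq free_extend_gen
      using xs(2) by (intro free.span_sum free.span_base) auto
  qed
  then show ?thesis using p unfolding ext_free_def by blast
qed

lemma ext_eigenvalues_wedge:
  assumes W: "subspace W" and B: "\<And>b v. b \<in> B \<Longrightarrow> v \<in> W \<Longrightarrow> br b v \<in> W"
    and d: "\<And>b v. b \<in> B \<Longrightarrow> v \<in> W \<Longrightarrow> br (d b) v \<in> W"
  shows "ext_eigenvalues B d W k =
    {\<mu>. \<exists>m\<in>free.span (wedge ` tuples W k). m \<noteq> 0 \<and> casimir B d R m = fscale \<mu> m}"
proof -
  have img: "free.span (wedge ` tuples W k) = cls ` ext_free W k"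
  proof -
    interpret c: Vector_Spaces.linear fscale fscale cls by (rule lin_cls)
    show ?thesis unfolding ext_free_def c.span_image[symmetric] wedge_def by (simp add: image_image)
  qed
  have WU: "ext_free W k \<subseteq> ext_free UNIV k"
    unfolding ext_free_def tuples_def by (intro free.span_mono) blast
  have key: "p \<notin> ext_null scale W k \<and> casimir B d (ext_act br) p - fscale \<mu> p \<in> ext_null scale W k
      \<longleftrightarrow> cls p \<noteq> 0 \<and> casimir B d R (cls p) = fscale \<mu> (cls p)" if p: "p \<in> ext_free W k" for p \<mu>
  proof -
    have s: "ext_act br (d b) (ext_act br b p) \<in> ext_free W k" "ext_act br b p \<in> ext_free W k" if "b \<in> B" for b
      using ext_act_free[OF d[OF that]] ext_act_free[OF B[OF that] p] by blast+
    have cp: "casimir B d (ext_act br) p - fscale \<mu> p \<in> ext_free W k"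
      using s p unfolding casimir_def ext_free_def
      by (intro free.span_diff free.span_sum free.span_scale) auto
    have "cls (casimir B d (ext_act br) p) = casimir B d R (cls p)"
      unfolding casimir_def lin_sum[OF lin_cls]
    proof (rule sum.cong[OF refl])
      fix b assume b: "b \<in> B"
      have u: "p \<in> ext_free UNIV k" "ext_act br b p \<in> ext_free UNIV k" using s(2)[OF b] p WU by blast+
      show "cls (ext_act br (d b) (ext_act br b p)) = R (d b) (R b (cls p))"
        unfolding R_cls[OF u(1)] R_cls[OF u(2)] ..
    qed
    then have "cls (casimir B d (ext_act br) p - fscale \<mu> p) = casimir B d R (cls p) - fscale \<mu> (cls p)"
      by (simp add: lin_diff[OF lin_cls] lin_scale[OF lin_cls])
    then show ?thesis using ext_null_subspace[OF W p] ext_null_subspace[OF W cp] by simp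
  qed
  show ?thesis unfolding ext_eigenvalues_def img using key by blast
qed

section \<open>Nonvanishing of wedge products\<close>

text \<open>The determinant of the matrix \<open>\<phi> i (ys ! j)\<close>, as a function of the
  list \<open>ys\<close>.\<close>

definition leibniz :: "(nat \<Rightarrow> 'b \<Rightarrow> 'a) \<Rightarrow> 'b list \<Rightarrow> 'a"
  where "leibniz \<phi> ys = (\<Sum>p | p permutes {..<k}. of_int (sign p) * (\<Prod>i<k. \<phi> i (ys ! p i)))"

text \<open>Composing permutations with the transposition of two equal entries changes the sign
  of every summand.\<close>

lemma leibniz_repeated:
  assumes "length ys = k" "\<not> distinct ys"
  shows "leibniz \<phi> ys = 0"
proof -
  obtain a b where ab: "a < k" "b < k" "a \<noteq> b" "ys ! a = ys ! b"
    using assms unfolding distinct_conv_nth by auto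
  let ?\<tau> = "transpose a b"
  have \<tau>: "?\<tau> permutes {..<k}" using ab by (intro permutes_swap_id) auto
  have nth: "ys ! ?\<tau> i = ys ! i" for i using ab by (auto simp: transpose_def)
  have "leibniz \<phi> ys = (\<Sum>p | p permutes {..<k}. of_int (sign (?\<tau> \<circ> p)) * (\<Prod>i<k. \<phi> i (ys ! (?\<tau> \<circ> p) i)))"
    unfolding leibniz_def by (rule setum_permutations_compose_left[OF \<tau>])
  also have "\<dots> = (\<Sum>p | p permutes {..<k}. - (of_int (sign p) * (\<Prod>i<k. \<phi> i (ys ! p i))))"
  proof (rule sum.cong[OF refl])
    fix p assume "p \<in> {p. p permutes {..<k}}"
    then have p: "p permutes {..<k}" by simp
    have "sign (?\<tau> \<circ> p) = sign ?\<tau> * sign p"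
      using p \<tau> permutation_permutes by (intro sign_compose) blast+
    then have "sign (?\<tau> \<circ> p) = - sign p" using ab(3) by (simp add: sign_swap_id)
    then show "of_int (sign (?\<tau> \<circ> p)) * (\<Prod>i<k. \<phi> i (ys ! (?\<tau> \<circ> p) i))
      = - (of_int (sign p) * (\<Prod>i<k. \<phi> i (ys ! p i)))" by (simp add: nth)
  qed
  also have "\<dots> = - leibniz \<phi> ys" unfolding leibniz_def by (rule sum_negf)
  finally show ?thesis by simp
qed

lemma leibniz_update:
  assumes "length ys = k" "j < k"
  shows "leibniz \<phi> (ys[j := c]) = (\<Sum>p | p permutes {..<k}. of_int (sign p) *
    (\<phi> (inv p j) c * (\<Prod>i\<in>{..<k} - {inv p j}. \<phi> i (ys ! p i))))"
  unfolding leibniz_def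
proof (rule sum.cong[OF refl])
  fix p assume "p \<in> {p. p permutes {..<k}}"
  then have p: "p permutes {..<k}" by simp
  let ?i = "inv p j"
  have i: "?i < k" "p ?i = j" using permutes_in_image[OF permutes_inv[OF p], of j] permutes_inverses(1)[OF p] assms by auto
  have "j \<noteq> p i" if "i \<noteq> ?i" for i using that permutes_inverses(2)[OF p] by metis
  then have "(\<Prod>i\<in>{..<k} - {?i}. \<phi> i (ys[j := c] ! p i)) = (\<Prod>i\<in>{..<k} - {?i}. \<phi> i (ys ! p i))"
    by (intro prod.cong refl) auto
  then have "(\<Prod>i<k. \<phi> i (ys[j := c] ! p i)) = \<phi> ?i c * (\<Prod>i\<in>{..<k} - {?i}. \<phi> i (ys ! p i))"
    using i assms by (subst prod.remove[of _ ?i]) auto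
  then show "of_int (sign p) * (\<Prod>i<k. \<phi> i (ys[j := c] ! p i))
    = of_int (sign p) * (\<phi> ?i c * (\<Prod>i\<in>{..<k} - {?i}. \<phi> i (ys ! p i)))" by simp
qed

text \<open>With functionals dual to the list, the determinant vanishes on all relations but is
  1 on the list.\<close>

lemma wedge_nonzero:
  assumes xs: "length xs = k" "distinct xs" "independent (set xs)"
  shows "wedge xs \<noteq> 0"
proof
  assume "wedge xs = 0"
  then have N: "gen xs \<in> ext_null scale UNIV k" unfolding wedge_def by (simp only: cls_zero)
  interpret vp: vector_space_pair scale "(*) :: 'a \<Rightarrow> 'a \<Rightarrow> 'a"
    by (intro vector_space_pair.intro vector_space_axioms vector_space_field)
  have "\<exists>g. Vector_Spaces.linear scale (*) g \<and> (\<forall>x\<in>set xs. g x = (if x = xs ! i then 1 else 0))" for i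
    by (rule vp.linear_independent_extend[OF xs(3)])
  then obtain \<phi> where \<phi>: "\<And>i. Vector_Spaces.linear scale (*) (\<phi> i)"
    "\<And>i x. x \<in> set xs \<Longrightarrow> \<phi> i x = (if x = xs ! i then 1 else 0)" by metis
  have \<phi>d: "\<phi> i (xs ! j) = (if i = j then 1 else 0)" if "i < k" "j < k" for i j
    using \<phi>(2)[of "xs ! j" i] that xs(1,2) by (auto simp: nth_eq_iff_index_eq)
  define \<psi> :: "('b list \<Rightarrow>\<^sub>0 'a) \<Rightarrow> (unit \<Rightarrow>\<^sub>0 'a)"
    where "\<psi> = free_extend (\<lambda>ys. fscale (leibniz \<phi> ys) (gen ()))"
  have \<psi>: "Vector_Spaces.linear fscale fscale \<psi>" unfolding \<psi>_def by (rule lin_free_extend)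
  have \<psi>g: "\<psi> (gen ys) = fscale (leibniz \<phi> ys) (gen ())" for ys unfolding \<psi>_def by (rule free_extend_gen)
  have Z: "Vector_Spaces.linear fscale fscale (\<lambda>_ :: 'b list \<Rightarrow>\<^sub>0 'a. 0 :: unit \<Rightarrow>\<^sub>0 'a)"
    by (simp add: Vector_Spaces.linear_iff vector_space_fscale)
  have "\<psi> (gen xs) = 0"
  proof (rule lin_eq_on_span[OF \<psi> Z N[unfolded ext_null_span]])
    fix q assume "q \<in> ext_rel UNIV"
    then show "\<psi> q = 0"
    proof (cases rule: ext_rel_cases)
      case (add ys i a b)
      have "leibniz \<phi> (ys[i := a + b]) = leibniz \<phi> (ys[i := a]) + leibniz \<phi> (ys[i := b])"
        unfolding leibniz_update[OF add(2,3)]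
        by (simp add: lin_add[OF \<phi>(1)] distrib_left distrib_right sum.distrib)
      then show ?thesis unfolding add(1) by (simp add: lin_diff[OF \<psi>] \<psi>g free.scale_left_distrib)
    next
      case (scl ys i c a)
      have "leibniz \<phi> (ys[i := c *s a]) = c * leibniz \<phi> (ys[i := a])"
        unfolding leibniz_update[OF scl(2,3)]
        by (simp only: lin_scale[OF \<phi>(1)] sum_distrib_left mult.assoc mult.left_commute[of _ c])
      then show ?thesis unfolding scl(1) by (simp only: lin_diff[OF \<psi>] lin_scale[OF \<psi>] \<psi>g free.scale_scale diff_self)
    next
      case (rep ys)
      then show ?thesis by (simp add: \<psi>g leibniz_repeated)
    qed
  qed
  moreover have "gen () \<noteq> (0 :: unit \<Rightarrow>\<^sub>0 'a)" by (metis lookup_single_eq lookup_zero one_neq_zero)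
  ultimately have "leibniz \<phi> xs = 0" unfolding \<psi>g free.scale_eq_0_iff by blast
  moreover have "leibniz \<phi> xs = 1"
  proof -
    have "leibniz \<phi> xs = (\<Sum>p | p permutes {..<k}. if p = id then 1 else 0)"
      unfolding leibniz_def
    proof (rule sum.cong[OF refl])
      fix p assume "p \<in> {p. p permutes {..<k}}"
      then have p: "p permutes {..<k}" by simp
      have pk: "p i < k" if "i < k" for i using permutes_in_image[OF p, of i] that by simp
      show "of_int (sign p) * (\<Prod>i<k. \<phi> i (xs ! p i)) = (if p = id then 1 else 0)"
      proof (cases "p = id")
        case True
        then show ?thesis by (simp add: \<phi>d)
      next
        case False
        then obtain i where i: "p i \<noteq> i" by fastforce
        then have "i < k" using permutes_not_in[OF p, of i] by auto
        then have "\<phi> i (xs ! p i) = 0" using \<phi>d pk i by simp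
        then have "(\<Prod>i<k. \<phi> i (xs ! p i)) = 0" using \<open>i < k\<close> by (intro prod_zero) auto
        then show ?thesis using False by simp
      qed
    qed
    also have "\<dots> = 1" using finite_permutations[of "{..<k}"] permutes_id[of "{..<k}"]
      by (simp add: sum.delta)
    finally show ?thesis .
  qed
  ultimately show False by simp
qed

lemma wedge_span:
  assumes "length xs = k" "set xs \<subseteq> span E"
  shows "wedge xs \<in> free.span (wedge ` tuples E k)"
proof -
  have "j \<le> k \<Longrightarrow> length xs = k \<Longrightarrow> (\<And>i. i < j \<Longrightarrow> xs ! i \<in> span E) \<Longrightarrow>
    (\<And>i. j \<le> i \<Longrightarrow> i < k \<Longrightarrow> xs ! i \<in> E) \<Longrightarrow> wedge xs \<in> free.span (wedge ` tuples E k)" for j xs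
  proof (induction j arbitrary: xs)
    case 0
    then have "xs \<in> tuples E k" unfolding tuples_def by (auto simp: in_set_conv_nth)
    then show ?case by (intro free.span_base) auto
  next
    case (Suc j)
    have "span E \<subseteq> {a. wedge (xs[j := a]) \<in> free.span (wedge ` tuples E k)}"
    proof (rule span_minimal)
      show "subspace {a. wedge (xs[j := a]) \<in> free.span (wedge ` tuples E k)}"
        using Suc.prems by (intro lin_preimage[OF lin_wedge free.subspace_span]) auto
      show "E \<subseteq> {a. wedge (xs[j := a]) \<in> free.span (wedge ` tuples E k)}"
      proof
        fix a assume a: "a \<in> E"
        have "wedge (xs[j := a]) \<in> free.span (wedge ` tuples E k)"
        proof (rule Suc.IH)
          show "(xs[j := a]) ! i \<in> E" if "j \<le> i" "i < k" for i
            using that a Suc.prems(2,4) by (cases "i = j") auto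
        qed (use Suc.prems in auto)
        then show "a \<in> {a. wedge (xs[j := a]) \<in> free.span (wedge ` tuples E k)}" by simp
      qed
    qed
    moreover have "xs ! j \<in> span E" using Suc.prems by auto
    ultimately have "wedge (xs[j := xs ! j]) \<in> free.span (wedge ` tuples E k)" by blast
    then show ?case by simp
  qed
  from this[of k xs] show ?thesis using assms by (auto simp: subset_iff in_set_conv_nth)
qed

end

section \<open>Weights of the exterior power\<close>

locale graded_power = graded_cartan + exterior_power
begin

lemma rep_on_R: "rep_on fscale R"
  unfolding rep_on_def using lin_R lin_R_left R_bracket by blast

interpretation M: operator_space "fscale :: 'a \<Rightarrow> ('b list \<Rightarrow>\<^sub>0 'a) \<Rightarrow> _"
  by (intro operator_space.intro free.vector_space_axioms)

lemma killing_fe: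
  assumes "\<gamma> \<in> \<Delta>" "\<delta> \<in> \<Delta>"
  shows "killing (f \<gamma>) (e \<delta>) = (if \<gamma> = \<delta> then 1 else 0)"
proof (cases "\<gamma> = \<delta>")
  case True
  then show ?thesis using sl2_pairD(5)[OF ef[OF assms(1)]] killing_sym by simp
next
  case False
  then have "- \<gamma> + \<delta> \<noteq> 0" by (metis add.inverse_inverse add_eq_0_iff)
  then show ?thesis
    using rs_orthogonal[OF dual_uminus[OF root_dual[OF assms(1)]] root_dual[OF assms(2)]
        sl2_pairD(4)[OF ef[OF assms(1)]] sl2_pairD(3)[OF ef[OF assms(2)]]] False by simp
qed

lemma e_inj: "inj_on e \<Delta>"
  by (rule inj_onI) (metis killing_fe zero_neq_one)

lemma e_independent:
  assumes "I \<subseteq> \<Delta>"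
  shows "independent (e ` I)" "card (e ` I) = card I"
proof -
  have inj: "inj_on e I" using e_inj assms by (rule inj_on_subset)
  show "card (e ` I) = card I" by (rule card_image[OF inj])
  have fin: "finite I" using assms finite_roots by (rule finite_subset)
  show "independent (e ` I)"
  proof (rule independent_if_scalars_zero)
    show "finite (e ` I)" using fin by simp
    fix u x assume s: "(\<Sum>x\<in>e ` I. u x *s x) = 0" and "x \<in> e ` I"
    then obtain \<gamma> where g: "\<gamma> \<in> I" "x = e \<gamma>" by blast
    have "0 = killing (f \<gamma>) (\<Sum>\<delta>\<in>I. u (e \<delta>) *s e \<delta>)" using s by (simp add: sum.reindex[OF inj])
    also have "\<dots> = (\<Sum>\<delta>\<in>I. if \<gamma> = \<delta> then u (e \<delta>) else 0)"
      unfolding killing_sum killing_scale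
      using killing_fe[of \<gamma>] g(1) assms by (intro sum.cong) (auto simp: subset_iff)
    also have "\<dots> = u x" using g fin by simp
    finally show "u x = 0" by simp
  qed
qed

lemma span_e: "span (e ` \<Delta>1) = V"
proof
  show "span (e ` \<Delta>1) \<subseteq> V" using e_V subspace_V by (intro span_minimal) auto
  show "V \<subseteq> span (e ` \<Delta>1)"
  proof
    fix x assume "x \<in> V"
    then have "x = (\<Sum>\<gamma>\<in>\<Delta>1. killing (f \<gamma>) x *s e \<gamma>)" by (rule V_expansion)
    also have "\<dots> \<in> span (e ` \<Delta>1)" by (intro span_sum span_scale span_base) auto
    finally show "x \<in> span (e ` \<Delta>1)" .
  qed
qed

lemma dim_V: "dim V = card \<Delta>1"
  using dim_span_eq_card_independent[OF e_independent(1)[OF \<Delta>1_roots]] e_independent(2)[OF \<Delta>1_roots]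
  by (simp add: span_e)

text \<open>\<open>wedge_V\<close> is the exterior power of \<open>V\<close>, and
  \<open>\<Lambda>\<close> is its set of weights.\<close>

definition wedge_V where "wedge_V = free.span (wedge ` tuples V k)"
definition index_sets where "index_sets = {I. I \<subseteq> \<Delta>1 \<and> card I = k}"
definition \<Lambda> where "\<Lambda> = (\<lambda>I. \<Sum>\<gamma>\<in>I. \<gamma>) ` index_sets"
definition wt_space where "wt_space \<nu> = {m \<in> wedge_V. \<forall>h\<in>t. R h m = fscale (\<nu> h) m}"

lemma finite_index_sets: "finite index_sets" and finite_\<Lambda>: "finite \<Lambda>"
  unfolding \<Lambda>_def index_sets_def using finite_\<Delta>1 by auto

lemma \<Lambda>_dual: "\<nu> \<in> \<Lambda> \<Longrightarrow> \<nu> \<in> t_dual"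
  unfolding \<Lambda>_def index_sets_def using \<Delta>1_roots root_dual by (auto intro!: dual_sum)

lemma sum_apply: "finite I \<Longrightarrow> (\<Sum>\<gamma>\<in>I. \<gamma>) h = (\<Sum>\<gamma>\<in>I. \<gamma> h)"
  by (induction I rule: finite_induct) auto

lemma wedge_V_stable:
  assumes x: "x \<in> G0" and m: "m \<in> wedge_V"
  shows "R x m \<in> wedge_V"
proof -
  have "wedge_V \<subseteq> {m. R x m \<in> wedge_V}"
    unfolding wedge_V_def
  proof (rule free.span_minimal[OF subsetI lin_preimage[OF lin_R free.subspace_span]])
    fix q assume "q \<in> wedge ` tuples V k"
    then obtain xs where xs: "q = wedge xs" "length xs = k" "set xs \<subseteq> V" unfolding tuples_def by blast
    have "xs[i := br x (xs ! i)] \<in> tuples V k" if "i < k" for i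
    proof -
      have "br x (xs ! i) \<in> V" using G0_br_V[OF x, of "xs ! i"] that xs(2,3) nth_mem[of i xs] by blast
      then have "set (xs[i := br x (xs ! i)]) \<subseteq> V"
        using set_update_subset_insert[of xs i "br x (xs ! i)"] xs(3) by blast
      then show ?thesis using xs(2) unfolding tuples_def by simp
    qed
    then show "q \<in> {m. R x m \<in> free.span (wedge ` tuples V k)}"
      unfolding xs(1) mem_Collect_eq R_wedge[OF xs(2)] wedge_act_def
      using xs(2) by (intro free.span_sum free.span_base) auto
  qed
  then show ?thesis using m by blast
qed

lemma cas_wedge_V: "m \<in> wedge_V \<Longrightarrow> cas R m \<in> wedge_V"
  unfolding casimir_def using B wedge_V_stable
  by (auto simp: wedge_V_def subset_iff intro!: free.span_sum)

lemma subspace_wt_space: "free.subspace (wt_space \<nu>)"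
proof -
  have "free.subspace {m. R h m - fscale (\<nu> h) m \<in> {0}}" for h
    by (rule lin_preimage[OF M.lin_sub_scale[OF lin_R]]) simp
  then have s: "free.subspace {m. R h m = fscale (\<nu> h) m}" for h by simp
  have "free.subspace wedge_V" unfolding wedge_V_def by (rule free.subspace_span)
  then show ?thesis using s unfolding wt_space_def free.subspace_def by auto
qed

lemma wedge_root_vectors_weight:
  assumes xs: "length \<gamma>s = k" "distinct \<gamma>s" "set \<gamma>s \<subseteq> \<Delta>1"
  shows "wedge (map e \<gamma>s) \<in> wt_space (\<Sum>\<gamma>\<in>set \<gamma>s. \<gamma>)" "set \<gamma>s \<in> index_sets" "wedge (map e \<gamma>s) \<noteq> 0"
proof -
  show "set \<gamma>s \<in> index_sets" unfolding index_sets_def using xs distinct_card by auto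
  have tup: "map e \<gamma>s \<in> tuples V k" using xs e_V unfolding tuples_def by auto
  have "R h (wedge (map e \<gamma>s)) = fscale ((\<Sum>\<gamma>\<in>set \<gamma>s. \<gamma>) h) (wedge (map e \<gamma>s))" if h: "h \<in> t" for h
  proof -
    have "R h (wedge (map e \<gamma>s)) = (\<Sum>i<k. wedge ((map e \<gamma>s)[i := br h (e (\<gamma>s ! i))]))"
      using xs(1) by (simp add: R_wedge wedge_act_def)
    also have "\<dots> = (\<Sum>i<k. fscale ((\<gamma>s ! i) h) (wedge (map e \<gamma>s)))"
    proof (rule sum.cong[OF refl])
      fix i assume i: "i \<in> {..<k}"
      then have "\<gamma>s ! i \<in> set \<gamma>s" using xs(1) by simp
      then have g: "\<gamma>s ! i \<in> \<Delta>" using xs(3) \<Delta>1_roots by blast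
      have u: "(map e \<gamma>s)[i := e (\<gamma>s ! i)] = map e \<gamma>s"
        using i xs(1) by (metis list_update_id nth_map lessThan_iff)
      show "wedge ((map e \<gamma>s)[i := br h (e (\<gamma>s ! i))]) = fscale ((\<gamma>s ! i) h) (wedge (map e \<gamma>s))"
        unfolding rsD[OF sl2_pairD(3)[OF ef[OF g]] h]
        using wedge_scale[of "map e \<gamma>s" i "(\<gamma>s ! i) h" "e (\<gamma>s ! i)"] i xs(1) u by simp
    qed
    also have "\<dots> = fscale (\<Sum>i<k. (\<gamma>s ! i) h) (wedge (map e \<gamma>s))" by (simp add: free.scale_sum_left)
    also have "(\<Sum>i<k. (\<gamma>s ! i) h) = (\<Sum>\<gamma>\<in>set \<gamma>s. \<gamma> h)"
      using bij_betw_nth[OF xs(2), of "{..<k}" "set \<gamma>s"] xs(1)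
      by (intro sum.reindex_bij_betw) auto
    finally show ?thesis by (simp add: sum_apply)
  qed
  then show "wedge (map e \<gamma>s) \<in> wt_space (\<Sum>\<gamma>\<in>set \<gamma>s. \<gamma>)"
    unfolding wt_space_def wedge_V_def using tup by (auto intro: free.span_base)
  show "wedge (map e \<gamma>s) \<noteq> 0"
  proof (rule wedge_nonzero)
    have s: "set \<gamma>s \<subseteq> \<Delta>" using xs(3) \<Delta>1_roots by blast
    show "distinct (map e \<gamma>s)" using xs(2) inj_on_subset[OF e_inj s] by (simp add: distinct_map)
    show "independent (set (map e \<gamma>s))" using e_independent(1)[OF s] by simp
  qed (use xs in simp)
qed

lemma wedge_V_weights: "wedge_V \<subseteq> free.span (\<Union>\<nu>\<in>\<Lambda>. wt_space \<nu>)"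
  unfolding wedge_V_def
proof (rule free.span_minimal[OF subsetI free.subspace_span])
  fix q assume "q \<in> wedge ` tuples V k"
  then obtain xs where xs: "q = wedge xs" "length xs = k" "set xs \<subseteq> span (e ` \<Delta>1)"
    unfolding tuples_def span_e by blast
  have "free.span (wedge ` tuples (e ` \<Delta>1) k) \<subseteq> free.span (\<Union>\<nu>\<in>\<Lambda>. wt_space \<nu>)"
  proof (rule free.span_minimal[OF subsetI free.subspace_span])
    fix p assume "p \<in> wedge ` tuples (e ` \<Delta>1) k"
    then obtain ys where ys: "p = wedge ys" "length ys = k" "set ys \<subseteq> e ` \<Delta>1"
      unfolding tuples_def by blast
    show "p \<in> free.span (\<Union>\<nu>\<in>\<Lambda>. wt_space \<nu>)"
    proof (cases "distinct ys")
      case False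
      then show ?thesis using wedge_repeated[OF ys(2)] ys(1) by (simp add: free.span_zero)
    next
      case True
      define \<gamma>s where "\<gamma>s = map (inv_into \<Delta>1 e) ys"
      have m: "map e \<gamma>s = ys" unfolding \<gamma>s_def using ys(3)
        by (auto simp: map_idI f_inv_into_f subset_iff)
      have g: "length \<gamma>s = k" "distinct \<gamma>s" "set \<gamma>s \<subseteq> \<Delta>1"
        using ys True m inv_into_into[of _ e \<Delta>1] distinct_map[of e \<gamma>s] unfolding \<gamma>s_def by auto
      note wt = wedge_root_vectors_weight[OF g]
      have "p \<in> wt_space (\<Sum>\<gamma>\<in>set \<gamma>s. \<gamma>)" using wt(1) m ys(1) by simp
      then show ?thesis using wt(2) unfolding \<Lambda>_def by (intro free.span_base) blast
    qed
  qed
  then show "q \<in> free.span (\<Union>\<nu>\<in>\<Lambda>. wt_space \<nu>)" using wedge_span[OF xs(2,3)] xs(1) by blast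
qed

lemma wt_space_independent:
  assumes F: "finite F" "F \<subseteq> t_dual" and y: "\<And>\<nu>. \<nu> \<in> F \<Longrightarrow> y \<nu> \<in> wt_space \<nu>" and s: "(\<Sum>\<nu>\<in>F. y \<nu>) = 0"
    and n: "\<nu> \<in> F"
  shows "y \<nu> = 0"
proof -
  have cm: "R h (R h' m) = R h' (R h m)" if "h \<in> t" "h' \<in> t" for h h' m
    using R_bracket[of h h' m] t_abelian[OF that] lin_zero[OF lin_R_left] by simp
  have "\<forall>\<nu>\<in>F. y \<nu> = 0"
  proof (rule M.gen_weight_independent[OF F(1) lin_R _ _ _ s])
    show "\<exists>h\<in>t. \<kappa> h \<noteq> \<mu> h" if "\<kappa> \<in> F" "\<mu> \<in> F" "\<kappa> \<noteq> \<mu>" for \<kappa> \<mu>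
      using that dual_ext[of \<kappa> \<mu>] F(2) by blast
    show "y \<nu> \<in> M.gen_weight t R \<nu>" if "\<nu> \<in> F" for \<nu>
      using y[OF that] unfolding wt_space_def M.gen_weight_def M.gen_eig_def
      by (auto intro!: exI[of _ "Suc 0"])
    show "R h v \<in> M.gen_weight t R \<nu>" if h: "h \<in> t" and v: "v \<in> M.gen_weight t R \<nu>" for h \<nu> v
    proof -
      have "((\<lambda>v. R h' v - fscale c v) ^^ n) (R h v) = R h (((\<lambda>v. R h' v - fscale c v) ^^ n) v)"
        if h': "h' \<in> t" for h' c n
        by (induction n) (simp_all add: cm[OF h h'] lin_diff[OF lin_R] lin_scale[OF lin_R])
      then show ?thesis using v unfolding M.gen_weight_def M.gen_eig_def
        by (auto simp: lin_zero[OF lin_R]) (metis lin_zero[OF lin_R])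
    qed
  qed
  then show ?thesis using n by blast
qed

lemma weight_in_\<Lambda>:
  assumes m: "m \<in> wt_space \<nu>" "m \<noteq> 0" and \<nu>: "\<nu> \<in> t_dual"
  shows "\<nu> \<in> \<Lambda>"
proof (rule ccontr)
  assume n: "\<nu> \<notin> \<Lambda>"
  have "m \<in> free.span (\<Union>\<nu>\<in>\<Lambda>. wt_space \<nu>)" using m(1) wedge_V_weights unfolding wt_space_def by blast
  then obtain F y where F: "finite F" "F \<subseteq> \<Lambda>" "\<And>\<nu>. \<nu> \<in> F \<Longrightarrow> y \<nu> \<in> wt_space \<nu>" "m = (\<Sum>\<nu>\<in>F. y \<nu>)"
    using M.span_Union_subspaces[where I = \<Lambda> and V = wt_space, OF _ subspace_wt_space] by metis
  let ?y = "y(\<nu> := - m)"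
  have nF: "\<nu> \<notin> F" using n F(2) by blast
  have "(\<Sum>\<mu>\<in>F. ?y \<mu>) = (\<Sum>\<mu>\<in>F. y \<mu>)" by (rule sum.cong[OF refl]) (use nF in auto)
  then have "(\<Sum>\<mu>\<in>insert \<nu> F. ?y \<mu>) = - m + (\<Sum>\<mu>\<in>F. y \<mu>)"
    unfolding sum.insert[OF F(1) nF] by simp
  then have z: "(\<Sum>\<mu>\<in>insert \<nu> F. ?y \<mu>) = 0" using F(4) by simp
  have "?y \<nu> = 0"
  proof (rule wt_space_independent[OF _ _ _ z])
    show "insert \<nu> F \<subseteq> t_dual" using F(2) \<Lambda>_dual \<nu> by blast
    show "?y \<mu> \<in> wt_space \<mu>" if "\<mu> \<in> insert \<nu> F" for \<mu>
      using that F(3) m(1) free.subspace_neg[OF subspace_wt_space] by auto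
  qed (use F(1) in auto)
  then show False using m(2) by simp
qed

lemma \<Lambda>_height: assumes "\<nu> \<in> \<Lambda>" shows "\<exists>j::int. \<nu> ht_vec = of_int j"
proof -
  obtain I where I: "I \<in> index_sets" "\<nu> = (\<Sum>\<gamma>\<in>I. \<gamma>)" using assms unfolding \<Lambda>_def by blast
  have "\<exists>j::int. \<gamma> ht_vec = of_int j" if "\<gamma> \<in> I" for \<gamma>
    using that I(1) \<Delta>1_roots root_height[of \<gamma>] unfolding index_sets_def by blast
  then obtain j :: "('b \<Rightarrow> 'a) \<Rightarrow> int" where j: "\<And>\<gamma>. \<gamma> \<in> I \<Longrightarrow> \<gamma> ht_vec = of_int (j \<gamma>)" by metis
  have "finite I" using I(1) finite_\<Delta>1 finite_subset unfolding index_sets_def by blast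
  then have "\<nu> ht_vec = of_int (\<Sum>\<gamma>\<in>I. j \<gamma>)" unfolding I(2) by (simp add: sum_apply j)
  then show ?thesis by blast
qed

lemma raise_wt_space:
  assumes m: "m \<in> wt_space \<nu>" and b: "\<beta> \<in> P"
  shows "R (e \<beta>) m \<in> wt_space (\<nu> + \<beta>)"
proof -
  have bR: "\<beta> \<in> \<Delta>" using b P_roots by blast
  have "R h (R (e \<beta>) m) = fscale ((\<nu> + \<beta>) h) (R (e \<beta>) m)" if h: "h \<in> t" for h
  proof -
    have "R h (R (e \<beta>) m) = R (br h (e \<beta>)) m + R (e \<beta>) (R h m)" by (simp add: R_bracket)
    also have "\<dots> = fscale (\<beta> h) (R (e \<beta>) m) + fscale (\<nu> h) (R (e \<beta>) m)"
      using m h rsD[OF sl2_pairD(3)[OF ef[OF bR]] h]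
      by (simp add: wt_space_def lin_scale[OF lin_R] lin_scale[OF lin_R_left])
    finally show ?thesis by (simp add: free.scale_left_distrib add.commute)
  qed
  moreover have "R (e \<beta>) m \<in> wedge_V" using wedge_V_stable ef_G0(1)[OF b] m unfolding wt_space_def by blast
  ultimately show ?thesis unfolding wt_space_def by blast
qed

text \<open>Among the weights carrying a nonzero vector with property \<open>Q\<close>, one of
  maximal height is a highest weight. For \<open>Q\<close> trivial this yields an eigenvalue;
  for \<open>Q\<close> membership in an eigenspace it evaluates the given one.\<close>

lemma highest_weight_vector:
  assumes start: "\<nu>0 \<in> \<Lambda>" "m0 \<in> wt_space \<nu>0" "m0 \<noteq> 0" "Q m0"
    and Q: "\<And>m \<beta>. m \<in> wedge_V \<Longrightarrow> Q m \<Longrightarrow> \<beta> \<in> P \<Longrightarrow> Q (R (e \<beta>) m)"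
  obtains I m where "I \<in> index_sets" "m \<in> wedge_V" "m \<noteq> 0" "Q m" "cas R m = fscale (of_rat (hw_value I)) m"
proof -
  let ?L = "{\<nu> \<in> \<Lambda>. \<exists>m\<in>wt_space \<nu>. m \<noteq> 0 \<and> Q m}"
  obtain hgt :: "('b \<Rightarrow> 'a) \<Rightarrow> int" where hgt: "\<And>\<nu>. \<nu> \<in> \<Lambda> \<Longrightarrow> \<nu> ht_vec = of_int (hgt \<nu>)"
    using \<Lambda>_height by metis
  have L: "finite ?L" "?L \<noteq> {}" using finite_\<Lambda> start by auto
  obtain \<nu> where \<nu>: "\<nu> \<in> ?L" "\<And>\<mu>. \<mu> \<in> ?L \<Longrightarrow> hgt \<mu> \<le> hgt \<nu>"
  proof -
    have "Max (hgt ` ?L) \<in> hgt ` ?L" using L by (intro Max_in) auto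
    then obtain \<nu> where n: "Max (hgt ` ?L) = hgt \<nu>" "\<nu> \<in> ?L" by (rule imageE)
    have "hgt \<mu> \<le> hgt \<nu>" if "\<mu> \<in> ?L" for \<mu>
      unfolding n(1)[symmetric] using that L(1) by (intro Max_ge) blast+
    then show ?thesis using that[OF n(2)] by blast
  qed
  then obtain m where m: "m \<in> wt_space \<nu>" "m \<noteq> 0" "Q m" by blast
  have mL: "m \<in> wedge_V" using m(1) unfolding wt_space_def by blast
  have kill: "R (e \<beta>) m = 0" if b: "\<beta> \<in> P" for \<beta>
  proof (rule ccontr)
    assume nz: "R (e \<beta>) m \<noteq> 0"
    have d: "\<nu> + \<beta> \<in> t_dual" using \<nu>(1) \<Lambda>_dual b P_roots root_dual by (blast intro: dual_add)
    have in\<Lambda>: "\<nu> + \<beta> \<in> \<Lambda>" by (rule weight_in_\<Lambda>[OF raise_wt_space[OF m(1) b] nz d])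
    then have "\<nu> + \<beta> \<in> ?L" using raise_wt_space[OF m(1) b] nz Q[OF mL m(3) b] by blast
    then have le: "hgt (\<nu> + \<beta>) \<le> hgt \<nu>" by (rule \<nu>(2))
    obtain j :: int where j: "j > 0" "\<beta> ht_vec = of_int j" using b unfolding P_def by blast
    have "(of_int (hgt (\<nu> + \<beta>)) :: 'a) = of_int (hgt \<nu> + j)"
      using hgt[OF in\<Lambda>] hgt[of \<nu>] \<nu>(1) j(2) by simp
    then have "hgt (\<nu> + \<beta>) = hgt \<nu> + j" by (simp only: of_int_eq_iff)
    then show False using le j(1) by simp
  qed
  obtain I where I: "I \<in> index_sets" "\<nu> = (\<Sum>\<gamma>\<in>I. \<gamma>)" using \<nu>(1) unfolding \<Lambda>_def by blast
  have "cas R m = fscale (hw_scalar \<nu>) m + fscale 2 (\<Sum>\<beta>\<in>P. R (f \<beta>) (R (e \<beta>) m))"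
    using m(1) \<nu>(1) \<Lambda>_dual by (intro cas_weight[OF rep_on_R]) (auto simp: wt_space_def)
  also have "(\<Sum>\<beta>\<in>P. R (f \<beta>) (R (e \<beta>) m)) = 0" using kill by (simp add: lin_zero[OF lin_R])
  also have "hw_scalar \<nu> = of_rat (hw_value I)" unfolding I(2)
    using I(1) finite_\<Delta>1 \<Delta>1_roots finite_subset unfolding index_sets_def by (intro hw_scalar_sum) blast+
  finally show ?thesis using that[OF I(1) mL m(2,3)] by simp
qed

text \<open>The Casimir element preserves the weight spaces, so a weight component of an
  eigenvector is an eigenvector; from it a highest weight vector in the same eigenspace is
  reached.\<close>

lemma eigenvalue_index_set:
  assumes m: "m \<in> wedge_V" "m \<noteq> 0" "cas R m = fscale \<mu> m"
  obtains I where "I \<in> index_sets" "\<mu> = of_rat (hw_value I)"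
proof -
  note C = linear_cas[OF rep_on_R]
  have Cw: "cas R y \<in> wt_space \<nu>" if "y \<in> wt_space \<nu>" for y \<nu>
  proof -
    have "R h (cas R y) = fscale (\<nu> h) (cas R y)" if h: "h \<in> t" for h
      using cas_commute[OF rep_on_R, of h y] t_G0 h \<open>y \<in> wt_space \<nu>\<close>
      by (auto simp: wt_space_def lin_scale[OF C])
    then show ?thesis using cas_wedge_V that unfolding wt_space_def by blast
  qed
  have "m \<in> free.span (\<Union>\<nu>\<in>\<Lambda>. wt_space \<nu>)" using m(1) wedge_V_weights by blast
  then obtain F y where F: "finite F" "F \<subseteq> \<Lambda>" "\<And>\<nu>. \<nu> \<in> F \<Longrightarrow> y \<nu> \<in> wt_space \<nu>" "m = (\<Sum>\<nu>\<in>F. y \<nu>)"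
    using M.span_Union_subspaces[where I = \<Lambda> and V = wt_space, OF _ subspace_wt_space] by metis
  let ?z = "\<lambda>\<nu>. cas R (y \<nu>) - fscale \<mu> (y \<nu>)"
  have "(\<Sum>\<nu>\<in>F. ?z \<nu>) = cas R m - fscale \<mu> m"
    unfolding F(4) by (simp add: lin_sum[OF C] free.scale_sum_right sum_subtractf)
  then have z0: "(\<Sum>\<nu>\<in>F. ?z \<nu>) = 0" using m(3) by simp
  have zero: "?z \<nu> = 0" if "\<nu> \<in> F" for \<nu>
  proof (rule wt_space_independent[OF F(1) _ _ z0 that])
    show "F \<subseteq> t_dual" using F(2) \<Lambda>_dual by blast
    show "?z \<nu> \<in> wt_space \<nu>" if "\<nu> \<in> F" for \<nu>
      using Cw[OF F(3)[OF that]] F(3)[OF that]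
      by (intro free.subspace_diff[OF subspace_wt_space] free.subspace_scale[OF subspace_wt_space])
  qed
  have "\<exists>\<nu>\<in>F. y \<nu> \<noteq> 0" using m(2) F(4) by (metis sum.neutral)
  then obtain \<nu> where n: "\<nu> \<in> F" "y \<nu> \<noteq> 0" by blast
  have Cy: "cas R (y \<nu>) = fscale \<mu> (y \<nu>)" using zero[OF n(1)] by simp
  obtain I m' where I: "I \<in> index_sets" "m' \<noteq> 0" "cas R m' = fscale \<mu> m'" "cas R m' = fscale (of_rat (hw_value I)) m'"
  proof (rule highest_weight_vector[of \<nu> "y \<nu>" "\<lambda>m. cas R m = fscale \<mu> m"])
    show "cas R (R (e \<beta>) m) = fscale \<mu> (R (e \<beta>) m)" if "cas R m = fscale \<mu> m" "\<beta> \<in> P" for m \<beta>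
      using cas_commute[OF rep_on_R ef_G0(1)[OF that(2)], of m] that(1) by (simp add: lin_scale[OF lin_R])
  qed (use n F(2,3) Cy in auto)
  then have "\<mu> = of_rat (hw_value I)" using free.scale_cancel_right by metis
  then show ?thesis using that I(1) by blast
qed

abbreviation "evs \<equiv> ext_eigenvalues B d V k"

lemma evs_eq: "evs = {\<mu>. \<exists>m\<in>wedge_V. m \<noteq> 0 \<and> cas R m = fscale \<mu> m}"
  unfolding wedge_V_def
  by (rule ext_eigenvalues_wedge[OF subspace_V]) (use B G0_br_V in blast)+

lemma evs_rational: "\<mu> \<in> evs \<Longrightarrow> \<exists>I\<in>index_sets. \<mu> = of_rat (hw_value I)"
  unfolding evs_eq using eigenvalue_index_set by blast

lemma evs_nonempty:
  assumes "k \<le> dim V"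
  shows "\<exists>I\<in>index_sets. of_rat (hw_value I) \<in> evs"
proof -
  obtain I where I: "I \<subseteq> \<Delta>1" "card I = k"
    using assms unfolding dim_V by (meson obtain_subset_with_card_n)
  then obtain \<gamma>s where g: "set \<gamma>s = I" "distinct \<gamma>s"
    using finite_distinct_list finite_\<Delta>1 finite_subset by metis
  then have l: "length \<gamma>s = k" using I(2) distinct_card by metis
  note wt = wedge_root_vectors_weight[OF l g(2), unfolded g(1), OF I(1)]
  obtain I' m where "I' \<in> index_sets" "m \<in> wedge_V" "m \<noteq> 0" "cas R m = fscale (of_rat (hw_value I')) m"
    by (rule highest_weight_vector[of "\<Sum>\<gamma>\<in>I. \<gamma>" "wedge (map e \<gamma>s)" "\<lambda>_. True"])
      (use wt in \<open>auto simp: \<Lambda>_def\<close>)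
  then show ?thesis unfolding evs_eq by blast
qed

lemma max_ext_eigenvalue:
  assumes "k \<le> dim V"
  obtains I where "I \<in> index_sets" "max_ext_eigenvalue B d V k = hw_value I"
    "\<And>q. of_rat q \<in> evs \<Longrightarrow> q \<le> hw_value I"
proof -
  let ?E = "{q. of_rat q \<in> evs}"
  have sub: "?E \<subseteq> hw_value ` index_sets" using evs_rational by fastforce
  then have fin: "finite ?E" using finite_index_sets finite_subset by blast
  have ne: "?E \<noteq> {}" using evs_nonempty[OF assms] by blast
  have mx: "Max ?E \<in> ?E" by (rule Max_in[OF fin ne])
  then obtain I where I: "I \<in> index_sets" "Max ?E = hw_value I" using sub by blast
  have "max_ext_eigenvalue B d V k = Max ?E"
    unfolding max_ext_eigenvalue_def
  proof (rule the_equality)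
    have "\<exists>r\<le>Max ?E. \<mu> = of_rat r" if "\<mu> \<in> evs" for \<mu>
    proof -
      obtain J where "\<mu> = of_rat (hw_value J)" using evs_rational[OF \<open>\<mu> \<in> evs\<close>] by blast
      then show ?thesis using that Max_ge[OF fin, of "hw_value J"] by auto
    qed
    then show "of_rat (Max ?E) \<in> evs \<and> (\<forall>\<mu>\<in>evs. \<exists>r\<le>Max ?E. \<mu> = of_rat r)" using mx by blast
    fix q assume q: "of_rat q \<in> evs \<and> (\<forall>\<mu>\<in>evs. \<exists>r\<le>q. \<mu> = of_rat r)"
    then obtain r where "r \<le> q" "(of_rat (Max ?E) :: 'a) = of_rat r" using mx by blast
    then have "Max ?E \<le> q" by simp
    moreover have "q \<le> Max ?E" using Max_ge[OF fin] q by simp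
    ultimately show "q = Max ?E" by simp
  qed
  then show ?thesis using that[of I] I Max_ge[OF fin] by simp
qed

section \<open>Abelian subspaces\<close>

lemma f_bracket_G0:
  assumes "x \<in> V" "\<gamma> \<in> \<Delta>1"
  shows "br x (f \<gamma>) \<in> G0"
proof -
  have "\<gamma> \<in> \<Delta>" "\<gamma> cowt = 1" using assms(2) unfolding \<Delta>1_def by auto
  then have "br cowt (f \<gamma>) = - f \<gamma>" using rsD[OF sl2_pairD(4)[OF ef] cowt(1), of \<gamma>] by simp
  then show ?thesis using assms(1) unfolding G0_def V_def
    by (simp add: br_deriv[of cowt x] br_neg)
qed

lemma self_negative_zero:
  fixes s :: "'m \<Rightarrow>\<^sub>0 'a"
  assumes "s = - s"
  shows "s = 0"
proof -
  have "fscale 2 s = s + s" using free.scale_left_distrib[of 1 1 s] by simp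
  also have "\<dots> = 0" using assms by (simp add: eq_neg_iff_add_eq_0)
  finally show ?thesis by simp
qed

text \<open>Expanding in root vectors gives coefficients \<open>\<Phi>([x, f\<^sub>\<gamma>],
  [y, f\<^sub>\<delta>])\<close>, which are symmetric in \<open>\<gamma>\<close> and
  \<open>\<delta>\<close> when \<open>[x, y] = 0\<close>, against values of an alternating
  form.\<close>

lemma alternating_casimir_zero:
  fixes \<omega> :: "'b \<Rightarrow> 'b \<Rightarrow> ('b list \<Rightarrow>\<^sub>0 'a)"
  assumes w1: "\<And>v. Vector_Spaces.linear scale fscale (\<lambda>u. \<omega> u v)"
    and w2: "\<And>u. Vector_Spaces.linear scale fscale (\<omega> u)"
    and alt: "\<And>u v. \<omega> u v = - \<omega> v u"
    and xy: "x \<in> V" "y \<in> V" "br x y = 0"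
  shows "(\<Sum>b\<in>B. \<omega> (br b x) (br (d b) y)) = 0"
proof -
  define K where "K \<gamma> \<delta> = killing (br x (f \<gamma>)) (br y (f \<delta>))" for \<gamma> \<delta>
  have Ksym: "K \<gamma> \<delta> = K \<delta> \<gamma>" for \<gamma> \<delta>
    using killing_quadratic[of x "f \<gamma>" y "f \<delta>"] xy(3) unfolding K_def by simp
  have expand: "\<omega> (br b x) (br (d b) y) =
    (\<Sum>\<gamma>\<in>\<Delta>1. \<Sum>\<delta>\<in>\<Delta>1. fscale (killing b (br x (f \<gamma>)) * killing (d b) (br y (f \<delta>))) (\<omega> (e \<gamma>) (e \<delta>)))"
    if b: "b \<in> B" for b
  proof -
    have bG: "b \<in> G0" "d b \<in> G0" using b B by auto
    have "\<omega> (br b x) (br (d b) y) = \<omega> (\<Sum>\<gamma>\<in>\<Delta>1. killing (f \<gamma>) (br b x) *s e \<gamma>) (\<Sum>\<delta>\<in>\<Delta>1. killing (f \<delta>) (br (d b) y) *s e \<delta>)"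
      using V_expansion[OF G0_br_V[OF bG(1) xy(1)]] V_expansion[OF G0_br_V[OF bG(2) xy(2)]] by simp
    also have "\<dots> = (\<Sum>\<gamma>\<in>\<Delta>1. fscale (killing (f \<gamma>) (br b x))
        (\<omega> (e \<gamma>) (\<Sum>\<delta>\<in>\<Delta>1. killing (f \<delta>) (br (d b) y) *s e \<delta>)))"
      by (simp only: lin_sum[OF w1] lin_scale[OF w1])
    also have "\<dots> = (\<Sum>\<gamma>\<in>\<Delta>1. fscale (killing (f \<gamma>) (br b x)) (\<Sum>\<delta>\<in>\<Delta>1. fscale (killing (f \<delta>) (br (d b) y)) (\<omega> (e \<gamma>) (e \<delta>))))"
      by (simp only: lin_sum[OF w2] lin_scale[OF w2])
    also have "\<dots> = (\<Sum>\<gamma>\<in>\<Delta>1. \<Sum>\<delta>\<in>\<Delta>1. fscale (killing b (br x (f \<gamma>)) * killing (d b) (br y (f \<delta>))) (\<omega> (e \<gamma>) (e \<delta>)))"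
      by (simp add: free.scale_sum_right killing_sym[of "f _"] killing_inv)
    finally show ?thesis .
  qed
  let ?S = "\<Sum>\<gamma>\<in>\<Delta>1. \<Sum>\<delta>\<in>\<Delta>1. fscale (K \<gamma> \<delta>) (\<omega> (e \<gamma>) (e \<delta>))"
  have "(\<Sum>b\<in>B. \<omega> (br b x) (br (d b) y)) = (\<Sum>b\<in>B. \<Sum>\<gamma>\<in>\<Delta>1. \<Sum>\<delta>\<in>\<Delta>1.
      fscale (killing b (br x (f \<gamma>)) * killing (d b) (br y (f \<delta>))) (\<omega> (e \<gamma>) (e \<delta>)))"
    by (rule sum.cong[OF refl expand])
  also have "\<dots> = (\<Sum>\<gamma>\<in>\<Delta>1. \<Sum>\<delta>\<in>\<Delta>1. \<Sum>b\<in>B.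
      fscale (killing b (br x (f \<gamma>)) * killing (d b) (br y (f \<delta>))) (\<omega> (e \<gamma>) (e \<delta>)))"
    by (subst sum.swap, rule sum.cong[OF refl], rule sum.swap)
  also have "\<dots> = ?S"
  proof (intro sum.cong refl)
    fix \<gamma> \<delta> assume g: "\<gamma> \<in> \<Delta>1" "\<delta> \<in> \<Delta>1"
    have "K \<gamma> \<delta> = killing (br x (f \<gamma>)) (\<Sum>b\<in>B. killing (d b) (br y (f \<delta>)) *s b)"
      unfolding K_def using B_expansion[OF f_bracket_G0[OF xy(2) g(2)]] by simp
    also have "\<dots> = (\<Sum>b\<in>B. killing b (br x (f \<gamma>)) * killing (d b) (br y (f \<delta>)))"
      by (simp add: killing_sum killing_scale killing_sym[of "br x (f \<gamma>)"] mult.commute)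
    finally show "(\<Sum>b\<in>B. fscale (killing b (br x (f \<gamma>)) * killing (d b) (br y (f \<delta>))) (\<omega> (e \<gamma>) (e \<delta>)))
      = fscale (K \<gamma> \<delta>) (\<omega> (e \<gamma>) (e \<delta>))" by (simp add: free.scale_sum_left)
  qed
  also have "?S = 0"
  proof -
    have "?S = (\<Sum>\<delta>\<in>\<Delta>1. \<Sum>\<gamma>\<in>\<Delta>1. fscale (K \<gamma> \<delta>) (\<omega> (e \<gamma>) (e \<delta>)))" by (rule sum.swap)
    also have "\<dots> = (\<Sum>\<delta>\<in>\<Delta>1. \<Sum>\<gamma>\<in>\<Delta>1. - fscale (K \<delta> \<gamma>) (\<omega> (e \<delta>) (e \<gamma>)))"
    proof (intro sum.cong refl)
      fix \<gamma> \<delta>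
      have "fscale (K \<gamma> \<delta>) (\<omega> (e \<gamma>) (e \<delta>)) = fscale (K \<delta> \<gamma>) (- \<omega> (e \<delta>) (e \<gamma>))"
        using alt Ksym by metis
      then show "fscale (K \<gamma> \<delta>) (\<omega> (e \<gamma>) (e \<delta>)) = - fscale (K \<delta> \<gamma>) (\<omega> (e \<delta>) (e \<gamma>))" by simp
    qed
    also have "\<dots> = - ?S" by (simp add: sum_negf)
    finally show ?thesis by (rule self_negative_zero)
  qed
  finally show ?thesis .
qed

lemma abelian_eigenvector:
  assumes xs: "length xs = k" "set xs \<subseteq> V" and ab: "\<And>x y. x \<in> set xs \<Longrightarrow> y \<in> set xs \<Longrightarrow> br x y = 0"
  shows "cas R (wedge xs) = fscale (of_rat (of_nat k * root_scalar \<alpha>)) (wedge xs)"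
proof -
  have "cas R (wedge xs) = (\<Sum>b\<in>B. (\<Sum>i<k. wedge (xs[i := br (d b) (br b (xs ! i))]))
    + (\<Sum>i<k. \<Sum>j\<in>{..<k} - {i}. wedge (xs[i := br b (xs ! i), j := br (d b) (xs ! j)])))"
    unfolding casimir_def R_wedge[OF xs(1)] R_wedge_act[OF xs(1)] ..
  also have "\<dots> = (\<Sum>i<k. \<Sum>b\<in>B. wedge (xs[i := br (d b) (br b (xs ! i))]))
    + (\<Sum>i<k. \<Sum>j\<in>{..<k} - {i}. \<Sum>b\<in>B. wedge (xs[i := br b (xs ! i), j := br (d b) (xs ! j)]))"
    unfolding sum.distrib by (simp add: sum.swap[of _ B])
  also have "(\<Sum>i<k. \<Sum>j\<in>{..<k} - {i}. \<Sum>b\<in>B. wedge (xs[i := br b (xs ! i), j := br (d b) (xs ! j)])) = 0"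
  proof (rule sum.neutral, rule ballI, rule sum.neutral, rule ballI)
    fix i j assume "i \<in> {..<k}" "j \<in> {..<k} - {i}"
    then have ij: "i < k" "j < k" "i \<noteq> j" by auto
    have m: "xs ! i \<in> set xs" "xs ! j \<in> set xs" using ij xs(1) by auto
    let ?\<omega> = "\<lambda>u v. wedge (xs[i := u, j := v])"
    have w1: "Vector_Spaces.linear scale fscale (\<lambda>u. ?\<omega> u v)" for v
      using lin_wedge[of "xs[j := v]" i] ij xs(1) by (simp add: list_update_swap[of i j])
    have w2: "Vector_Spaces.linear scale fscale (?\<omega> u)" for u
      using lin_wedge[of "xs[i := u]" j] ij xs(1) by simp
    show "(\<Sum>b\<in>B. wedge (xs[i := br b (xs ! i), j := br (d b) (xs ! j)])) = 0"
      by (rule alternating_casimir_zero[of ?\<omega>, OF w1 w2 wedge_swap[OF xs(1) ij]])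
        (use m xs(2) ab in auto)
  qed
  also have "(\<Sum>i<k. \<Sum>b\<in>B. wedge (xs[i := br (d b) (br b (xs ! i))]))
    = (\<Sum>i<k. fscale (of_rat (root_scalar \<alpha>)) (wedge xs))"
  proof (rule sum.cong[OF refl])
    fix i assume i: "i \<in> {..<k}"
    then have l: "Vector_Spaces.linear scale fscale (\<lambda>a. wedge (xs[i := a]))" using lin_wedge xs(1) by simp
    have "(\<Sum>b\<in>B. wedge (xs[i := br (d b) (br b (xs ! i))])) = wedge (xs[i := cas br (xs ! i)])"
      unfolding casimir_def by (rule lin_sum[OF l, symmetric])
    also have "cas br (xs ! i) = of_rat (root_scalar \<alpha>) *s (xs ! i)" using i xs by (intro cas_V) auto
    finally show "(\<Sum>b\<in>B. wedge (xs[i := br (d b) (br b (xs ! i))])) = fscale (of_rat (root_scalar \<alpha>)) (wedge xs)"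
      by (simp add: lin_scale[OF l])
  qed
  finally show ?thesis by (simp add: free.sum_constant_scale of_rat_mult)
qed

section \<open>The maximal eigenvalue\<close>

theorem max_eigenvalue_bound:
  assumes k: "k \<le> dim V"
  shows "max_ext_eigenvalue B d V k \<le> of_nat k * casimir_scalar B d V"
    and "max_ext_eigenvalue B d V k = of_nat k * casimir_scalar B d V
      \<longleftrightarrow> (\<exists>a. abelian_subspace V a \<and> dim a = k)"
proof -
  obtain I where I: "I \<in> index_sets" and mx: "max_ext_eigenvalue B d V k = hw_value I"
    and ge: "\<And>q. of_rat q \<in> evs \<Longrightarrow> q \<le> hw_value I"
    using max_ext_eigenvalue[OF k] by blast
  have I1: "I \<subseteq> \<Delta>1" and Ik: "card I = k" using I unfolding index_sets_def by auto
  have IR: "I \<subseteq> \<Delta>" using I1 \<Delta>1_roots by blast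
  show le: "max_ext_eigenvalue B d V k \<le> of_nat k * casimir_scalar B d V"
    unfolding mx casimir_scalar_V using hw_value_bound(1)[OF I1] Ik by simp
  show "max_ext_eigenvalue B d V k = of_nat k * casimir_scalar B d V
      \<longleftrightarrow> (\<exists>a. abelian_subspace V a \<and> dim a = k)"
  proof
    assume "max_ext_eigenvalue B d V k = of_nat k * casimir_scalar B d V"
    then have eq: "hw_value I = of_nat (card I) * root_scalar \<alpha>" unfolding mx casimir_scalar_V Ik .
    let ?a = "span (e ` I)"
    have "br x y = 0" if "x \<in> ?a" "y \<in> ?a" for x y
    proof -
      have z: "Vector_Spaces.linear scale scale (\<lambda>_. 0)" by (simp add: Vector_Spaces.linear_iff vector_space_axioms)
      have "br x b = 0" if "b \<in> e ` I" for b
        by (rule lin_eq_on_span[OF lin_br_left z \<open>x \<in> ?a\<close>]) (use hw_value_bound(2)[OF I1 eq] that in auto)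
      then show ?thesis using lin_eq_on_span[OF lin_br z \<open>y \<in> ?a\<close>] by blast
    qed
    moreover have "?a \<subseteq> V" using e_V I1 subspace_V by (intro span_minimal) auto
    ultimately have "abelian_subspace V ?a" unfolding abelian_subspace_def by simp
    moreover have "dim ?a = k"
      using dim_span_eq_card_independent[OF e_independent(1)[OF IR]] e_independent(2)[OF IR] Ik by simp
    ultimately show "\<exists>a. abelian_subspace V a \<and> dim a = k" by blast
  next
    assume "\<exists>a. abelian_subspace V a \<and> dim a = k"
    then obtain a where a: "subspace a" "a \<subseteq> V" "\<And>x y. x \<in> a \<Longrightarrow> y \<in> a \<Longrightarrow> br x y = 0" "dim a = k"
      unfolding abelian_subspace_def by blast
    obtain A where A: "A \<subseteq> a" "independent A" "a \<subseteq> span A" "card A = dim a" by (rule basis_exists)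
    obtain xs where xs: "set xs = A" "distinct xs"
      using finite_distinct_list[OF finiteI_independent[OF A(2)]] by blast
    have l: "length xs = k" using xs A(4) a(4) distinct_card by metis
    have "cas R (wedge xs) = fscale (of_rat (of_nat k * root_scalar \<alpha>)) (wedge xs)"
    proof (rule abelian_eigenvector[OF l])
      show "set xs \<subseteq> V" using xs(1) A(1) a(2) by blast
      show "br x y = 0" if "x \<in> set xs" "y \<in> set xs" for x y
        using that xs(1) A(1) a(3)[of x y] by blast
    qed
    moreover have "wedge xs \<noteq> 0" by (rule wedge_nonzero[OF l xs(2)]) (simp add: xs(1) A(2))
    moreover have "wedge xs \<in> wedge_V" unfolding wedge_V_def tuples_def
      using l xs(1) A(1) a(2) by (intro free.span_base) auto
    ultimately have "of_rat (of_nat k * root_scalar \<alpha>) \<in> evs" unfolding evs_eq by blast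
    then have "of_nat k * root_scalar \<alpha> \<le> hw_value I" by (rule ge)
    then show "max_ext_eigenvalue B d V k = of_nat k * casimir_scalar B d V"
      using le unfolding mx casimir_scalar_V by simp
  qed
qed

end

text \<open>A Cartan subalgebra is not zero, as zero is normalised by the whole algebra; so the
  piece of degree 0 has a nonempty basis and \<open>\<Phi>\<close> is not zero.\<close>

lemma (in lie_algebra) killing_nondegenerate:
  assumes simple: is_simple and t: "cartan_subalgebra t" and dual: "dual_bases (grade t S \<alpha> 0) B d"
    and x: "\<And>y. killing x y = 0"
  shows "x = 0"
proof -
  have t0: "\<exists>h\<in>t. h \<noteq> 0"
  proof (rule ccontr)
    assume "\<not> (\<exists>h\<in>t. h \<noteq> 0)"
    then have sub: "t \<subseteq> {0}" by blast
    have t': "subspace t" "normalizer t = t" using t unfolding cartan_subalgebra_def subalgebra_def by auto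
    have tz: "t = {0}" using sub subspace_0[OF t'(1)] by blast
    have n: "x \<in> normalizer t" for x unfolding normalizer_def tz by simp
    have z: "x = 0" for x :: 'g using n[of x] unfolding t'(2) using sub by (rule subsetD[THEN singletonD, rotated])
    obtain x y where "br x y \<noteq> 0" using simple unfolding is_simple_def by (elim conjE exE)
    then show False using z[of "br x y"] by (rule notE)
  qed
  have sp: "span B = grade t S \<alpha> 0" and dl: "\<And>b c. b \<in> B \<Longrightarrow> c \<in> B \<Longrightarrow> killing (d b) c = (if b = c then 1 else 0)"
    using dual unfolding dual_bases_def by auto
  have "t \<subseteq> grade t S \<alpha> 0" unfolding grade_def by (auto intro: span_base)
  then have "B \<noteq> {}" using t0 sp by auto
  then obtain b where "b \<in> B" by blast
  then have nz: "killing (d b) b \<noteq> 0" using dl by simp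
  let ?I = "{x. \<forall>y. killing x y = 0}"
  have "ideal ?I" unfolding ideal_def
  proof (intro conjI allI ballI)
    show "subspace ?I" by (rule subspaceI) (auto simp: killing_add killing_scale)
    fix x y assume y: "y \<in> ?I"
    show "br x y \<in> ?I" using y by (simp add: killing_inv')
  qed
  moreover have "?I \<noteq> UNIV" using nz by blast
  ultimately have "?I = {0}" using simple unfolding is_simple_def by blast
  then show ?thesis using x by blast
qed

theorem theorem0p2:
  fixes scale :: "'k::{alg_closed_field, field_char_0} \<Rightarrow> 'g::ab_group_add \<Rightarrow> 'g"
    and Basis :: "'g set"
    and br :: "'g \<Rightarrow> 'g \<Rightarrow> 'g"
    and t :: "'g set"
    and S :: "('g \<Rightarrow> 'k) set"
    and \<alpha> :: "'g \<Rightarrow> 'k"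
    and B :: "'g set"
    and d :: "'g \<Rightarrow> 'g"
    and k :: nat
  defines "g \<equiv> lie_algebra.grade scale br t S \<alpha>"
  defines "\<gamma> \<equiv> lie_algebra.casimir_scalar scale br B d (g 1)"
  defines "\<delta> \<equiv> lie_algebra.max_ext_eigenvalue scale br B d (g 1)"
  assumes "lie_algebra scale Basis br"
    and "lie_algebra.is_simple scale br"
    and "lie_algebra.cartan_subalgebra scale br t"
    and "lie_algebra.simple_roots scale br t S"
    and "\<alpha> \<in> S"
    and "lie_algebra.dual_bases scale Basis br (g 0) B d"
    and "1 \<le> k" and "k \<le> vector_space.dim scale (g 1)"
  shows "\<delta> k \<le> of_nat k * \<gamma> \<and>
    (\<delta> k = of_nat k * \<gamma> \<longleftrightarrow>
      (\<exists>a. lie_algebra.abelian_subspace scale br (g 1) a \<and> vector_space.dim scale a = k))"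
proof -
  interpret L: lie_algebra scale Basis br by fact
  have dual: "L.dual_bases (L.grade t S \<alpha> 0) B d" using assms(9) unfolding g_def .
  interpret G: graded_power scale Basis br t S \<alpha> B d k
    by unfold_locales (use assms dual L.killing_nondegenerate[OF assms(5,6) dual] in auto)
  have "k \<le> L.dim G.V" using assms(11) unfolding g_def G.grade1 .
  then show ?thesis
    using G.max_eigenvalue_bound unfolding \<delta>_def \<gamma>_def g_def G.grade1 by blast
qed

end
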